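(* Let $\nu\in\mathcal{M}^{\circ,+}_{\mu,2}$ and $\phi:=\frac{d\nu}{d\mu}$. Then: (1) In $\mu^*$-probability, $$\log\frac{d\nu^*}{d\mu^*}(\omega)=\lim_{\epsilon\to0}\left(\int_{\{x:\,|\log\phi(x)|>\epsilon\}}\log\phi\,d\omega-\int_{\{x:\,|\log\phi(x)|>\epsilon\}}(\phi-1)\,d\mu\right).$$ (2) $\log\frac{d\nu^*}{d\mu^*}$ is an infinitely divisible random variable (on $(X^*,\mu^* )$) whose Lévy measure is the restriction to $\mathbb{R}\setminus\{0\}$ of the image of $\mu$ under $\log\phi$. (3) $\mathbb{E}_{\mu^*}\!\left[\log\frac{d\nu^*}{d\mu^*}\right]=-\int_X(\phi-1-\log\phi)\,d\mu\in[-\infty,0]$, and this is finite if and only if $\int_{\{x:\,|\log\phi(x)|>1\}}|\log\phi|\,d\mu<\infty$.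
   Context: $(X,\mathcal{A},\mu)$ is a standard $\sigma$-finite measure space with non-atomic $\mu$; for a $\sigma$-finite measure $\rho$, $\rho^*$ is the Poisson measure with intensity $\rho$ on the space $X^*$ of countable counting measures $\omega$ on $X$ (independent Poisson counts $N_A(\omega)=\omega(A)$ with parameter $\rho(A)$ on disjoint finite-measure sets). $\mathcal{M}^{\circ,+}_{\mu,2}$ is the set of $\sigma$-finite measures $\nu$ equivalent to $\mu$ with $\sqrt{d\nu/d\mu}-1\in L^2(\mu)$; for such $\nu$, $\nu^*\ll\mu^*$. A real random variable is infinitely divisible with Lévy measure $\sigma$ if its characteristic function is $\exp\big(-\tfrac{a^2\kappa^2}{2}+ia\delta+\int_{\mathbb{R}}(e^{iax}-1-iax1_{\{|x|\le1\}})d\sigma(x)\big)$ for some $\delta\in\mathbb R,\kappa\ge0$ and $\sigma$ with $\sigma(\{0\})=0$, $\int x^2\wedge 1\,d\sigma<\infty$. *)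

theory Defs
  imports "HOL-Probability.Probability"
begin

definition nonatomic :: "'a measure \<Rightarrow> bool" where
  "nonatomic M \<longleftrightarrow> \<not> (\<exists>A\<in>sets M. emeasure M A > 0 \<and>
      (\<forall>B\<in>sets M. B \<subseteq> A \<longrightarrow> emeasure M B = 0 \<or> emeasure M (A - B) = 0))"

text \<open>Countable counting measures on the points of type 'a, represented by their
multiplicity function with countable support.\<close>
definition counting_space :: "('a \<Rightarrow> nat) set" where
  "counting_space = {\<omega>. countable {x. \<omega> x \<noteq> 0}}"

definition cnt :: "('a \<Rightarrow> nat) \<Rightarrow> 'a set \<Rightarrow> ennreal" where
  "cnt \<omega> A = (\<integral>\<^sup>+ x. indicator A x * of_nat (\<omega> x) \<partial>count_space UNIV)"

definition cnt_integral :: "('a \<Rightarrow> nat) \<Rightarrow> ('a \<Rightarrow> real) \<Rightarrow> real" where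
  "cnt_integral \<omega> f = (LINT x|count_space UNIV. real (\<omega> x) * f x)"

definition Xstar :: "'a measure \<Rightarrow> ('a \<Rightarrow> nat) measure" where
  "Xstar M = sigma counting_space
     {{\<omega> \<in> counting_space. cnt \<omega> A = of_nat k} | A k. A \<in> sets M}"

definition poisson_measure :: "'a measure \<Rightarrow> 'a measure \<Rightarrow> ('a \<Rightarrow> nat) measure \<Rightarrow> bool" where
  "poisson_measure M \<rho> P \<longleftrightarrow>
     sets \<rho> = sets M \<and> sets P = sets (Xstar M) \<and> prob_space P \<and>
     (\<forall>(n::nat) (A::nat \<Rightarrow> 'a set) (k::nat \<Rightarrow> nat).
        (\<forall>i<n. A i \<in> sets M \<and> emeasure \<rho> (A i) < \<infinity>) \<and> disjoint_family_on A {..<n} \<longrightarrow>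
        emeasure P {\<omega> \<in> space P. \<forall>i<n. cnt \<omega> (A i) = of_nat (k i)} =
          (\<Prod>i<n. ennreal (exp (- measure \<rho> (A i)) * measure \<rho> (A i) ^ k i / fact (k i))))"

definition levy_measure :: "real measure \<Rightarrow> bool" where
  "levy_measure \<sigma> \<longleftrightarrow> sets \<sigma> = sets borel \<and> emeasure \<sigma> {0} = 0 \<and>
     (\<integral>\<^sup>+ x. ennreal (min (x\<^sup>2) 1) \<partial>\<sigma>) < \<infinity>"

text \<open>A real distribution is infinitely divisible with Levy measure sigma (Levy-Khintchine form).\<close>
definition inf_div_with_levy :: "real measure \<Rightarrow> real measure \<Rightarrow> bool" where
  "inf_div_with_levy D \<sigma> \<longleftrightarrow> levy_measure \<sigma> \<and>
     (\<exists>(\<delta>::real) (\<kappa>::real). \<kappa> \<ge> 0 \<and> (\<forall>a::real.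
        char D a = exp (- complex_of_real (a\<^sup>2 * \<kappa>\<^sup>2 / 2) + \<i> * complex_of_real (a * \<delta>)
          + (CLINT x|\<sigma>. iexp (a * x) - 1 - \<i> * complex_of_real (a * x * indicator {-1..1} x)))))"

definition ext_expectation :: "'b measure \<Rightarrow> ('b \<Rightarrow> real) \<Rightarrow> ereal" where
  "ext_expectation P f = enn2ereal (\<integral>\<^sup>+ \<omega>. ennreal (f \<omega>) \<partial>P)
                         - enn2ereal (\<integral>\<^sup>+ \<omega>. ennreal (- f \<omega>) \<partial>P)"

end

theory Submission
  imports Defs
begin

text \<open>
  For \<open>\<epsilon> > 0\<close> let \<open>h\<close> be \<open>ln \<phi>\<close> cut off to \<open>\<epsilon> < \<bar>ln \<phi>\<bar> \<le> 1/\<epsilon>\<close>: it is bounded and lives on a set of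
  finite intensity, so \<open>E exp (\<omega>(h)) = exp (\<integral> (exp h - 1))\<close> is an elementary limit of the finite-dimensional Poisson laws.
  This formula gives \<open>E Z = 1\<close> for \<open>Z = exp (\<omega>(h) - \<integral> (exp h - 1))\<close>, and shows that the Hellinger distance of two
  such variables is controlled by the \<open>L2\<close> distance of the cut-off versions of \<open>sqrt \<phi>\<close>. Hence \<open>Z\<close> converges in \<open>L1\<close>
  as \<open>\<epsilon>\<close> tends to 0, and comparing Laplace functionals identifies the limit with \<open>d\<nu>*/d\<mu>*\<close>. The limit is positive
  because the roles of \<open>\<mu>\<close> and \<open>\<nu>\<close> can be exchanged, so \<open>ln Z\<close> converges in probability, and points with
  \<open>\<bar>ln \<phi>\<bar> > 1/\<epsilon>\<close> occur with vanishing probability. The Levy-Khintchine formula is the limit of the characteristic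
  functions of \<open>ln Z\<close>. For the expectation put \<open>\<psi>(z) = z - 1 - ln z\<close>: then \<open>E \<psi>(Z) = \<integral> \<psi>(exp h) d\<mu>\<close>
  by Campbell's formula, and Fatou's lemma together with the tangent inequality of \<open>\<psi>\<close> at \<open>Z\<close>
  (using \<open>E (1/Z) = 1\<close> under \<open>\<nu>*\<close>) carries this identity over to the limit.
\<close>

section \<open>Counting measures and their measurability\<close>

text \<open>Three obstacles shape the argument. \<open>ln \<phi>\<close> is in general neither
  bounded nor integrable; only \<open>sqrt \<phi> - 1\<close> is controlled, and only in
  \<open>L2\<close>. The estimates are therefore made for square roots of densities, where Poisson
  laws have explicit Hellinger affinities, and the logarithm is taken after the limit. Next, a
  Poisson law is prescribed through finite counts on disjoint sets of finite intensity, while the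
  sigma-algebra contains the counts of all measurable sets; identifying the limit thus asks for a
  uniqueness theorem that reaches sets of infinite intensity by exhaustion. Finally, statement (1)
  is a limit over all \<epsilon>, so the \<open>L1\<close> limit comes with an error bound for each
  single \<epsilon>; almost sure convergence is extracted along one sequence only where dominated
  convergence or Fatou asks for it. Each configuration is turned into the measure
  \<open>cmeas\<close>, for which every function is measurable, so that counts and sums over points
  become ordinary measures and integrals.\<close>

definition cmeas :: "('a \<Rightarrow> nat) \<Rightarrow> 'a measure" where
  "cmeas \<omega> = density (count_space UNIV) (\<lambda>x. of_nat (\<omega> x))"

text \<open>This is 0 when the number of points in \<open>A\<close> is infinite.\<close>
definition cnt_nat :: "('a \<Rightarrow> nat) \<Rightarrow> 'a set \<Rightarrow> nat" where
  "cnt_nat \<omega> A = (\<Sum>x\<in>{x\<in>A. \<omega> x \<noteq> 0}. \<omega> x)"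

lemma sets_cmeas [simp, measurable_cong]: "sets (cmeas \<omega>) = UNIV"
  by (simp add: cmeas_def)

lemma space_cmeas [simp]: "space (cmeas \<omega>) = UNIV"
  by (simp add: cmeas_def)

lemma borel_measurable_cmeas [simp]: "f \<in> borel_measurable (cmeas \<omega>)"
  by (simp add: cmeas_def)

lemma emeasure_cmeas: "emeasure (cmeas \<omega>) A = cnt \<omega> A"
  by (simp add: cmeas_def emeasure_density cnt_def mult.commute)

lemma cnt_integral_eq_cmeas: "cnt_integral \<omega> f = integral\<^sup>L (cmeas \<omega>) f"
  unfolding cnt_integral_def cmeas_def ennreal_of_nat_eq_real_of_nat
  by (subst integral_density) auto

lemma cnt_mono: "A \<subseteq> B \<Longrightarrow> cnt \<omega> A \<le> cnt \<omega> B"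
  unfolding emeasure_cmeas[symmetric] by (rule emeasure_mono) auto

text \<open>Each support point has multiplicity at least 1, so the count dominates the cardinality
  of the support.\<close>

lemma finite_support_if_cnt_finite:
  assumes "cnt \<omega> A < \<infinity>"
  shows "finite {x\<in>A. \<omega> x \<noteq> 0}"
proof (rule ccontr)
  let ?S = "{x\<in>A. \<omega> x \<noteq> 0}"
  assume "infinite ?S"
  then have "\<infinity> = emeasure (count_space UNIV) ?S" by simp
  also have "\<dots> = (\<integral>\<^sup>+ x. indicator ?S x \<partial>count_space UNIV)" by simp
  also have "\<dots> \<le> cnt \<omega> A"
    unfolding cnt_def by (rule nn_integral_mono)
      (use of_nat_mono[where 'a=ennreal, of 1] in \<open>auto simp: indicator_def Suc_le_eq\<close>)
  finally show False using assms by simp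
qed

lemma cnt_eq_cnt_nat_if_finite_support:
  assumes "finite {x\<in>A. \<omega> x \<noteq> 0}"
  shows "cnt \<omega> A = of_nat (cnt_nat \<omega> A)"
proof -
  have "cnt \<omega> A = (\<integral>\<^sup>+ x. indicator A x * of_nat (\<omega> x) \<partial>count_space UNIV)" by (simp add: cnt_def)
  also have "\<dots> = (\<Sum>x\<in>{x\<in>A. \<omega> x \<noteq> 0}. indicator A x * of_nat (\<omega> x))"
    by (rule nn_integral_count_space'[OF assms]) (auto simp: indicator_def)
  also have "\<dots> = of_nat (cnt_nat \<omega> A)" by (simp add: cnt_nat_def)
  finally show ?thesis .
qed

lemma cnt_eq_cnt_nat: "cnt \<omega> A < \<infinity> \<Longrightarrow> cnt \<omega> A = of_nat (cnt_nat \<omega> A)"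
  by (intro cnt_eq_cnt_nat_if_finite_support finite_support_if_cnt_finite)

text \<open>An infinite count forces an infinite support, over which \<open>sum\<close> takes its
  default value 0.\<close>

lemma cnt_nat_eq_0_if_cnt_infinite: "\<not> cnt \<omega> A < \<infinity> \<Longrightarrow> cnt_nat \<omega> A = 0"
  using cnt_eq_cnt_nat_if_finite_support[of A \<omega>] unfolding cnt_nat_def by (metis (no_types, lifting) of_nat_less_top sum.infinite infinity_ennreal_def)

lemma cnt_eq_of_nat_iff: "cnt \<omega> A = of_nat k \<longleftrightarrow> cnt \<omega> A < \<infinity> \<and> cnt_nat \<omega> A = k"
  using cnt_eq_cnt_nat[of \<omega> A] by (auto simp: of_nat_less_top)

text \<open>Valid for infinite counts as well because the defaults agree: \<open>measure\<close> and
  \<open>cnt_nat\<close> are then both 0.\<close>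

lemma measure_cmeas: "measure (cmeas \<omega>) A = real (cnt_nat \<omega> A)"
proof (cases "cnt \<omega> A < \<infinity>")
  case True
  then show ?thesis using cnt_eq_cnt_nat[OF True] by (simp add: measure_def emeasure_cmeas enn2real_of_nat ennreal_of_nat_eq_real_of_nat)
next
  case False
  then show ?thesis using cnt_nat_eq_0_if_cnt_infinite[OF False] by (simp add: measure_def emeasure_cmeas not_less top_unique)
qed

section \<open>The sigma-algebra generated by counts\<close>

lemma space_Xstar [simp]: "space (Xstar M) = counting_space"
  unfolding Xstar_def by (rule space_measure_of) auto

lemma sets_Xstar: "sets (Xstar M) = sigma_sets counting_space
     {{\<omega> \<in> counting_space. cnt \<omega> A = of_nat k} | A k. A \<in> sets M}"
  unfolding Xstar_def by (rule sets_measure_of) auto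

lemma sets_cnt_eq:
  assumes "A \<in> sets M" shows "{\<omega> \<in> counting_space. cnt \<omega> A = of_nat k} \<in> sets (Xstar M)"
  unfolding sets_Xstar using assms by (intro sigma_sets.Basic) auto

text \<open>Each generator fixes one finite value; finiteness is their countable union.\<close>

lemma sets_cnt_finite:
  assumes "A \<in> sets M" shows "{\<omega> \<in> counting_space. cnt \<omega> A < \<infinity>} \<in> sets (Xstar M)"
proof -
  have "{\<omega> \<in> counting_space. cnt \<omega> A < \<infinity>} = (\<Union>k. {\<omega> \<in> counting_space. cnt \<omega> A = of_nat k})"
    using cnt_eq_cnt_nat[of _ A] by (auto simp: of_nat_less_top)
  then show ?thesis using sets_cnt_eq[OF assms] by (simp add: sets.countable_UN)
qed

lemma measurable_cnt_nat:
  assumes "A \<in> sets M" shows "(\<lambda>\<omega>. cnt_nat \<omega> A) \<in> measurable (Xstar M) (count_space UNIV)"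
proof (rule measurableI)
  fix B :: "nat set"
  \<comment> \<open>The default value makes the fibre over 0 contain the event of an infinite count
    as well.\<close>
  have "(\<lambda>\<omega>. cnt_nat \<omega> A) -` B \<inter> space (Xstar M) =
     (\<Union>k\<in>B. {\<omega> \<in> counting_space. cnt \<omega> A = of_nat k}) \<union> (if 0 \<in> B then space (Xstar M) - {\<omega> \<in> counting_space. cnt \<omega> A < \<infinity>} else {})"
    using cnt_nat_eq_0_if_cnt_infinite[of _ A] unfolding cnt_eq_of_nat_iff
    by (auto split: if_splits) (metis infinity_ennreal_def)
  also have "\<dots> \<in> sets (Xstar M)"
    using sets_cnt_eq[OF assms] sets_cnt_finite[OF assms] sets.top[of "Xstar M"] by (auto intro!: sets.Un sets.countable_UN' sets.Diff sets.top)
  finally show "(\<lambda>\<omega>. cnt_nat \<omega> A) -` B \<inter> space (Xstar M) \<in> sets (Xstar M)" .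
qed simp

lemma measurable_cnt:
  assumes "A \<in> sets M" shows "(\<lambda>\<omega>. cnt \<omega> A) \<in> borel_measurable (Xstar M)"
proof -
  have *: "(\<lambda>\<omega>. if \<omega> \<in> {\<omega> \<in> counting_space. cnt \<omega> A < \<infinity>} then of_nat (cnt_nat \<omega> A) else (\<infinity>::ennreal)) \<in> borel_measurable (Xstar M)"
    using sets.Int[OF sets_cnt_finite[OF assms] sets.top] measurable_cnt_nat[OF assms]
    by (intro measurable_If_set) (auto intro: measurable_compose)
  show ?thesis
    by (rule measurable_cong[THEN iffD1, OF _ *]) (auto simp: cnt_eq_cnt_nat not_less top_unique)
qed

text \<open>Monotone class induction, starting from the measurability of a count.
  \<open>space M = UNIV\<close> turns agreement on the space into equality of functions, which
  matters because configurations may charge any point of the type.\<close>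

lemma measurable_nn_integral_cmeas:
  assumes sp: "space M = UNIV" and f: "f \<in> borel_measurable M"
  shows "(\<lambda>\<omega>. \<integral>\<^sup>+ x. f x \<partial>cmeas \<omega>) \<in> borel_measurable (Xstar M)"
  using f
proof (induction rule: borel_measurable_induct)
  case (cong f g)
  then have "f = g" using sp by auto
  then show ?case using cong by simp
next
  case (set A)
  then show ?case using measurable_cnt[of A M] by (simp add: emeasure_cmeas)
next
  case (mult u c)
  then show ?case by (subst nn_integral_cmult) auto
next
  case (add u v)
  then show ?case by (subst nn_integral_add) auto
next
  case (seq U)
  have "(\<integral>\<^sup>+ x. (SUP i. U i) x \<partial>cmeas \<omega>) = (SUP i. \<integral>\<^sup>+ x. U i x \<partial>cmeas \<omega>)" for \<omega>
    unfolding SUP_apply by (rule nn_integral_monotone_convergence_SUP) (use seq in auto)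
  then show ?case using seq by simp
qed

text \<open>Reduces a finitely valued integrand to the counts of its level sets. The value 0 is left
  out since its level set may carry infinitely many points.\<close>

lemma integral_simple_cmeas:
  fixes F :: "'a \<Rightarrow> 'b::{banach, second_countable_topology}"
  assumes fin: "finite (range F)" and int: "(\<integral>\<^sup>+ x. norm (F x) \<partial>cmeas \<omega>) < \<infinity>"
  shows "\<And>v. v \<noteq> 0 \<Longrightarrow> cnt \<omega> (F -` {v}) < \<infinity>"
    "integral\<^sup>L (cmeas \<omega>) F = (\<Sum>v\<in>range F - {0}. real (cnt_nat \<omega> (F -` {v})) *\<^sub>R v)"
proof -
  show fc: "cnt \<omega> (F -` {v}) < \<infinity>" if "v \<noteq> 0" for v
  proof -
    \<comment> \<open>Markov's inequality: an infinite count at a nonzero value would make the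
      integral of the norm infinite.\<close>
    have "ennreal (norm v) * cnt \<omega> (F -` {v}) = (\<integral>\<^sup>+ x. ennreal (norm v) * indicator (F -` {v}) x \<partial>cmeas \<omega>)"
      by (subst nn_integral_cmult_indicator) (auto simp: emeasure_cmeas)
    also have "\<dots> \<le> (\<integral>\<^sup>+ x. norm (F x) \<partial>cmeas \<omega>)"
      by (rule nn_integral_mono) (auto simp: indicator_def)
    finally have "ennreal (norm v) * cnt \<omega> (F -` {v}) < \<infinity>" using int by simp
    then show ?thesis using that by (auto simp: ennreal_mult_less_top)
  qed
  have F: "F x = (\<Sum>v\<in>range F - {0}. indicator (F -` {v}) x *\<^sub>R v)" for x
  proof -
    have "(\<Sum>v\<in>range F - {0}. indicator (F -` {v}) x *\<^sub>R v) = (\<Sum>v\<in>range F - {0}. if v = F x then v else 0)"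
      by (rule sum.cong) (auto split: split_indicator)
    also have "\<dots> = F x" using fin by (subst sum.delta) auto
    finally show ?thesis by simp
  qed
  have "integral\<^sup>L (cmeas \<omega>) F = (\<integral>x. (\<Sum>v\<in>range F - {0}. indicator (F -` {v}) x *\<^sub>R v) \<partial>cmeas \<omega>)"
    by (rule Bochner_Integration.integral_cong[OF refl F])
  also have "\<dots> = (\<Sum>v\<in>range F - {0}. \<integral>x. indicator (F -` {v}) x *\<^sub>R v \<partial>cmeas \<omega>)"
    by (rule Bochner_Integration.integral_sum) (use fc in \<open>auto simp: emeasure_cmeas\<close>)
  also have "\<dots> = (\<Sum>v\<in>range F - {0}. real (cnt_nat \<omega> (F -` {v})) *\<^sub>R v)"
    by (rule sum.cong) (use fc in \<open>auto simp: measure_cmeas emeasure_cmeas\<close>)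
  finally show "integral\<^sup>L (cmeas \<omega>) F = (\<Sum>v\<in>range F - {0}. real (cnt_nat \<omega> (F -` {v})) *\<^sub>R v)" .
qed

lemma measurable_integral_cmeas:
  fixes h :: "'a \<Rightarrow> 'b::{banach, second_countable_topology}"
  assumes sp: "space M = UNIV" and h: "h \<in> borel_measurable M"
  shows "(\<lambda>\<omega>. integral\<^sup>L (cmeas \<omega>) h) \<in> borel_measurable (Xstar M)"
proof -
  obtain F where F: "\<And>i. simple_function M (F i)" "\<And>x. (\<lambda>i. F i x) \<longlonglongrightarrow> h x"
     "\<And>i x. norm (F i x) \<le> 2 * norm (h x)"
    using borel_measurable_implies_sequence_metric[OF h, of 0] sp by auto
  have finF: "finite (range (F i))" for i using simple_functionD(1)[OF F(1)[of i]] sp by simp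
  have setF: "F i -` {v} \<in> sets M" for i v using simple_functionD(2)[OF F(1)[of i], of "{v}"] sp by simp
  let ?I = "\<lambda>\<omega>. \<integral>\<^sup>+ x. norm (h x) \<partial>cmeas \<omega>"
  have I[measurable]: "?I \<in> borel_measurable (Xstar M)"
    by (rule measurable_nn_integral_cmeas[OF sp]) (use h in auto)
  \<comment> \<open>Where the norm has infinite integral, the Bochner integral is 0 by convention,
    while the sums over level sets need not tend to 0; the approximants are therefore set to 0
    there.\<close>
  let ?S = "\<lambda>i \<omega>. if ?I \<omega> < \<infinity> then \<Sum>v\<in>range (F i) - {0}. real (cnt_nat \<omega> (F i -` {v})) *\<^sub>R v else 0"
  have [measurable]: "(\<lambda>\<omega>. real (cnt_nat \<omega> (F i -` {v}))) \<in> borel_measurable (Xstar M)" for i v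
    by (rule measurable_compose[OF measurable_cnt_nat[OF setF]]) simp
  have meas: "?S i \<in> borel_measurable (Xstar M)" for i
    by measurable
  have conv: "(\<lambda>i. ?S i \<omega>) \<longlonglongrightarrow> integral\<^sup>L (cmeas \<omega>) h" for \<omega>
  proof (cases "?I \<omega> < \<infinity>")
    case True
    then have inth: "integrable (cmeas \<omega>) h" by (auto intro: integrableI_bounded)
    have "?S i \<omega> = integral\<^sup>L (cmeas \<omega>) (F i)" for i
    proof -
      have "(\<integral>\<^sup>+ x. norm (F i x) \<partial>cmeas \<omega>) \<le> (\<integral>\<^sup>+ x. 2 * ennreal (norm (h x)) \<partial>cmeas \<omega>)"
      proof (rule nn_integral_mono)
        fix x show "ennreal (norm (F i x)) \<le> 2 * ennreal (norm (h x))"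
          using ennreal_leI[OF F(3)[of i x]] by (simp add: ennreal_mult)
      qed
      also have "\<dots> = 2 * ?I \<omega>" by (rule nn_integral_cmult) auto
      also have "\<dots> < \<infinity>" using True by (simp add: ennreal_mult_less_top)
      finally show ?thesis using integral_simple_cmeas(2)[OF finF[of i]] True by simp
    qed
    moreover have "(\<lambda>i. integral\<^sup>L (cmeas \<omega>) (F i)) \<longlonglongrightarrow> integral\<^sup>L (cmeas \<omega>) h"
      by (rule integral_dominated_convergence[where w="\<lambda>x. 2 * norm (h x)"]) (use F inth in auto)
    ultimately show ?thesis by simp
  next
    case False
    then have "\<not> integrable (cmeas \<omega>) h" by (auto simp: integrable_iff_bounded)
    then show ?thesis using False by (simp add: not_integrable_integral_eq)
  qed
  show ?thesis by (rule borel_measurable_LIMSEQ_metric[OF meas conv])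
qed

section \<open>Independent Poisson counts and the exponential functional\<close>

text \<open>Through the bound by a count, exponentials of such integrals are dominated by
  \<open>exp C ^ cnt_nat \<omega> A\<close>, which has finite mean under a Poisson law when
  \<open>A\<close> has finite intensity.\<close>

lemma integrable_cmeas_bounded:
  fixes h :: "'a \<Rightarrow> 'b::{banach, second_countable_topology}"
  assumes fin: "cnt \<omega> A < \<infinity>" and bd: "\<And>x. norm (h x) \<le> C" and out: "\<And>x. x \<notin> A \<Longrightarrow> h x = 0"
  shows "integrable (cmeas \<omega>) h" "norm (integral\<^sup>L (cmeas \<omega>) h) \<le> C * real (cnt_nat \<omega> A)"
proof -
  have iA: "integrable (cmeas \<omega>) (\<lambda>x. C * indicator A x)"
    using fin by (auto simp: emeasure_cmeas)
  have le: "norm (h x) \<le> C * indicator A x" for x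
    using bd[of x] out[of x] by (cases "x \<in> A") auto
  show ih: "integrable (cmeas \<omega>) h"
    by (rule Bochner_Integration.integrable_bound[OF iA]) (use le in \<open>auto intro!: AE_I2 order_trans[OF _ abs_ge_self]\<close>)
  have "norm (integral\<^sup>L (cmeas \<omega>) h) \<le> (\<integral>x. norm (h x) \<partial>cmeas \<omega>)"
    by (rule integral_norm_bound)
  also have "\<dots> \<le> (\<integral>x. C * indicator A x \<partial>cmeas \<omega>)"
    by (rule integral_mono[OF integrable_norm[OF ih] iA le])
  also have "\<dots> = C * real (cnt_nat \<omega> A)" by (simp add: measure_cmeas)
  finally show "norm (integral\<^sup>L (cmeas \<omega>) h) \<le> C * real (cnt_nat \<omega> A)" .
qed

section \<open>Poisson weights and their generating function\<close>

definition poisson_prob :: "real \<Rightarrow> nat \<Rightarrow> real" where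
  "poisson_prob r k = exp (- r) * r ^ k / fact k"

lemma poisson_prob_nonneg: "0 \<le> r \<Longrightarrow> 0 \<le> poisson_prob r k"
  by (simp add: poisson_prob_def)

text \<open>Stated over a general field so that real exponential moments and characteristic
  functions come from the same series; \<open>c\<close> will be \<open>exp v\<close> for a value
  \<open>v\<close> of the integrand.\<close>

lemma poisson_prob_gf_sums:
  fixes c :: "'b::{real_normed_field, banach}"
  shows "(\<lambda>k. poisson_prob r k *\<^sub>R c ^ k) sums exp ((c - 1) * of_real r)"
proof -
  have "(\<lambda>k. exp (- r) *\<^sub>R ((c * of_real r) ^ k /\<^sub>R fact k)) sums (exp (- r) *\<^sub>R exp (c * of_real r))"
    by (intro sums_scaleR_right exp_converges)
  also have "(\<lambda>k. exp (- r) *\<^sub>R ((c * of_real r) ^ k /\<^sub>R fact k)) = (\<lambda>k. poisson_prob r k *\<^sub>R c ^ k)"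
    by (rule ext) (simp add: poisson_prob_def power_mult_distrib scaleR_conv_of_real divide_simps)
  also have "exp (- r) *\<^sub>R exp (c * of_real r) = exp ((c - 1) * of_real r)"
    by (simp add: scaleR_conv_of_real exp_of_real[symmetric] exp_add[symmetric] algebra_simps)
  finally show ?thesis .
qed

lemma poisson_prob_mean_sums: "(\<lambda>k. poisson_prob r k * real k) sums r"
proof -
  \<comment> \<open>\<open>k\<close> times the weight at \<open>k\<close> is \<open>r\<close> times
    the weight at \<open>k - 1\<close>; shifting the series of total mass 1 by one index gives the
    mean.\<close>
  have "(\<lambda>k. r * (poisson_prob r k *\<^sub>R 1 ^ k)) sums (r * exp ((1 - 1) * of_real r))"
    by (intro sums_mult poisson_prob_gf_sums)
  then have "(\<lambda>k. poisson_prob r (Suc k) * real (Suc k)) sums r"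
    by (simp add: poisson_prob_def mult_ac)
  from sums_Suc[OF this] show ?thesis by simp
qed

text \<open>The intensity is separate from \<open>M\<close>, which supplies the sigma-algebra: laws
  with different intensities then live on the same measurable space \<open>Xstar M\<close> and can
  be compared.\<close>

locale poisson_model = prob_space P + intensity: sigma_finite_measure \<rho>
  for M \<rho> :: "'a measure" and P :: "('a \<Rightarrow> nat) measure" +
  assumes space_M: "space M = UNIV" and poisson: "poisson_measure M \<rho> P"
begin

lemma sets_intensity [simp, measurable_cong]: "sets \<rho> = sets M"
  using poisson by (simp add: poisson_measure_def)

lemma space_intensity [simp]: "space \<rho> = UNIV"
  using sets_eq_imp_space_eq[OF sets_intensity] space_M by simp

lemma sets_P [measurable_cong]: "sets P = sets (Xstar M)"
  using poisson by (simp add: poisson_measure_def)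

lemma space_P [simp]: "space P = counting_space"
  using sets_eq_imp_space_eq[OF sets_P] by simp

lemma measurable_cnt_nat_P [measurable]: "A \<in> sets M \<Longrightarrow> (\<lambda>\<omega>. cnt_nat \<omega> A) \<in> measurable P (count_space UNIV)"
  using measurable_cnt_nat[of A M] by (simp add: measurable_cong_sets[OF sets_P refl])

lemma measurable_cnt_P [measurable]: "A \<in> sets M \<Longrightarrow> (\<lambda>\<omega>. cnt \<omega> A) \<in> borel_measurable P"
  using measurable_cnt[of A M] by (simp add: measurable_cong_sets[OF sets_P refl])

lemma measurable_integral_cmeas_P [measurable]:
  fixes h :: "'a \<Rightarrow> 'b::{banach, second_countable_topology}"
  shows "h \<in> borel_measurable M \<Longrightarrow> (\<lambda>\<omega>. integral\<^sup>L (cmeas \<omega>) h) \<in> borel_measurable P"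
  using measurable_integral_cmeas[OF space_M, of h] by (simp add: measurable_cong_sets[OF sets_P refl])

lemma measurable_nn_integral_cmeas_P [measurable]:
  "f \<in> borel_measurable M \<Longrightarrow> (\<lambda>\<omega>. \<integral>\<^sup>+ x. f x \<partial>cmeas \<omega>) \<in> borel_measurable P"
  using measurable_nn_integral_cmeas[OF space_M, of f] by (simp add: measurable_cong_sets[OF sets_P refl])

text \<open>Passes from initial segments of the naturals to arbitrary finite index sets, since later
  the sets are indexed by the values of a simple function.\<close>

lemma emeasure_cnt_family:
  assumes I: "finite I" and A: "\<And>i. i \<in> I \<Longrightarrow> A i \<in> sets M" "\<And>i. i \<in> I \<Longrightarrow> emeasure \<rho> (A i) < \<infinity>"
    and disj: "disjoint_family_on A I"
  shows "emeasure P {\<omega> \<in> space P. \<forall>i\<in>I. cnt \<omega> (A i) = of_nat (k i)}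
    = (\<Prod>i\<in>I. ennreal (poisson_prob (measure \<rho> (A i)) (k i)))"
proof -
  obtain f where f: "bij_betw f {..<card I} I"
    using ex_bij_betw_nat_finite[OF I] by (auto simp: atLeast0LessThan)
  then have inj: "inj_on f {..<card I}" and im: "f ` {..<card I} = I" by (auto simp: bij_betw_def)
  have "disjoint_family_on (A \<circ> f) {..<card I}"
    using disj inj im by (auto simp: disjoint_family_on_def inj_on_def) (metis IntI emptyE imageI lessThan_iff)
  moreover have "\<forall>i<card I. (A \<circ> f) i \<in> sets M \<and> emeasure \<rho> ((A \<circ> f) i) < \<infinity>"
    using A im by auto
  ultimately have "emeasure P {\<omega> \<in> space P. \<forall>i<card I. cnt \<omega> ((A \<circ> f) i) = of_nat ((k \<circ> f) i)}
    = (\<Prod>i<card I. ennreal (poisson_prob (measure \<rho> ((A \<circ> f) i)) ((k \<circ> f) i)))"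
    using poisson unfolding poisson_measure_def poisson_prob_def by blast
  also have "{\<omega> \<in> space P. \<forall>i<card I. cnt \<omega> ((A \<circ> f) i) = of_nat ((k \<circ> f) i)} = {\<omega> \<in> space P. \<forall>i\<in>I. cnt \<omega> (A i) = of_nat (k i)}"
    using im by (auto simp: image_iff) (metis im image_iff lessThan_iff)
  also have "(\<Prod>i<card I. ennreal (poisson_prob (measure \<rho> ((A \<circ> f) i)) ((k \<circ> f) i))) = (\<Prod>i\<in>I. ennreal (poisson_prob (measure \<rho> (A i)) (k i)))"
    using prod.reindex_bij_betw[OF f, of "\<lambda>i. ennreal (poisson_prob (measure \<rho> (A i)) (k i))"] by simp
  finally show ?thesis .
qed

lemma emeasure_cnt_eq:
  assumes "A \<in> sets M" "emeasure \<rho> A < \<infinity>"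
  shows "emeasure P {\<omega> \<in> space P. cnt \<omega> A = of_nat k} = ennreal (poisson_prob (measure \<rho> A) k)"
  using emeasure_cnt_family[of "{()}" "\<lambda>_. A" "\<lambda>_. k"] assms by (simp add: disjoint_family_on_def)

text \<open>The definition only gives probabilities of finite counts; they add up to 1, which leaves
  no mass for an infinite count.\<close>

lemma AE_cnt_finite:
  assumes A: "A \<in> sets M" "emeasure \<rho> A < \<infinity>"
  shows "AE \<omega> in P. cnt \<omega> A < \<infinity>"
proof -
  let ?E = "\<lambda>k. {\<omega> \<in> space P. cnt \<omega> A = of_nat k}"
  have "(\<Sum>k. emeasure P (?E k)) = emeasure P (\<Union>k. ?E k)"
  proof (rule suminf_emeasure)
    show "range ?E \<subseteq> sets P" using sets_cnt_eq[OF A(1)] by (auto simp: sets_P)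
    show "disjoint_family ?E" by (auto simp: disjoint_family_on_def)
  qed
  moreover have "(\<lambda>k. poisson_prob (measure \<rho> A) k) sums 1"
    using poisson_prob_gf_sums[of "measure \<rho> A" "1::real"] by simp
  then have "(\<Sum>k. emeasure P (?E k)) = 1"
    unfolding emeasure_cnt_eq[OF A] by (subst suminf_ennreal_eq) (auto simp: poisson_prob_nonneg)
  moreover have "(\<Union>k. ?E k) = {\<omega> \<in> space P. cnt \<omega> A < \<infinity>}"
    using cnt_eq_cnt_nat[of _ A] by (auto simp: of_nat_less_top)
  ultimately have "emeasure P {\<omega> \<in> space P. cnt \<omega> A < \<infinity>} = 1" by simp
  then have "prob {\<omega> \<in> space P. cnt \<omega> A < \<infinity>} = 1" by (simp add: measure_def)
  then have "AE \<omega> in P. \<omega> \<in> {\<omega> \<in> space P. cnt \<omega> A < \<infinity>}" by (subst AE_in_set_eq_1) (use A in measurable)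
  then show ?thesis by auto
qed

lemma prob_cnt_nat_family:
  assumes I: "finite I" and A: "\<And>i. i \<in> I \<Longrightarrow> A i \<in> sets M" "\<And>i. i \<in> I \<Longrightarrow> emeasure \<rho> (A i) < \<infinity>"
    and disj: "disjoint_family_on A I"
  shows "prob {\<omega> \<in> space P. \<forall>i\<in>I. cnt_nat \<omega> (A i) = k i} = (\<Prod>i\<in>I. poisson_prob (measure \<rho> (A i)) (k i))"
proof -
  have m: "(\<lambda>\<omega>. cnt_nat \<omega> (A i)) \<in> measurable P (count_space UNIV)" if "i \<in> I" for i using A that by measurable
  have "emeasure P {\<omega> \<in> space P. \<forall>i\<in>I. cnt_nat \<omega> (A i) = k i} = emeasure P {\<omega> \<in> space P. \<forall>i\<in>I. cnt \<omega> (A i) = of_nat (k i)}"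
  proof (rule emeasure_eq_AE)
    have "AE \<omega> in P. \<forall>i\<in>I. cnt \<omega> (A i) < \<infinity>"
      using I AE_cnt_finite A by (subst AE_finite_all) auto
    then show "AE \<omega> in P. (\<omega> \<in> {\<omega> \<in> space P. \<forall>i\<in>I. cnt_nat \<omega> (A i) = k i}) = (\<omega> \<in> {\<omega> \<in> space P. \<forall>i\<in>I. cnt \<omega> (A i) = of_nat (k i)})"
      by eventually_elim (auto simp: cnt_eq_of_nat_iff)
    show "{\<omega> \<in> space P. \<forall>i\<in>I. cnt_nat \<omega> (A i) = k i} \<in> sets P"
    proof (rule sets.sets_Collect_finite_All[OF _ I])
      fix i assume "i \<in> I"
      from measurable_sets[OF m[OF this], of "{k i}"]
      show "{\<omega> \<in> space P. cnt_nat \<omega> (A i) = k i} \<in> sets P"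
        by (simp add: vimage_def Int_def conj_commute)
    qed
    show "{\<omega> \<in> space P. \<forall>i\<in>I. cnt \<omega> (A i) = of_nat (k i)} \<in> sets P"
    proof (rule sets.sets_Collect_finite_All[OF _ I])
      fix i assume "i \<in> I"
      then show "{\<omega> \<in> space P. cnt \<omega> (A i) = of_nat (k i)} \<in> sets P"
        using sets_cnt_eq[of "A i" M "k i"] A by (simp add: sets_P)
    qed
  qed
  also have "\<dots> = ennreal (\<Prod>i\<in>I. poisson_prob (measure \<rho> (A i)) (k i))"
    by (subst emeasure_cnt_family[OF I A disj, of k]) (auto simp: prod_ennreal poisson_prob_nonneg)
  finally show ?thesis
    by (simp add: measure_def prod_nonneg poisson_prob_nonneg)
qed

lemma prob_cnt_nat:
  assumes "A \<in> sets M" "emeasure \<rho> A < \<infinity>"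
  shows "prob {\<omega> \<in> space P. cnt_nat \<omega> A = k} = poisson_prob (measure \<rho> A) k"
  using prob_cnt_nat_family[of "{()}" "\<lambda>_. A" "\<lambda>_. k"] assms by (simp add: disjoint_family_on_def)

text \<open>Singletons generate all sets of naturals, so the product formula for point probabilities
  already yields independence.\<close>

lemma indep_vars_cnt_nat:
  assumes I: "finite I" "I \<noteq> {}" and A: "\<And>i. i \<in> I \<Longrightarrow> A i \<in> sets M" "\<And>i. i \<in> I \<Longrightarrow> emeasure \<rho> (A i) < \<infinity>"
    and disj: "disjoint_family_on A I"
  shows "indep_vars (\<lambda>_. count_space UNIV) (\<lambda>i \<omega>. cnt_nat \<omega> (A i)) I"
proof -
  \<comment> \<open>The empty set makes the family of singletons closed under intersection;
    \<open>UNIV\<close> is added because the independence criterion wants the whole space among the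
    generators.\<close>
  define E where "E = insert UNIV (insert {} (range (\<lambda>k::nat. {k})))"
  have gen: "sets (count_space UNIV) = sigma_sets (space (count_space UNIV)) E"
  proof -
    have "B \<in> sigma_sets UNIV E" for B
    proof -
      have "\<Union>((\<lambda>k. {k}) ` B) \<in> sigma_sets UNIV E"
        by (rule sigma_sets_UNION) (auto simp: E_def intro!: sigma_sets.Basic)
      then show ?thesis by simp
    qed
    then show ?thesis by auto
  qed
  show ?thesis
  proof (subst indep_vars_finite[OF I(2,1) gen])
    show "random_variable (count_space UNIV) (\<lambda>\<omega>. cnt_nat \<omega> (A i))" if "i \<in> I" for i using A that by measurable
    show "Int_stable E" by (auto simp: Int_stable_def E_def)
    show "space (count_space UNIV) \<in> E" by (simp add: E_def)
    show "E \<subseteq> Pow (space (count_space UNIV))" by simp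
    show "\<forall>S\<in>I \<rightarrow> E. prob (\<Inter>j\<in>I. (\<lambda>\<omega>. cnt_nat \<omega> (A j)) -` S j \<inter> space P) = (\<Prod>j\<in>I. prob ((\<lambda>\<omega>. cnt_nat \<omega> (A j)) -` S j \<inter> space P))"
    proof
      fix S assume S: "S \<in> I \<rightarrow> E"
      show "prob (\<Inter>j\<in>I. (\<lambda>\<omega>. cnt_nat \<omega> (A j)) -` S j \<inter> space P) = (\<Prod>j\<in>I. prob ((\<lambda>\<omega>. cnt_nat \<omega> (A j)) -` S j \<inter> space P))"
      proof (cases "\<exists>j\<in>I. S j = {}")
        case True
        then have "(\<Inter>j\<in>I. (\<lambda>\<omega>. cnt_nat \<omega> (A j)) -` S j \<inter> space P) = {}" by auto
        moreover have "(\<Prod>j\<in>I. prob ((\<lambda>\<omega>. cnt_nat \<omega> (A j)) -` S j \<inter> space P)) = 0"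
          using True by (intro prod_zero[OF I(1)]) (auto intro!: bexI)
        ultimately show ?thesis by simp
      next
        case False
        \<comment> \<open>an index with \<open>S j = UNIV\<close> is handled as the event that the empty set contains no point\<close>
        define B where "B j = (if S j = UNIV then {} else A j)" for j
        define k where "k j = (if S j = UNIV then 0 else the_elem (S j))" for j
        have Sj: "(cnt_nat \<omega> (A j) \<in> S j) = (cnt_nat \<omega> (B j) = k j)" if "j \<in> I" for j \<omega>
        proof -
          have "S j = UNIV \<or> (\<exists>n. S j = {n})" using S False that by (auto simp: E_def Pi_iff)
          moreover have "{n} \<noteq> (UNIV :: nat set)" for n :: nat by (metis finite.emptyI finite.insertI infinite_UNIV_nat)
          ultimately show ?thesis by (auto simp: B_def k_def cnt_nat_def)
        qed
        have B: "\<And>i. i \<in> I \<Longrightarrow> B i \<in> sets M" "\<And>i. i \<in> I \<Longrightarrow> emeasure \<rho> (B i) < \<infinity>" "disjoint_family_on B I"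
          using A disj by (auto simp: B_def disjoint_family_on_def)
        have all: "(\<Inter>j\<in>I. (\<lambda>\<omega>. cnt_nat \<omega> (A j)) -` S j \<inter> space P) = {\<omega> \<in> space P. \<forall>j\<in>I. cnt_nat \<omega> (B j) = k j}"
          using Sj I(2) by auto
        have one: "(\<lambda>\<omega>. cnt_nat \<omega> (A j)) -` S j \<inter> space P = {\<omega> \<in> space P. cnt_nat \<omega> (B j) = k j}" if "j \<in> I" for j
          using Sj[OF that] by auto
        have "(\<Prod>j\<in>I. prob ((\<lambda>\<omega>. cnt_nat \<omega> (A j)) -` S j \<inter> space P)) = (\<Prod>j\<in>I. poisson_prob (measure \<rho> (B j)) (k j))"
          by (rule prod.cong) (simp_all only: one prob_cnt_nat[OF B(1,2)])
        then show ?thesis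
          unfolding all using prob_cnt_nat_family[OF I(1) B, of k] by simp
      qed
    qed
  qed
qed

lemma integral_cnt_nat:
  fixes f :: "nat \<Rightarrow> 'b::{banach, second_countable_topology}"
  assumes A: "A \<in> sets M" "emeasure \<rho> A < \<infinity>"
    and sm: "summable (\<lambda>k. poisson_prob (measure \<rho> A) k * norm (f k))"
  shows "integrable P (\<lambda>\<omega>. f (cnt_nat \<omega> A))" "(\<integral>\<omega>. f (cnt_nat \<omega> A) \<partial>P) = (\<Sum>k. poisson_prob (measure \<rho> A) k *\<^sub>R f k)"
proof -
  let ?p = "poisson_prob (measure \<rho> A)"
  have d: "distr P (count_space UNIV) (\<lambda>\<omega>. cnt_nat \<omega> A) = density (count_space UNIV) (\<lambda>k. ennreal (?p k))"
  proof (rule measure_eqI_countable[where A=UNIV])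
    fix a :: nat assume "a \<in> UNIV"
    have "emeasure (distr P (count_space UNIV) (\<lambda>\<omega>. cnt_nat \<omega> A)) {a} = emeasure P ((\<lambda>\<omega>. cnt_nat \<omega> A) -` {a} \<inter> space P)"
      by (rule emeasure_distr) (use A in auto)
    also have "(\<lambda>\<omega>. cnt_nat \<omega> A) -` {a} \<inter> space P = {\<omega> \<in> space P. cnt_nat \<omega> A = a}" by auto
    also have "emeasure P {\<omega> \<in> space P. cnt_nat \<omega> A = a} = ennreal (?p a)"
      using prob_cnt_nat[OF A, of a] by (simp add: emeasure_eq_measure)
    finally show "emeasure (distr P (count_space UNIV) (\<lambda>\<omega>. cnt_nat \<omega> A)) {a} = emeasure (density (count_space UNIV) (\<lambda>k. ennreal (?p k))) {a}"
      by (simp add: emeasure_density)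
  qed auto
  have nn: "0 \<le> ?p k" for k by (simp add: poisson_prob_nonneg)
  have int: "integrable (count_space UNIV) (\<lambda>k. ?p k *\<^sub>R f k)"
    using sm nn by (simp add: integrable_count_space_nat_iff)
  have "integrable (distr P (count_space UNIV) (\<lambda>\<omega>. cnt_nat \<omega> A)) f"
    unfolding d using int nn by (subst integrable_density) auto
  then show "integrable P (\<lambda>\<omega>. f (cnt_nat \<omega> A))"
    by (subst (asm) integrable_distr_eq) (use A in auto)
  have "(\<integral>\<omega>. f (cnt_nat \<omega> A) \<partial>P) = integral\<^sup>L (distr P (count_space UNIV) (\<lambda>\<omega>. cnt_nat \<omega> A)) f"
    by (subst integral_distr) (use A in auto)
  also have "\<dots> = (\<integral>k. ?p k *\<^sub>R f k \<partial>count_space UNIV)"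
    unfolding d using nn by (subst integral_density) auto
  also have "\<dots> = (\<Sum>k. ?p k *\<^sub>R f k)" by (rule integral_count_space_nat[OF int])
  finally show "(\<integral>\<omega>. f (cnt_nat \<omega> A) \<partial>P) = (\<Sum>k. ?p k *\<^sub>R f k)" .
qed

lemma integral_power_cnt_nat:
  fixes c :: "'b::{real_normed_field, banach, second_countable_topology}"
  assumes A: "A \<in> sets M" "emeasure \<rho> A < \<infinity>"
  shows "integrable P (\<lambda>\<omega>. c ^ cnt_nat \<omega> A)" "(\<integral>\<omega>. c ^ cnt_nat \<omega> A \<partial>P) = exp ((c - 1) * of_real (measure \<rho> A))"
proof -
  have "summable (\<lambda>k. poisson_prob (measure \<rho> A) k * norm (c ^ k))"
    using sums_summable[OF poisson_prob_gf_sums[of "measure \<rho> A" "norm c"]] by (simp add: norm_power)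
  note * = integral_cnt_nat[OF A this]
  show "integrable P (\<lambda>\<omega>. c ^ cnt_nat \<omega> A)" by (rule *)
  show "(\<integral>\<omega>. c ^ cnt_nat \<omega> A \<partial>P) = exp ((c - 1) * of_real (measure \<rho> A))"
    using *(2) sums_unique[OF poisson_prob_gf_sums[of "measure \<rho> A" c]] by simp
qed

section \<open>Campbell's formula\<close>

lemma nn_integral_cnt_finite:
  assumes A: "A \<in> sets M" "emeasure \<rho> A < \<infinity>"
  shows "(\<integral>\<^sup>+ \<omega>. cnt \<omega> A \<partial>P) = emeasure \<rho> A"
proof -
  have sm: "summable (\<lambda>k. poisson_prob (measure \<rho> A) k * norm (real k))"
    using sums_summable[OF poisson_prob_mean_sums] by simp
  have "(\<integral>\<^sup>+ \<omega>. cnt \<omega> A \<partial>P) = (\<integral>\<^sup>+ \<omega>. ennreal (real (cnt_nat \<omega> A)) \<partial>P)"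
    using AE_cnt_finite[OF A] by (intro nn_integral_cong_AE) (auto simp: cnt_eq_cnt_nat ennreal_of_nat_eq_real_of_nat)
  also have "\<dots> = ennreal (\<integral>\<omega>. real (cnt_nat \<omega> A) \<partial>P)"
    by (rule nn_integral_eq_integral[OF integral_cnt_nat(1)[OF A sm]]) auto
  also have "(\<integral>\<omega>. real (cnt_nat \<omega> A) \<partial>P) = measure \<rho> A"
    using integral_cnt_nat(2)[OF A sm] sums_unique[OF poisson_prob_mean_sums[of "measure \<rho> A"]] by simp
  finally show ?thesis using A by (simp add: emeasure_eq_ennreal_measure)
qed

text \<open>Sigma-finiteness cuts \<open>A\<close> into countably many disjoint pieces of finite
  intensity, and both sides are countably additive.\<close>

lemma nn_integral_cnt:
  assumes A: "A \<in> sets M"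
  shows "(\<integral>\<^sup>+ \<omega>. cnt \<omega> A \<partial>P) = emeasure \<rho> A"
proof -
  obtain D :: "nat \<Rightarrow> 'a set" where D: "range D \<subseteq> sets \<rho>" "(\<Union>i. D i) = space \<rho>" "\<And>i. emeasure \<rho> (D i) \<noteq> \<infinity>" "disjoint_family D"
    by (rule intensity.sigma_finite_disjoint) auto
  define C where "C i = A \<inter> D i" for i
  have C: "C i \<in> sets M" "emeasure \<rho> (C i) < \<infinity>" for i
    using A D(1) D(3)[of i] emeasure_mono[of "C i" "D i" \<rho>] by (auto simp: C_def top.not_eq_extremum intro: le_less_trans)
  have UC: "(\<Union>i. C i) = A" and dC: "disjoint_family C"
    using D(2,4) by (auto simp: C_def disjoint_family_on_def)
  have "(\<integral>\<^sup>+ \<omega>. cnt \<omega> A \<partial>P) = (\<integral>\<^sup>+ \<omega>. (\<Sum>i. cnt \<omega> (C i)) \<partial>P)"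
    unfolding emeasure_cmeas[symmetric] by (subst suminf_emeasure[OF _ dC]) (auto simp: UC)
  also have "\<dots> = (\<Sum>i. \<integral>\<^sup>+ \<omega>. cnt \<omega> (C i) \<partial>P)"
    by (rule nn_integral_suminf) (use C in measurable)
  also have "\<dots> = (\<Sum>i. emeasure \<rho> (C i))"
    by (simp add: nn_integral_cnt_finite[OF C])
  also have "\<dots> = emeasure \<rho> A" 
    by (subst suminf_emeasure[OF _ dC]) (use C UC in auto)
  finally show ?thesis .
qed

lemma nn_integral_campbell:
  assumes "f \<in> borel_measurable M"
  shows "(\<integral>\<^sup>+ \<omega>. (\<integral>\<^sup>+ x. f x \<partial>cmeas \<omega>) \<partial>P) = (\<integral>\<^sup>+ x. f x \<partial>\<rho>)"
  using assms
proof (induction rule: borel_measurable_induct)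
  case (cong f g)
  then have "f = g" using space_M by auto
  then show ?case using cong by simp
next
  case (set A)
  then show ?case using nn_integral_cnt[of A] by (simp add: emeasure_cmeas)
next
  case (mult u c)
  then show ?case by (simp add: nn_integral_cmult)
next
  case (add u v)
  then show ?case by (simp add: nn_integral_add)
next
  case (seq U)
  have "(\<integral>\<^sup>+ x. (SUP i. U i) x \<partial>cmeas \<omega>) = (SUP i. \<integral>\<^sup>+ x. U i x \<partial>cmeas \<omega>)" for \<omega>
    unfolding SUP_apply by (rule nn_integral_monotone_convergence_SUP) (use seq in auto)
  moreover have "(\<integral>\<^sup>+ \<omega>. (SUP i. \<integral>\<^sup>+ x. U i x \<partial>cmeas \<omega>) \<partial>P) = (SUP i. \<integral>\<^sup>+ \<omega>. (\<integral>\<^sup>+ x. U i x \<partial>cmeas \<omega>) \<partial>P)"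
    by (rule nn_integral_monotone_convergence_SUP)
      (use seq in \<open>auto simp: incseq_def le_fun_def intro!: nn_integral_mono\<close>)
  moreover have "(\<integral>\<^sup>+ x. (SUP i. U i) x \<partial>\<rho>) = (SUP i. \<integral>\<^sup>+ x. U i x \<partial>\<rho>)"
    unfolding SUP_apply by (rule nn_integral_monotone_convergence_SUP) (use seq in auto)
  ultimately show ?case using seq by simp
qed

lemma campbell:
  fixes h :: "'a \<Rightarrow> real"
  assumes h: "integrable \<rho> h"
  shows "integrable P (\<lambda>\<omega>. integral\<^sup>L (cmeas \<omega>) h)" "(\<integral>\<omega>. integral\<^sup>L (cmeas \<omega>) h \<partial>P) = integral\<^sup>L \<rho> h"
proof -
  have hm[measurable]: "h \<in> borel_measurable M" using h by (auto dest: borel_measurable_integrable)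
  have fin: "(\<integral>\<^sup>+ x. ennreal (norm (h x)) \<partial>\<rho>) < \<infinity>" using h by (auto simp: integrable_iff_bounded)
  define p where "p \<omega> = (\<integral>\<^sup>+ x. ennreal (h x) \<partial>cmeas \<omega>)" for \<omega>
  define n where "n \<omega> = (\<integral>\<^sup>+ x. ennreal (- h x) \<partial>cmeas \<omega>)" for \<omega>
  have pn[measurable]: "p \<in> borel_measurable P" "n \<in> borel_measurable P" unfolding p_def n_def by measurable
  have ip: "(\<integral>\<^sup>+ \<omega>. p \<omega> \<partial>P) = (\<integral>\<^sup>+ x. ennreal (h x) \<partial>\<rho>)" and jn: "(\<integral>\<^sup>+ \<omega>. n \<omega> \<partial>P) = (\<integral>\<^sup>+ x. ennreal (- h x) \<partial>\<rho>)"
    unfolding p_def n_def by (rule nn_integral_campbell; measurable)+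
  have le: "(\<integral>\<^sup>+ x. ennreal (h x) \<partial>\<rho>) < \<infinity>" "(\<integral>\<^sup>+ x. ennreal (- h x) \<partial>\<rho>) < \<infinity>"
    by (rule le_less_trans[OF nn_integral_mono fin]; simp add: ennreal_leI)+
  \<comment> \<open>Almost surely both parts are finite; there the Bochner integral is the
    difference of the two, and its default value is confined to a null set.\<close>
  have Ap: "AE \<omega> in P. p \<omega> \<noteq> \<infinity>" and An: "AE \<omega> in P. n \<omega> \<noteq> \<infinity>"
    by (rule nn_integral_PInf_AE; use ip jn le in simp)+
  have rp: "integrable P (\<lambda>\<omega>. enn2real (p \<omega>))" "integrable P (\<lambda>\<omega>. enn2real (n \<omega>))"
  proof -
    have "(\<integral>\<^sup>+ \<omega>. ennreal (norm (enn2real (p \<omega>))) \<partial>P) = (\<integral>\<^sup>+ \<omega>. p \<omega> \<partial>P)"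
      using Ap by (intro nn_integral_cong_AE) (auto simp: top.not_eq_extremum)
    then show "integrable P (\<lambda>\<omega>. enn2real (p \<omega>))" using ip le by (intro integrableI_bounded) auto
    have "(\<integral>\<^sup>+ \<omega>. ennreal (norm (enn2real (n \<omega>))) \<partial>P) = (\<integral>\<^sup>+ \<omega>. n \<omega> \<partial>P)"
      using An by (intro nn_integral_cong_AE) (auto simp: top.not_eq_extremum)
    then show "integrable P (\<lambda>\<omega>. enn2real (n \<omega>))" using jn le by (intro integrableI_bounded) auto
  qed
  have vp: "(\<integral>\<omega>. enn2real (p \<omega>) \<partial>P) = enn2real (\<integral>\<^sup>+ x. ennreal (h x) \<partial>\<rho>)"
    using Ap by (subst integral_eq_nn_integral)
      (auto simp: ip[symmetric] top.not_eq_extremum intro!: arg_cong[where f=enn2real] nn_integral_cong_AE)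
  have vn: "(\<integral>\<omega>. enn2real (n \<omega>) \<partial>P) = enn2real (\<integral>\<^sup>+ x. ennreal (- h x) \<partial>\<rho>)"
    using An by (subst integral_eq_nn_integral)
      (auto simp: jn[symmetric] top.not_eq_extremum intro!: arg_cong[where f=enn2real] nn_integral_cong_AE)
  have eq: "AE \<omega> in P. integral\<^sup>L (cmeas \<omega>) h = enn2real (p \<omega>) - enn2real (n \<omega>)"
    using Ap An
  proof eventually_elim
    case (elim \<omega>)
    then have "integrable (cmeas \<omega>) h"
      by (auto simp: real_integrable_def p_def n_def)
    then show ?case by (simp add: real_lebesgue_integral_def p_def n_def)
  qed
  have m: "(\<lambda>\<omega>. integral\<^sup>L (cmeas \<omega>) h) \<in> borel_measurable P" by measurable
  show "integrable P (\<lambda>\<omega>. integral\<^sup>L (cmeas \<omega>) h)"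
    by (subst integrable_cong_AE[OF m _ eq]) (use rp in auto)
  have "(\<integral>\<omega>. integral\<^sup>L (cmeas \<omega>) h \<partial>P) = (\<integral>\<omega>. enn2real (p \<omega>) - enn2real (n \<omega>) \<partial>P)"
    by (rule integral_cong_AE[OF m _ eq]) measurable
  also have "\<dots> = integral\<^sup>L \<rho> h" using rp vp vn h by (simp add: real_lebesgue_integral_def)
  finally show "(\<integral>\<omega>. integral\<^sup>L (cmeas \<omega>) h \<partial>P) = integral\<^sup>L \<rho> h" .
qed

section \<open>The exponential formula\<close>

lemma exp_cmeas_simple:
  fixes F :: "'a \<Rightarrow> complex"
  assumes A: "A \<in> sets M" "emeasure \<rho> A < \<infinity>" and F: "simple_function M F" and out: "\<And>x. x \<notin> A \<Longrightarrow> F x = 0"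
  shows "(\<integral>\<omega>. exp (integral\<^sup>L (cmeas \<omega>) F) \<partial>P) = exp (\<integral>x. exp (F x) - 1 \<partial>\<rho>)"
proof -
  \<comment> \<open>The value 0 is excluded: its level set contains the complement of
    \<open>A\<close>, possibly of infinite intensity, and it contributes only the factor
    \<open>exp 0 = 1\<close>.\<close>
  let ?V = "range F - {0}" and ?B = "\<lambda>v. F -` {v}"
  have fin: "finite (range F)" using simple_functionD(1)[OF F] space_M by simp
  have setB: "?B v \<in> sets M" for v using simple_functionD(2)[OF F, of "{v}"] space_M by simp
  have BA: "?B v \<subseteq> A" if "v \<noteq> 0" for v using out that by auto
  have finB: "emeasure \<rho> (?B v) < \<infinity>" if "v \<noteq> 0" for v
    using emeasure_mono[OF BA[OF that], of \<rho>] A by (auto intro: le_less_trans)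
  obtain C where C: "\<And>x. norm (F x) \<le> C"
    using finite_imp_bounded[OF fin] by (auto simp: bounded_iff)
  have ae: "AE \<omega> in P. exp (integral\<^sup>L (cmeas \<omega>) F) = (\<Prod>v\<in>?V. exp v ^ cnt_nat \<omega> (?B v))"
    using AE_cnt_finite[OF A]
  proof eventually_elim
    case (elim \<omega>)
    have "integrable (cmeas \<omega>) F" by (rule integrable_cmeas_bounded(1)[OF elim C out])
    then have "(\<integral>\<^sup>+ x. norm (F x) \<partial>cmeas \<omega>) < \<infinity>" by (auto simp: integrable_iff_bounded)
    note integral_simple_cmeas(2)[OF fin this]
    then have "exp (integral\<^sup>L (cmeas \<omega>) F) = exp (\<Sum>v\<in>?V. of_nat (cnt_nat \<omega> (?B v)) * v)" by (simp add: scaleR_conv_of_real)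
    also have "\<dots> = (\<Prod>v\<in>?V. exp v ^ cnt_nat \<omega> (?B v))" using fin by (simp add: exp_sum exp_of_nat_mult)
    finally show ?case .
  qed
  have [measurable]: "F \<in> borel_measurable M" by (rule borel_measurable_simple_function[OF F])
  have mp: "(\<lambda>\<omega>. exp v ^ cnt_nat \<omega> (?B v)) \<in> borel_measurable P" for v :: complex
    by (rule measurable_compose[OF measurable_cnt_nat_P[OF setB]]) simp
  have "(\<integral>\<omega>. exp (integral\<^sup>L (cmeas \<omega>) F) \<partial>P) = (\<integral>\<omega>. (\<Prod>v\<in>?V. exp v ^ cnt_nat \<omega> (?B v)) \<partial>P)"
    by (rule integral_cong_AE[OF _ _ ae]) (use mp in measurable)
  \<comment> \<open>The level sets are disjoint, so their counts are independent and the mean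
    factorizes. The zero function gives an empty product, which the independence lemma does not
    cover.\<close>
  also have "\<dots> = (\<Prod>v\<in>?V. \<integral>\<omega>. exp v ^ cnt_nat \<omega> (?B v) \<partial>P)"
  proof (cases "?V = {}")
    case True
    show ?thesis unfolding True using prob_space by simp
  next
    case False
    have ind: "indep_vars (\<lambda>_. count_space UNIV) (\<lambda>v \<omega>. cnt_nat \<omega> (?B v)) ?V"
      by (rule indep_vars_cnt_nat) (use False fin setB finB in \<open>auto simp: disjoint_family_on_def\<close>)
    have "indep_vars (\<lambda>_. borel) (\<lambda>v \<omega>. exp v ^ cnt_nat \<omega> (?B v)) ?V"
      by (rule indep_vars_compose2[OF ind]) auto
    then show ?thesis
      by (intro indep_vars_lebesgue_integral) (use fin setB finB integral_power_cnt_nat(1) in auto)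
  qed
  also have "\<dots> = (\<Prod>v\<in>?V. exp ((exp v - 1) * of_real (measure \<rho> (?B v))))"
    by (rule prod.cong) (use setB finB integral_power_cnt_nat(2) in auto)
  also have "\<dots> = exp (\<Sum>v\<in>?V. (exp v - 1) * of_real (measure \<rho> (?B v)))" using fin by (simp add: exp_sum)
  also have "(\<Sum>v\<in>?V. (exp v - 1) * of_real (measure \<rho> (?B v))) = (\<integral>x. exp (F x) - 1 \<partial>\<rho>)"
  proof -
    have F: "exp (F x) - 1 = (\<Sum>v\<in>?V. indicator (?B v) x *\<^sub>R (exp v - 1))" for x
    proof -
      have "(\<Sum>v\<in>?V. indicator (?B v) x *\<^sub>R (exp v - 1)) = (\<Sum>v\<in>?V. if v = F x then (exp v - 1) else 0)"
        by (rule sum.cong) (auto split: split_indicator)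
      also have "\<dots> = exp (F x) - 1" using fin by (subst sum.delta) auto
      finally show ?thesis by simp
    qed
    have "(\<integral>x. exp (F x) - 1 \<partial>\<rho>) = (\<integral>x. (\<Sum>v\<in>?V. indicator (?B v) x *\<^sub>R (exp v - 1)) \<partial>\<rho>)"
      by (rule Bochner_Integration.integral_cong[OF refl F])
    also have "\<dots> = (\<Sum>v\<in>?V. \<integral>x. indicator (?B v) x *\<^sub>R (exp v - 1) \<partial>\<rho>)"
      by (rule Bochner_Integration.integral_sum) (use setB finB in auto)
    also have "\<dots> = (\<Sum>v\<in>?V. (exp v - 1) * of_real (measure \<rho> (?B v)))"
      by (rule sum.cong) (use setB finB in \<open>auto simp: scaleR_conv_of_real\<close>)
    finally show ?thesis by simp
  qed
  finally show ?thesis .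
qed

lemma exp_cmeas_integrable:
  fixes h :: "'a \<Rightarrow> 'b::{real_normed_field, banach, second_countable_topology}"
  assumes A: "A \<in> sets M" "emeasure \<rho> A < \<infinity>" and h: "h \<in> borel_measurable M"
    and bd: "\<And>x. norm (h x) \<le> C" and out: "\<And>x. x \<notin> A \<Longrightarrow> h x = 0"
  shows "integrable P (\<lambda>\<omega>. exp (integral\<^sup>L (cmeas \<omega>) h))"
proof (rule Bochner_Integration.integrable_bound[OF integral_power_cnt_nat(1)[OF A, of "exp C"]])
  show "(\<lambda>\<omega>. exp (integral\<^sup>L (cmeas \<omega>) h)) \<in> borel_measurable P" 
    using h by measurable
  show "AE \<omega> in P. norm (exp (integral\<^sup>L (cmeas \<omega>) h)) \<le> norm (exp C ^ cnt_nat \<omega> A)"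
    using AE_cnt_finite[OF A]
  proof eventually_elim
    case (elim \<omega>)
    have "norm (exp (integral\<^sup>L (cmeas \<omega>) h)) \<le> exp (norm (integral\<^sup>L (cmeas \<omega>) h))" by (rule norm_exp)
    also have "\<dots> \<le> exp (C * real (cnt_nat \<omega> A))" using integrable_cmeas_bounded(2)[OF elim bd out] by simp
    also have "\<dots> = exp C ^ cnt_nat \<omega> A" by (simp add: exp_of_nat_mult[symmetric] mult.commute)
    finally show ?case by simp
  qed
qed

text \<open>Simple functions approximating \<open>h\<close> within \<open>2 * norm (h x)\<close>
  vanish outside \<open>A\<close> too. Hence one power of a Poisson count dominates all the
  exponentials, a multiple of the indicator of \<open>A\<close> dominates the integrands of the
  exponent, and the limit may be taken on both sides.\<close>

lemma exp_cmeas: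
  fixes h :: "'a \<Rightarrow> complex"
  assumes A: "A \<in> sets M" "emeasure \<rho> A < \<infinity>" and h[measurable]: "h \<in> borel_measurable M"
    and bd: "\<And>x. norm (h x) \<le> C" and out: "\<And>x. x \<notin> A \<Longrightarrow> h x = 0"
  shows "(\<integral>\<omega>. exp (integral\<^sup>L (cmeas \<omega>) h) \<partial>P) = exp (\<integral>x. exp (h x) - 1 \<partial>\<rho>)"
proof -
  obtain F where F: "\<And>i. simple_function M (F i)" "\<And>x. (\<lambda>i. F i x) \<longlonglongrightarrow> h x"
     "\<And>i x. norm (F i x) \<le> 2 * norm (h x)"
    using borel_measurable_implies_sequence_metric[OF h, of 0] space_M by auto
  have [measurable]: "F i \<in> borel_measurable M" for i by (rule borel_measurable_simple_function[OF F(1)])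
  have Fout: "F i x = 0" if "x \<notin> A" for i x using F(3)[of i x] out[OF that] by simp
  have Fbd: "norm (F i x) \<le> 2 * C" for i x using F(3)[of i x] bd[of x] by simp
  have L: "(\<lambda>i. \<integral>\<omega>. exp (integral\<^sup>L (cmeas \<omega>) (F i)) \<partial>P) \<longlonglongrightarrow> (\<integral>\<omega>. exp (integral\<^sup>L (cmeas \<omega>) h) \<partial>P)"
  proof (rule integral_dominated_convergence[where w="\<lambda>\<omega>. exp (2 * C) ^ cnt_nat \<omega> A"])
    show "integrable P (\<lambda>\<omega>. exp (2 * C) ^ cnt_nat \<omega> A)" by (rule integral_power_cnt_nat(1)[OF A])
    show "AE \<omega> in P. (\<lambda>i. exp (integral\<^sup>L (cmeas \<omega>) (F i))) \<longlonglongrightarrow> exp (integral\<^sup>L (cmeas \<omega>) h)"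
      using AE_cnt_finite[OF A]
    proof eventually_elim
      case (elim \<omega>)
      have ih: "integrable (cmeas \<omega>) h" by (rule integrable_cmeas_bounded(1)[OF elim bd out])
      have "(\<lambda>i. integral\<^sup>L (cmeas \<omega>) (F i)) \<longlonglongrightarrow> integral\<^sup>L (cmeas \<omega>) h"
        by (rule integral_dominated_convergence[where w="\<lambda>x. 2 * norm (h x)"]) (use F ih in auto)
      then show ?case by (rule tendsto_exp)
    qed
    fix i
    show "AE \<omega> in P. norm (exp (integral\<^sup>L (cmeas \<omega>) (F i))) \<le> exp (2 * C) ^ cnt_nat \<omega> A"
      using AE_cnt_finite[OF A]
    proof eventually_elim
      case (elim \<omega>)
      have "norm (exp (integral\<^sup>L (cmeas \<omega>) (F i))) \<le> exp (norm (integral\<^sup>L (cmeas \<omega>) (F i)))" by (rule norm_exp)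
      also have "\<dots> \<le> exp (2 * C * real (cnt_nat \<omega> A))" using integrable_cmeas_bounded(2)[OF elim Fbd Fout] by simp
      also have "\<dots> = exp (2 * C) ^ cnt_nat \<omega> A" by (simp add: exp_of_nat_mult[symmetric] mult.commute)
      finally show ?case .
    qed
  qed measurable
  have R: "(\<lambda>i. \<integral>x. exp (F i x) - 1 \<partial>\<rho>) \<longlonglongrightarrow> (\<integral>x. exp (h x) - 1 \<partial>\<rho>)"
  proof (rule integral_dominated_convergence[where w="\<lambda>x. (exp (2 * C) + 1) * indicator A x"])
    show "integrable \<rho> (\<lambda>x. (exp (2 * C) + 1) * indicator A x)" using A by auto
    show "AE x in \<rho>. (\<lambda>i. exp (F i x) - 1) \<longlonglongrightarrow> exp (h x) - 1"
      using F(2) by (auto intro!: AE_I2 tendsto_intros)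
    show "AE x in \<rho>. norm (exp (F i x) - 1) \<le> (exp (2 * C) + 1) * indicator A x" for i
    proof (rule AE_I2)
      fix x
      have "norm (exp (F i x) - 1) \<le> norm (exp (F i x)) + 1" using norm_triangle_ineq4[of "exp (F i x)" 1] by simp
      also have "norm (exp (F i x)) \<le> exp (2 * C)" using norm_exp[of "F i x"] Fbd[of i x] by (meson exp_le_cancel_iff order_trans)
      finally show "norm (exp (F i x) - 1) \<le> (exp (2 * C) + 1) * indicator A x"
        using Fout[of x i] by (cases "x \<in> A") auto
    qed
  qed measurable
  have "(\<integral>\<omega>. exp (integral\<^sup>L (cmeas \<omega>) (F i)) \<partial>P) = exp (\<integral>x. exp (F i x) - 1 \<partial>\<rho>)" for i
    by (rule exp_cmeas_simple[OF A F(1) Fout])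
  then have "(\<lambda>i. \<integral>\<omega>. exp (integral\<^sup>L (cmeas \<omega>) (F i)) \<partial>P) \<longlonglongrightarrow> exp (\<integral>x. exp (h x) - 1 \<partial>\<rho>)"
    using tendsto_exp[OF R] by simp
  with L show ?thesis by (rule LIMSEQ_unique)
qed

lemma exp_cmeas_real:
  fixes h :: "'a \<Rightarrow> real"
  assumes A: "A \<in> sets M" "emeasure \<rho> A < \<infinity>" and h[measurable]: "h \<in> borel_measurable M"
    and bd: "\<And>x. norm (h x) \<le> C" and out: "\<And>x. x \<notin> A \<Longrightarrow> h x = 0"
  shows "(\<integral>\<omega>. exp (integral\<^sup>L (cmeas \<omega>) h) \<partial>P) = exp (\<integral>x. exp (h x) - 1 \<partial>\<rho>)"
proof -
  have "complex_of_real (\<integral>\<omega>. exp (integral\<^sup>L (cmeas \<omega>) h) \<partial>P) = (\<integral>\<omega>. exp (integral\<^sup>L (cmeas \<omega>) (\<lambda>x. complex_of_real (h x))) \<partial>P)"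
    by (simp add: exp_of_real integral_complex_of_real)
  also have "\<dots> = exp (\<integral>x. exp (complex_of_real (h x)) - 1 \<partial>\<rho>)"
    by (rule exp_cmeas[OF A, where C=C]) (use bd out in auto)
  also have "(\<integral>x. exp (complex_of_real (h x)) - 1 \<partial>\<rho>) = complex_of_real (\<integral>x. exp (h x) - 1 \<partial>\<rho>)"
  proof -
    have "exp (complex_of_real (h x)) - 1 = complex_of_real (exp (h x) - 1)" for x by (simp add: exp_of_real)
    then show ?thesis by (simp only: integral_complex_of_real)
  qed
  finally show ?thesis by (simp only: exp_of_real of_real_eq_iff)
qed

end

section \<open>Uniqueness of the Laplace functional\<close>

text \<open>
  Induction on \<open>k\<close>: the indicator of \<open>N = k\<close> is the limit, as \<open>n\<close> tends to infinity, of
  \<open>exp (n k) * (exp (- n N) - (\<Sum>j<k. exp (- n j) * [N = j]))\<close>, which is bounded by 1.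
\<close>
lemma integral_eq_on_level_sets:
  fixes N :: "'b \<Rightarrow> nat" and W :: "'b \<Rightarrow> real"
  assumes P1: "finite_measure P1" and P2: "finite_measure P2" and sets2: "sets P2 = sets P1"
    and N: "N \<in> measurable P1 (count_space UNIV)" and W: "W \<in> borel_measurable P1" and bd: "\<And>\<omega>. \<bar>W \<omega>\<bar> \<le> 1"
    and eq: "\<And>n::nat. (\<integral>\<omega>. W \<omega> * exp (- (real n * real (N \<omega>))) \<partial>P1) = (\<integral>\<omega>. W \<omega> * exp (- (real n * real (N \<omega>))) \<partial>P2)"
  shows "(\<integral>\<omega>. W \<omega> * indicator {\<omega>. N \<omega> = k} \<omega> \<partial>P1) = (\<integral>\<omega>. W \<omega> * indicator {\<omega>. N \<omega> = k} \<omega> \<partial>P2)"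
proof (induction k rule: less_induct)
  case (less k)
  define f where "f n \<omega> = W \<omega> * (exp (real n * real k) * (exp (- (real n * real (N \<omega>))) - (\<Sum>j<k. exp (- (real n * real j)) * indicator {\<omega>. N \<omega> = j} \<omega>)))" for n :: nat and \<omega>
  \<comment> \<open>The subtracted sum cancels the levels below \<open>k\<close> exactly, which the
    factor \<open>exp (n * k)\<close> would otherwise make unbounded; what remains is at most
    \<open>\<bar>W \<omega>\<bar>\<close>.\<close>
  have f_eq: "f n \<omega> = (if N \<omega> < k then 0 else W \<omega> * exp (- (real n * (real (N \<omega>) - real k))))" for n \<omega>
  proof -
    have "(\<Sum>j<k. exp (- (real n * real j)) * indicator {\<omega>. N \<omega> = j} \<omega>) = (\<Sum>j<k. if j = N \<omega> then exp (- (real n * real j)) else 0)"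
      by (rule sum.cong) auto
    also have "\<dots> = (if N \<omega> < k then exp (- (real n * real (N \<omega>))) else 0)" by (subst sum.delta) auto
    finally show ?thesis by (simp add: f_def exp_add[symmetric] algebra_simps)
  qed
  have lim: "(\<lambda>n. f n \<omega>) \<longlonglongrightarrow> W \<omega> * indicator {\<omega>. N \<omega> = k} \<omega>" for \<omega>
  proof (cases "N \<omega> > k")
    case True
    have "(\<lambda>n. exp (- (real (N \<omega>) - real k)) ^ n) \<longlonglongrightarrow> 0"
      using True by (intro LIMSEQ_power_zero) auto
    then have "(\<lambda>n. W \<omega> * exp (- (real (N \<omega>) - real k)) ^ n) \<longlonglongrightarrow> W \<omega> * 0" by (intro tendsto_mult tendsto_const)
    then show ?thesis using True by (simp add: f_eq exp_of_nat_mult[symmetric] right_diff_distrib)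
  next
    case False
    then show ?thesis by (cases "N \<omega> = k") (auto simp: f_eq)
  qed
  have fb: "norm (f n \<omega>) \<le> 1" for n \<omega>
  proof -
    have "\<bar>W \<omega>\<bar> * exp (- (real n * (real (N \<omega>) - real k))) \<le> 1 * 1" if "\<not> N \<omega> < k"
      using that bd[of \<omega>] by (intro mult_mono) auto
    then show ?thesis by (auto simp: f_eq abs_mult)
  qed
  have N'[measurable]: "(\<lambda>\<omega>. real (N \<omega>)) \<in> borel_measurable P1" by (rule measurable_compose[OF N]) simp
  have ind[measurable]: "(\<lambda>\<omega>. indicator {\<omega>. N \<omega> = j} \<omega> :: real) \<in> borel_measurable P1" for j
  proof -
    have "(\<lambda>\<omega>. indicator {j} (N \<omega>) :: real) \<in> borel_measurable P1" by (rule measurable_compose[OF N]) simp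
    then show ?thesis by (simp add: indicator_def)
  qed
  note W[measurable]
  have fm: "f n \<in> borel_measurable P1" for n unfolding f_def by measurable
  have m2: "g \<in> borel_measurable P2" if "g \<in> borel_measurable P1" for g :: "'b \<Rightarrow> real"
    using that by (simp add: measurable_cong_sets[OF sets2 refl])
  have conv: "(\<lambda>n. \<integral>\<omega>. f n \<omega> \<partial>R) \<longlonglongrightarrow> (\<integral>\<omega>. W \<omega> * indicator {\<omega>. N \<omega> = k} \<omega> \<partial>R)"
    if R: "finite_measure R" "\<And>g. g \<in> borel_measurable P1 \<Longrightarrow> (g :: 'b \<Rightarrow> real) \<in> borel_measurable R" for R
  proof (rule integral_dominated_convergence[where w="\<lambda>_. 1"])
    show "integrable R (\<lambda>_. 1::real)" using R(1) by (rule finite_measure.integrable_const)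
    show "(\<lambda>\<omega>. W \<omega> * indicator {\<omega>. N \<omega> = k} \<omega>) \<in> borel_measurable R" by (rule R(2)) measurable
  qed (use lim fb R(2)[OF fm] in auto)
  have calc: "(\<integral>\<omega>. f n \<omega> \<partial>R) = exp (real n * real k) * ((\<integral>\<omega>. W \<omega> * exp (- (real n * real (N \<omega>))) \<partial>R)
      - (\<Sum>j<k. exp (- (real n * real j)) * (\<integral>\<omega>. W \<omega> * indicator {\<omega>. N \<omega> = j} \<omega> \<partial>R)))"
    if R: "finite_measure R" "\<And>g. g \<in> borel_measurable P1 \<Longrightarrow> (g :: 'b \<Rightarrow> real) \<in> borel_measurable R" for R n
  proof -
    have bdd: "integrable R g" if "g \<in> borel_measurable P1" "\<And>\<omega>. \<bar>g \<omega>\<bar> \<le> 1" for g :: "'b \<Rightarrow> real"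
      by (rule finite_measure.integrable_const_bound[OF R(1), where B=1]) (simp_all add: that R(2))
    have i1: "integrable R (\<lambda>\<omega>. W \<omega> * exp (- (real n * real (N \<omega>))))"
    proof (rule bdd)
      show "\<bar>W \<omega> * exp (- (real n * real (N \<omega>)))\<bar> \<le> 1" for \<omega>
        using mult_mono[OF bd[of \<omega>], of "exp (- (real n * real (N \<omega>)))" 1] by (simp add: abs_mult)
    qed measurable
    have i2: "integrable R (\<lambda>\<omega>. W \<omega> * indicator {\<omega>. N \<omega> = j} \<omega>)" for j
      by (rule bdd, measurable) (use bd in \<open>auto simp: abs_mult split: split_indicator\<close>)
    have "f n \<omega> = exp (real n * real k) * (W \<omega> * exp (- (real n * real (N \<omega>))) - (\<Sum>j<k. exp (- (real n * real j)) * (W \<omega> * indicator {\<omega>. N \<omega> = j} \<omega>)))" for \<omega>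
      by (simp only: f_def right_diff_distrib sum_distrib_left mult_ac)
    then have "(\<integral>\<omega>. f n \<omega> \<partial>R) = (\<integral>\<omega>. exp (real n * real k) * (W \<omega> * exp (- (real n * real (N \<omega>))) - (\<Sum>j<k. exp (- (real n * real j)) * (W \<omega> * indicator {\<omega>. N \<omega> = j} \<omega>))) \<partial>R)"
      by (rule Bochner_Integration.integral_cong[OF refl])
    also have "\<dots> = exp (real n * real k) * ((\<integral>\<omega>. W \<omega> * exp (- (real n * real (N \<omega>))) \<partial>R)
      - (\<integral>\<omega>. (\<Sum>j<k. exp (- (real n * real j)) * (W \<omega> * indicator {\<omega>. N \<omega> = j} \<omega>)) \<partial>R))"
      by (simp only: integral_mult_right_zero Bochner_Integration.integral_diff[OF i1 Bochner_Integration.integrable_sum[OF integrable_mult_right[OF i2]]])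
    also have "(\<integral>\<omega>. (\<Sum>j<k. exp (- (real n * real j)) * (W \<omega> * indicator {\<omega>. N \<omega> = j} \<omega>)) \<partial>R)
      = (\<Sum>j<k. exp (- (real n * real j)) * (\<integral>\<omega>. W \<omega> * indicator {\<omega>. N \<omega> = j} \<omega> \<partial>R))"
      by (simp only: Bochner_Integration.integral_sum[OF integrable_mult_right[OF i2]] integral_mult_right_zero)
    finally show ?thesis .
  qed
  have "(\<integral>\<omega>. f n \<omega> \<partial>P1) = (\<integral>\<omega>. f n \<omega> \<partial>P2)" for n
    using less.IH by (simp add: calc[OF P1] calc[OF P2 m2] eq)
  then have "(\<lambda>n. \<integral>\<omega>. f n \<omega> \<partial>P1) \<longlonglongrightarrow> (\<integral>\<omega>. W \<omega> * indicator {\<omega>. N \<omega> = k} \<omega> \<partial>P2)"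
    using conv[OF P2 m2] by simp
  then show ?case using conv[OF P1] LIMSEQ_unique by blast
qed

text \<open>The class \<open>good\<close> of events is enlarged by one count event at a time.
  Carrying every weight \<open>exp (- integral h)\<close> along makes the induction close: adding
  \<open>n * indicator A\<close> to \<open>h\<close> produces the Laplace transform of the count of
  \<open>A\<close> under the weighted laws, and this transform determines the integrals over the
  level sets of the count.\<close>

lemma laplace_functional_unique:
  fixes P1 P2 :: "('a \<Rightarrow> nat) measure"
  assumes P1: "prob_space P1" and P2: "prob_space P2" and sets1: "sets P1 = sets (Xstar M)" and sets2: "sets P2 = sets (Xstar M)"
    and sp: "space M = UNIV" and Y: "range Y \<subseteq> sets M" "incseq Y" "(\<Union>n. Y n) = UNIV"
    and AE1: "\<And>n::nat. AE \<omega> in P1. cnt \<omega> (Y n) < \<infinity>" and AE2: "\<And>n. AE \<omega> in P2. cnt \<omega> (Y n) < \<infinity>"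
    and eq: "\<And>(h :: 'a \<Rightarrow> real) C n. h \<in> borel_measurable M \<Longrightarrow> (\<And>x. 0 \<le> h x) \<Longrightarrow> (\<And>x. h x \<le> C) \<Longrightarrow> (\<And>x. x \<notin> Y n \<Longrightarrow> h x = 0) \<Longrightarrow>
       (\<integral>\<omega>. exp (- integral\<^sup>L (cmeas \<omega>) h) \<partial>P1) = (\<integral>\<omega>. exp (- integral\<^sup>L (cmeas \<omega>) h) \<partial>P2)"
  shows "P1 = P2"
proof -
  \<comment> \<open>Admissible functions live on some \<open>Y n\<close>, where counts are almost
    surely finite, so that their integrals against a configuration are genuine and additive.\<close>
  define adm where "adm h \<longleftrightarrow> h \<in> borel_measurable M \<and> (\<forall>x. 0 \<le> h x) \<and> (\<exists>C. \<forall>x. h x \<le> C) \<and> (\<exists>n. \<forall>x. x \<notin> Y n \<longrightarrow> h x = 0)"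
    for h :: "'a \<Rightarrow> real"
  define good where "good C \<longleftrightarrow> C \<in> sets (Xstar M) \<and> (\<forall>h. adm h \<longrightarrow>
     (\<integral>\<omega>. indicator C \<omega> * exp (- integral\<^sup>L (cmeas \<omega>) h) \<partial>P1) = (\<integral>\<omega>. indicator C \<omega> * exp (- integral\<^sup>L (cmeas \<omega>) h) \<partial>P2))" for C
  have m1: "measurable P1 = (measurable (Xstar M) :: 'c measure \<Rightarrow> _)" and m2: "measurable P2 = (measurable (Xstar M) :: 'c measure \<Rightarrow> _)"
    using sets1 sets2 by (auto intro!: ext measurable_cong_sets)
  have sp1: "space P1 = counting_space" and sp2: "space P2 = counting_space"
    using sets_eq_imp_space_eq[OF sets1] sets_eq_imp_space_eq[OF sets2] by auto
  have AEs: "AE \<omega> in R. \<forall>n. cnt \<omega> (Y n) < \<infinity>" if "R = P1 \<or> R = P2" for R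
    using AE1 AE2 that by (auto simp: AE_all_countable)
  have le1: "exp (- integral\<^sup>L (cmeas \<omega>) h) \<le> 1" if "adm h" for h \<omega>
    using that by (auto simp: adm_def intro!: integral_nonneg)
  have mI: "(\<lambda>\<omega>. exp (- integral\<^sup>L (cmeas \<omega>) h)) \<in> borel_measurable (Xstar M)" if "adm h" for h
    using measurable_integral_cmeas[OF sp, of h] that by (auto simp: adm_def)

  have step_cnt_nat: "(\<integral>\<omega>. indicator C \<omega> * exp (- integral\<^sup>L (cmeas \<omega>) h) * indicator {\<omega>. cnt_nat \<omega> A = k} \<omega> \<partial>P1)
      = (\<integral>\<omega>. indicator C \<omega> * exp (- integral\<^sup>L (cmeas \<omega>) h) * indicator {\<omega>. cnt_nat \<omega> A = k} \<omega> \<partial>P2)"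
    if C: "good C" and A: "A \<in> sets M" "A \<subseteq> Y m" and h: "adm h" for C A m h k
  proof (rule integral_eq_on_level_sets)
    show "finite_measure P1" "finite_measure P2" using P1 P2 by (auto simp: prob_space_def)
    show "sets P2 = sets P1" using sets1 sets2 by simp
    show "(\<lambda>\<omega>. cnt_nat \<omega> A) \<in> measurable P1 (count_space UNIV)"
      using measurable_cnt_nat[OF A(1)] by (simp add: measurable_cong_sets[OF sets1 refl])
    show "(\<lambda>\<omega>. indicator C \<omega> * exp (- integral\<^sup>L (cmeas \<omega>) h)) \<in> borel_measurable P1"
      using C mI[OF h] by (auto simp: good_def measurable_cong_sets[OF sets1 refl])
    show "\<bar>indicator C \<omega> * exp (- integral\<^sup>L (cmeas \<omega>) h)\<bar> \<le> 1" for \<omega>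
      using le1[OF h] by (auto simp: abs_mult split: split_indicator)
    fix n :: nat
    let ?h = "\<lambda>x. h x + real n * indicator A x"
    from h obtain c l where c: "\<And>x. h x \<le> c" and l: "\<And>x. x \<notin> Y l \<Longrightarrow> h x = 0" and hm: "h \<in> borel_measurable M" "\<And>x. 0 \<le> h x"
      by (auto simp: adm_def)
    have Yl: "Y l \<subseteq> Y (max l m)" "Y m \<subseteq> Y (max l m)" using Y(2) by (auto simp: incseq_def)
    have ha: "adm ?h"
      unfolding adm_def
    proof (intro conjI allI exI[of _ "c + real n"] exI[of _ "max l m"] impI)
      show "?h \<in> borel_measurable M" using hm A by measurable
      show "0 \<le> ?h x" for x using hm by simp
      show "?h x \<le> c + real n" for x using c[of x] by (auto split: split_indicator)
      show "?h x = 0" if "x \<notin> Y (max l m)" for x using that Yl l A by (auto split: split_indicator)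
    qed
    have ae: "AE \<omega> in R. indicator C \<omega> * exp (- integral\<^sup>L (cmeas \<omega>) h) * exp (- (real n * real (cnt_nat \<omega> A))) = indicator C \<omega> * exp (- integral\<^sup>L (cmeas \<omega>) ?h)"
      if "R = P1 \<or> R = P2" for R
      using AEs[OF that]
    proof eventually_elim
      case (elim \<omega>)
      have "cnt \<omega> A < \<infinity>" using cnt_mono[OF A(2), of \<omega>] elim by (auto intro: le_less_trans)
      then have i2: "integrable (cmeas \<omega>) (\<lambda>x. real n * indicator A x)" by (auto simp: emeasure_cmeas)
      have i1: "integrable (cmeas \<omega>) h"
        by (rule integrable_cmeas_bounded(1)[of \<omega> "Y l" h c]) (use elim c l hm in auto)
      have "integral\<^sup>L (cmeas \<omega>) ?h = integral\<^sup>L (cmeas \<omega>) h + real n * real (cnt_nat \<omega> A)"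
        using Bochner_Integration.integral_add[OF i1 i2] by (simp add: measure_cmeas)
      then show ?case by (simp only: minus_add_distrib exp_add mult.assoc)
    qed
    have mc: "(\<lambda>\<omega>. indicator C \<omega> * exp (- integral\<^sup>L (cmeas \<omega>) ?h)) \<in> borel_measurable (Xstar M)"
      "(\<lambda>\<omega>. indicator C \<omega> * exp (- integral\<^sup>L (cmeas \<omega>) h) * exp (- (real n * real (cnt_nat \<omega> A)))) \<in> borel_measurable (Xstar M)"
    proof -
      show "(\<lambda>\<omega>. indicator C \<omega> * exp (- integral\<^sup>L (cmeas \<omega>) ?h)) \<in> borel_measurable (Xstar M)"
        using C mI[OF ha] by (auto simp: good_def)
      have "(\<lambda>\<omega>. exp (- (real n * real (cnt_nat \<omega> A)))) \<in> borel_measurable (Xstar M)"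
        by (rule measurable_compose[OF measurable_cnt_nat[OF A(1)]]) simp
      then show "(\<lambda>\<omega>. indicator C \<omega> * exp (- integral\<^sup>L (cmeas \<omega>) h) * exp (- (real n * real (cnt_nat \<omega> A)))) \<in> borel_measurable (Xstar M)"
        using C mI[OF h] by (auto simp: good_def)
    qed
    have "(\<integral>\<omega>. indicator C \<omega> * exp (- integral\<^sup>L (cmeas \<omega>) h) * exp (- (real n * real (cnt_nat \<omega> A))) \<partial>R) = (\<integral>\<omega>. indicator C \<omega> * exp (- integral\<^sup>L (cmeas \<omega>) ?h) \<partial>R)"
      if "R = P1 \<or> R = P2" for R
      by (rule integral_cong_AE[OF _ _ ae[OF that]]) (use mc that in \<open>auto simp: measurable_cong_sets[OF sets1 refl] measurable_cong_sets[OF sets2 refl]\<close>)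
    moreover have "(\<integral>\<omega>. indicator C \<omega> * exp (- integral\<^sup>L (cmeas \<omega>) ?h) \<partial>P1) = (\<integral>\<omega>. indicator C \<omega> * exp (- integral\<^sup>L (cmeas \<omega>) ?h) \<partial>P2)"
      using C ha by (auto simp: good_def)
    ultimately show "(\<integral>\<omega>. indicator C \<omega> * exp (- integral\<^sup>L (cmeas \<omega>) h) * exp (- (real n * real (cnt_nat \<omega> A))) \<partial>P1) = (\<integral>\<omega>. indicator C \<omega> * exp (- integral\<^sup>L (cmeas \<omega>) h) * exp (- (real n * real (cnt_nat \<omega> A))) \<partial>P2)"
      by simp
  qed

  have step: "good (C \<inter> {\<omega> \<in> counting_space. cnt \<omega> A = of_nat k})" if C: "good C" and A: "A \<in> sets M" for C A k
    unfolding good_def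
  proof (intro conjI allI impI)
    show sD: "C \<inter> {\<omega> \<in> counting_space. cnt \<omega> A = of_nat k} \<in> sets (Xstar M)" using C sets_cnt_eq[OF A] by (auto simp: good_def)
    fix h assume h: "adm h"
    let ?g = "\<lambda>n \<omega>. indicator C \<omega> * exp (- integral\<^sup>L (cmeas \<omega>) h) * indicator {\<omega>. cnt_nat \<omega> (A \<inter> Y n) = k} \<omega> :: real"
    let ?l = "\<lambda>\<omega>. indicator (C \<inter> {\<omega> \<in> counting_space. cnt \<omega> A = of_nat k}) \<omega> * exp (- integral\<^sup>L (cmeas \<omega>) h) :: real"
    have AY: "A \<inter> Y n \<in> sets M" for n using A Y(1) by auto
    \<comment> \<open>The count of \<open>A\<close> may be infinite, and level sets are so far
      controlled only for subsets of some \<open>Y n\<close>. The counts of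
      \<open>A \<inter> Y n\<close> increase to that of \<open>A\<close>; being integers, they
      decide for all large \<open>n\<close> whether the count of \<open>A\<close> equals
      \<open>k\<close>.\<close>
    have lim: "(\<lambda>n. ?g n \<omega>) \<longlonglongrightarrow> ?l \<omega>" if fin: "\<forall>n. cnt \<omega> (Y n) < \<infinity>" and om: "\<omega> \<in> counting_space" for \<omega>
    proof -
      have finA: "cnt \<omega> (A \<inter> Y n) < \<infinity>" for n
        using cnt_mono[of "A \<inter> Y n" "Y n" \<omega>] fin[rule_format, of n] by (auto intro: le_less_trans)
      have "(\<lambda>n. emeasure (cmeas \<omega>) (A \<inter> Y n)) \<longlonglongrightarrow> emeasure (cmeas \<omega>) (\<Union>n. A \<inter> Y n)"
        by (rule Lim_emeasure_incseq) (use Y(2) in \<open>auto simp: incseq_def\<close>)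
      moreover have "(\<Union>n. A \<inter> Y n) = A" using Y(3) by auto
      ultimately have lim: "(\<lambda>n. cnt \<omega> (A \<inter> Y n)) \<longlonglongrightarrow> cnt \<omega> A" by (simp add: emeasure_cmeas)
      have le: "cnt \<omega> (A \<inter> Y n) \<le> cnt \<omega> A" for n by (rule cnt_mono) auto
      have "\<forall>\<^sub>F n in sequentially. (cnt_nat \<omega> (A \<inter> Y n) = k) = (cnt \<omega> A = of_nat k)"
      proof (cases "cnt \<omega> A = of_nat k")
        case True
        show ?thesis
        proof (cases k)
          case 0
          then have "cnt_nat \<omega> (A \<inter> Y n) = k" for n
            using le[of n] True unfolding cnt_eq_cnt_nat[OF finA] by simp
          then show ?thesis using True by simp
        next
          case (Suc j)
          \<comment> \<open>A count that exceeds \<open>j\<close> and is at most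
            \<open>k = Suc j\<close> equals \<open>k\<close>.\<close>
          have "of_nat j < cnt \<omega> A" using True Suc by simp
          from order_tendstoD(1)[OF lim this]
          show ?thesis
          proof eventually_elim
            case (elim n)
            have "cnt_nat \<omega> (A \<inter> Y n) \<le> k" using le[of n] by (simp only: cnt_eq_cnt_nat[OF finA] True of_nat_le_iff)
            moreover have "j < cnt_nat \<omega> (A \<inter> Y n)" using elim by (simp only: cnt_eq_cnt_nat[OF finA] of_nat_less_iff)
            ultimately show ?case using True Suc by simp
          qed
        qed
      next
        case False
        show ?thesis
        proof (cases "cnt \<omega> A < of_nat k")
          case True
          have "cnt_nat \<omega> (A \<inter> Y n) \<noteq> k" for n
            using le[of n] True False cnt_eq_cnt_nat[OF finA, of n] by (metis leD)
          then show ?thesis using False by simp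
        next
          case nless: False
          then have "of_nat k < cnt \<omega> A" using False by auto
          from order_tendstoD(1)[OF lim this] show ?thesis
            by eventually_elim (use False in \<open>auto simp: cnt_eq_cnt_nat[OF finA]\<close>)
        qed
      qed
      then have "\<forall>\<^sub>F n in sequentially. ?g n \<omega> = ?l \<omega>"
        by eventually_elim (use om in \<open>auto split: split_indicator\<close>)
      then show ?thesis by (rule tendsto_eventually)
    qed
    have mg: "?g n \<in> borel_measurable (Xstar M)" for n
    proof -
      have "(\<lambda>\<omega>. indicator {k} (cnt_nat \<omega> (A \<inter> Y n)) :: real) \<in> borel_measurable (Xstar M)"
        by (rule measurable_compose[OF measurable_cnt_nat[OF AY]]) simp
      then have "(\<lambda>\<omega>. indicator {\<omega>. cnt_nat \<omega> (A \<inter> Y n) = k} \<omega> :: real) \<in> borel_measurable (Xstar M)"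
        by (simp add: indicator_def)
      then show ?thesis using C mI[OF h] by (auto simp: good_def)
    qed
    have ml: "?l \<in> borel_measurable (Xstar M)" using sD mI[OF h] by auto
    have conv: "(\<lambda>n. \<integral>\<omega>. ?g n \<omega> \<partial>R) \<longlonglongrightarrow> (\<integral>\<omega>. ?l \<omega> \<partial>R)" if R: "R = P1 \<or> R = P2" for R
    proof (rule integral_dominated_convergence[where w="\<lambda>_. 1"])
      have "finite_measure R" using R P1 P2 by (auto simp: prob_space_def)
      then show "integrable R (\<lambda>_. 1::real)" by (rule finite_measure.integrable_const)
      show "AE \<omega> in R. (\<lambda>n. ?g n \<omega>) \<longlonglongrightarrow> ?l \<omega>"
        using AEs[OF R] AE_space by eventually_elim (use lim R sp1 sp2 in auto)
      show "AE \<omega> in R. norm (?g n \<omega>) \<le> 1" for n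
        using le1[OF h] by (auto simp: abs_mult split: split_indicator)
    qed (use R mg ml in \<open>auto simp: measurable_cong_sets[OF sets1 refl] measurable_cong_sets[OF sets2 refl]\<close>)
    have "(\<integral>\<omega>. ?g n \<omega> \<partial>P1) = (\<integral>\<omega>. ?g n \<omega> \<partial>P2)" for n
      by (rule step_cnt_nat[OF C AY _ h, of n n]) auto
    then have "(\<lambda>n. \<integral>\<omega>. ?g n \<omega> \<partial>P1) \<longlonglongrightarrow> (\<integral>\<omega>. ?l \<omega> \<partial>P2)" using conv[of P2] by simp
    then show "(\<integral>\<omega>. ?l \<omega> \<partial>P1) = (\<integral>\<omega>. ?l \<omega> \<partial>P2)" using conv[of P1] LIMSEQ_unique by blast
  qed

  \<comment> \<open>Finite conjunctions of count events are closed under intersection, unlike the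
    single generators; the empty conjunction is the whole space, which serves as the exhausting set
    of the uniqueness theorem for measures.\<close>
  define gen where "gen F = {\<omega> \<in> counting_space. \<forall>(A, k)\<in>F. cnt \<omega> A = of_nat k}" for F :: "('a set \<times> nat) set"
  define G where "G = gen ` {F. finite F \<and> fst ` F \<subseteq> sets M}"
  have adm0: "adm (\<lambda>x. 0)" by (auto simp: adm_def)
  have good_gen: "good (gen F)" if "finite F" "fst ` F \<subseteq> sets M" for F
    using that
  proof (induction F)
    case empty
    have "(\<integral>\<omega>. indicator counting_space \<omega> * exp (- integral\<^sup>L (cmeas \<omega>) h) \<partial>R) = (\<integral>\<omega>. exp (- integral\<^sup>L (cmeas \<omega>) h) \<partial>R)"
      if "R = P1 \<or> R = P2" for h :: "'a \<Rightarrow> real" and R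
      using that sp1 sp2 by (intro Bochner_Integration.integral_cong) auto
    moreover have "counting_space \<in> sets (Xstar M)" using sets.top[of "Xstar M"] by simp
    moreover have "(\<integral>\<omega>. exp (- integral\<^sup>L (cmeas \<omega>) h) \<partial>P1) = (\<integral>\<omega>. exp (- integral\<^sup>L (cmeas \<omega>) h) \<partial>P2)" if "adm h" for h
      using that eq[of h] unfolding adm_def by blast
    ultimately show ?case by (auto simp: good_def gen_def)
  next
    case (insert p F)
    obtain A k where p: "p = (A, k)" by force
    have "gen (insert p F) = gen F \<inter> {\<omega> \<in> counting_space. cnt \<omega> A = of_nat k}" by (auto simp: gen_def p)
    then show ?case using step[of "gen F" A k] insert p by simp
  qed
  have sG: "sets (Xstar M) = sigma_sets counting_space G"
  proof
    have "{\<omega> \<in> counting_space. cnt \<omega> A = of_nat k} \<in> G" if "A \<in> sets M" for A k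
      unfolding G_def by (rule image_eqI[of _ _ "{(A, k)}"]) (use that in \<open>auto simp: gen_def\<close>)
    then show "sets (Xstar M) \<subseteq> sigma_sets counting_space G"
      unfolding sets_Xstar by (intro sigma_sets_mono') auto
    have "G \<subseteq> sets (Xstar M)" using good_gen by (auto simp: G_def good_def)
    then show "sigma_sets counting_space G \<subseteq> sets (Xstar M)"
      using sets.sigma_sets_subset[of G "Xstar M"] by simp
  qed
  show "P1 = P2"
  proof (rule measure_eqI_generator_eq_countable[where E=G and \<Omega>=counting_space and A="{counting_space}"])
    show "Int_stable G"
    proof (rule Int_stableI)
      fix a b assume "a \<in> G" "b \<in> G"
      then obtain F F' where F: "a = gen F" "b = gen F'" "finite F" "finite F'" "fst ` F \<subseteq> sets M" "fst ` F' \<subseteq> sets M"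
        by (auto simp: G_def)
      have "a \<inter> b = gen (F \<union> F')" by (auto simp: F gen_def)
      then show "a \<inter> b \<in> G" using F by (auto simp: G_def image_Un)
    qed
    show "G \<subseteq> Pow counting_space" by (auto simp: G_def gen_def)
    show "emeasure P1 X = emeasure P2 X" if "X \<in> G" for X
    proof -
      have g: "good X" using that good_gen by (auto simp: G_def)
      then have "(\<integral>\<omega>. indicator X \<omega> \<partial>P1) = (\<integral>\<omega>. indicator X \<omega> \<partial>P2 :: real)"
        using adm0 by (auto simp: good_def)
      moreover have "X \<in> sets P1" "X \<in> sets P2" using g by (auto simp: good_def sets1 sets2)
      ultimately have "measure P1 X = measure P2 X"
        by (simp add: Int_absorb2 sets.sets_into_space)
      then show ?thesis using P1 P2 by (simp add: finite_measure.emeasure_eq_measure prob_space_def)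
    qed
    show "sets P1 = sigma_sets counting_space G" "sets P2 = sigma_sets counting_space G" using sG sets1 sets2 by auto
    have "gen {} \<in> G" by (auto simp: G_def)
    then show "{counting_space} \<subseteq> G" by (simp add: gen_def)
    show "emeasure P1 a \<noteq> \<infinity>" for a using P1 by (simp add: finite_measure.emeasure_finite prob_space_def)
  qed auto
qed

section \<open>The density as an L1 limit\<close>

text \<open>Completeness of \<open>L1\<close> with a rate. A sequence along which \<open>r\<close>
  vanishes produces the limit, but the bound is then proved for every index of the family, as a
  limit over continuous \<epsilon> requires.\<close>

lemma L1_Cauchy_family_limit:
  fixes f :: "'i \<Rightarrow> 'b \<Rightarrow> real"
  assumes int: "\<And>i. i \<in> I \<Longrightarrow> integrable M (f i)"
    and cauchy: "\<And>i j. i \<in> I \<Longrightarrow> j \<in> I \<Longrightarrow> (\<integral>x. \<bar>f i x - f j x\<bar> \<partial>M) \<le> r i + r j"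
    and e: "\<And>n::nat. e n \<in> I" and r: "(\<lambda>n. r (e n)) \<longlonglongrightarrow> 0"
  obtains g where "integrable M g" "\<And>i. i \<in> I \<Longrightarrow> (\<integral>x. \<bar>f i x - g x\<bar> \<partial>M) \<le> r i"
proof -
  have "\<exists>n. r (e n) \<le> (1/2) ^ k" for k :: nat
  proof -
    have "\<forall>\<^sub>F n in sequentially. r (e n) < (1/2) ^ k" by (rule order_tendstoD(2)[OF r]) simp
    then show ?thesis by (auto simp: eventually_sequentially intro: less_imp_le)
  qed
  then obtain s where s: "\<And>k. r (e (s k)) \<le> (1/2) ^ k" by metis
  define F where "F k = f (e (s k))" for k
  have iF: "integrable M (F k)" for k unfolding F_def by (intro int e)
  have [measurable]: "F k \<in> borel_measurable M" for k using iF by (rule borel_measurable_integrable)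
  have nnF: "(\<integral>\<^sup>+ x. ennreal \<bar>F (Suc k) x - F k x\<bar> \<partial>M) \<le> ennreal (2 * (1/2) ^ k)" for k
  proof -
    have "(\<integral>\<^sup>+ x. ennreal \<bar>F (Suc k) x - F k x\<bar> \<partial>M) = ennreal (\<integral>x. \<bar>F (Suc k) x - F k x\<bar> \<partial>M)"
      by (rule nn_integral_eq_integral) (use iF in auto)
    also have "(\<integral>x. \<bar>F (Suc k) x - F k x\<bar> \<partial>M) \<le> r (e (s (Suc k))) + r (e (s k))" unfolding F_def by (intro cauchy e)
    also have "\<dots> \<le> (1/2) ^ Suc k + (1/2) ^ k" by (intro add_mono s)
    also have "\<dots> \<le> 2 * (1/2) ^ k" by simp
    finally show ?thesis by (simp add: ennreal_leI)
  qed
  have "(\<integral>\<^sup>+ x. (\<Sum>k. ennreal \<bar>F (Suc k) x - F k x\<bar>) \<partial>M) = (\<Sum>k. \<integral>\<^sup>+ x. ennreal \<bar>F (Suc k) x - F k x\<bar> \<partial>M)"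
    by (rule nn_integral_suminf) measurable
  also have "\<dots> \<le> (\<Sum>k. ennreal (2 * (1/2) ^ k))" by (intro suminf_le nnF) auto
  also have "\<dots> = ennreal (\<Sum>k. 2 * (1/2) ^ k)"
    by (intro suminf_ennreal2 summable_mult summable_geometric) auto
  also have "\<dots> < \<infinity>" by simp
  finally have "AE x in M. (\<Sum>k. ennreal \<bar>F (Suc k) x - F k x\<bar>) \<noteq> \<infinity>"
    by (intro nn_integral_PInf_AE) auto
  then have lim: "AE x in M. (\<lambda>n. F n x) \<longlonglongrightarrow> lim (\<lambda>n. F n x)"
  proof eventually_elim
    case (elim x)
    then have "summable (\<lambda>k. \<bar>F (Suc k) x - F k x\<bar>)" by (intro summable_suminf_not_top) auto
    then have "summable (\<lambda>k. F (Suc k) x - F k x)" by (rule summable_rabs_cancel)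
    then have "convergent (\<lambda>n. \<Sum>k<n. F (Suc k) x - F k x)" by (simp add: summable_iff_convergent)
    then have "convergent (\<lambda>n. F n x - F 0 x)" by (simp add: sum_lessThan_telescope[of "\<lambda>k. F k x"])
    then have "convergent (\<lambda>n. (F n x - F 0 x) + F 0 x)" by (intro convergent_add convergent_const)
    then show ?case by (simp add: convergent_LIMSEQ_iff)
  qed
  define g where "g x = lim (\<lambda>n. F n x)" for x
  have gm[measurable]: "g \<in> borel_measurable M" unfolding g_def by measurable
  \<comment> \<open>Fatou along the subsequence: the distance of \<open>f i\<close> to
    \<open>F k\<close> is at most \<open>r i + (1/2) ^ k\<close>, and the last term
    vanishes.\<close>
  have bound: "(\<integral>\<^sup>+ x. ennreal \<bar>f i x - g x\<bar> \<partial>M) \<le> ennreal (r i)" if i: "i \<in> I" for i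
  proof -
    have [measurable]: "f i \<in> borel_measurable M" using int[OF i] by (rule borel_measurable_integrable)
    have "(\<integral>\<^sup>+ x. ennreal \<bar>f i x - g x\<bar> \<partial>M) = (\<integral>\<^sup>+ x. liminf (\<lambda>k. ennreal \<bar>f i x - F k x\<bar>) \<partial>M)"
    proof (rule nn_integral_cong_AE)
      show "AE x in M. ennreal \<bar>f i x - g x\<bar> = liminf (\<lambda>k. ennreal \<bar>f i x - F k x\<bar>)"
        using lim
      proof eventually_elim
        case (elim x)
        have "(\<lambda>k. ennreal \<bar>f i x - F k x\<bar>) \<longlonglongrightarrow> ennreal \<bar>f i x - g x\<bar>"
          unfolding g_def by (intro tendsto_intros elim)
        then show ?case by (rule lim_imp_Liminf[OF trivial_limit_sequentially, symmetric])
      qed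
    qed
    also have "\<dots> \<le> liminf (\<lambda>k. \<integral>\<^sup>+ x. ennreal \<bar>f i x - F k x\<bar> \<partial>M)"
      by (rule nn_integral_liminf) measurable
    also have "\<dots> \<le> liminf (\<lambda>k. ennreal (r i + (1/2) ^ k))"
    proof (rule Liminf_mono, rule always_eventually, rule allI)
      fix k
      have "(\<integral>\<^sup>+ x. ennreal \<bar>f i x - F k x\<bar> \<partial>M) = ennreal (\<integral>x. \<bar>f i x - F k x\<bar> \<partial>M)"
        by (rule nn_integral_eq_integral) (use iF int[OF i] in auto)
      also have "(\<integral>x. \<bar>f i x - F k x\<bar> \<partial>M) \<le> r i + r (e (s k))" unfolding F_def by (intro cauchy e i)
      also have "\<dots> \<le> r i + (1/2) ^ k" using s by simp
      finally show "(\<integral>\<^sup>+ x. ennreal \<bar>f i x - F k x\<bar> \<partial>M) \<le> ennreal (r i + (1/2) ^ k)" by (simp add: ennreal_leI)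
    qed
    also have "\<dots> = ennreal (r i)"
    proof -
      have "(\<lambda>k. r i + (1/2) ^ k) \<longlonglongrightarrow> r i + 0" by (intro tendsto_intros LIMSEQ_power_zero) auto
      then have "(\<lambda>k. ennreal (r i + (1/2) ^ k)) \<longlonglongrightarrow> ennreal (r i)" by (intro tendsto_ennrealI) simp
      then show ?thesis by (rule lim_imp_Liminf[OF trivial_limit_sequentially])
    qed
    finally show ?thesis .
  qed
  have id: "integrable M (\<lambda>x. f i x - g x)" if "i \<in> I" for i
  proof (rule integrableI_bounded)
    show "(\<lambda>x. f i x - g x) \<in> borel_measurable M" using borel_measurable_integrable[OF int[OF that]] by measurable
    show "(\<integral>\<^sup>+ x. ennreal (norm (f i x - g x)) \<partial>M) < \<infinity>" using bound[OF that] by (auto intro: le_less_trans)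
  qed
  have "integrable M (\<lambda>x. f (e 0) x - (f (e 0) x - g x))"
    using int[OF e] id[OF e] by (rule Bochner_Integration.integrable_diff)
  then have ig: "integrable M g" by simp
  have "(\<integral>x. \<bar>f i x - g x\<bar> \<partial>M) \<le> r i" if i: "i \<in> I" for i
  proof -
    have "ennreal (\<integral>x. \<bar>f i x - g x\<bar> \<partial>M) \<le> ennreal (r i)"
      using bound[OF i] nn_integral_eq_integral[OF integrable_abs[OF id[OF i]]] by simp
    \<comment> \<open>Comparing \<open>i\<close> with itself shows that \<open>r i\<close> is
      nonnegative, so the bound can leave \<open>ennreal\<close>.\<close>
    moreover have "0 \<le> r i"
    proof -
      have "0 \<le> (\<integral>x. \<bar>f i x - f i x\<bar> \<partial>M)" by simp
      also have "\<dots> \<le> r i + r i" by (rule cauchy[OF i i])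
      finally show ?thesis by simp
    qed
    ultimately show ?thesis by (simp add: ennreal_le_iff)
  qed
  with ig that show ?thesis by blast
qed

text \<open>The choice \<open>t = sqrt d\<close> gives \<open>5/2 * sqrt d\<close>, rounded up to 3.
  For \<open>d = 0\<close> that choice is not admissible, and \<open>t\<close> tends to 0
  instead.\<close>

lemma le_three_sqrt:
  fixes x d :: real
  assumes "0 \<le> d" "\<And>t. 0 < t \<Longrightarrow> x \<le> d / (2 * t) + 2 * t"
  shows "x \<le> 3 * sqrt d"
proof (cases "d = 0")
  case True
  show ?thesis
  proof (rule field_le_epsilon)
    fix e :: real assume "0 < e"
    then show "x \<le> 3 * sqrt d + e" using assms(2)[of "e / 2"] True by simp
  qed
next
  case False
  then have s: "sqrt d > 0" using assms by simp
  have "d / (2 * sqrt d) = sqrt d / 2" using assms(1) s by (simp add: field_simps)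
  then show ?thesis using assms(2)[OF s] s by linarith
qed

text \<open>Equality holds for negative \<open>v\<close>; for positive \<open>v\<close> the left
  side is the right side times \<open>exp (- v)\<close>. It tells how far a ratio is from 1 once its
  logarithm is bounded away from 0.\<close>

lemma abs_exp_minus_one_ge: "1 - exp (- \<bar>v\<bar>) \<le> \<bar>exp v - 1\<bar>" for v :: real
proof (cases "v \<ge> 0")
  case True
  have "1 - exp (- v) = (exp v - 1) * exp (- v)" by (simp add: algebra_simps exp_minus_inverse)
  also have "\<dots> \<le> (exp v - 1) * 1" using True by (intro mult_left_mono) auto
  finally show ?thesis using True by simp
next
  case False
  then show ?thesis by simp
qed

section \<open>Bounded functions supported on finite intensity\<close>

context poisson_model begin

definition bdd_fsupp :: "('a \<Rightarrow> 'b::{banach, second_countable_topology}) \<Rightarrow> bool" where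
  "bdd_fsupp h \<longleftrightarrow> h \<in> borel_measurable M \<and> (\<exists>C. \<forall>x. norm (h x) \<le> C) \<and>
     (\<exists>A\<in>sets M. emeasure \<rho> A < \<infinity> \<and> (\<forall>x. x \<notin> A \<longrightarrow> h x = 0))"

lemma bdd_fsuppI:
  "\<lbrakk>h \<in> borel_measurable M; \<And>x. norm (h x) \<le> C; A \<in> sets M; emeasure \<rho> A < \<infinity>; \<And>x. x \<notin> A \<Longrightarrow> h x = 0\<rbrakk> \<Longrightarrow> bdd_fsupp h"
  by (auto simp: bdd_fsupp_def)

lemma bdd_fsupp_measurable: "bdd_fsupp h \<Longrightarrow> h \<in> borel_measurable M"
  by (simp add: bdd_fsupp_def)

lemma bdd_fsupp_add:
  fixes h k :: "'a \<Rightarrow> 'b::{banach, second_countable_topology}"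
  assumes "bdd_fsupp h" "bdd_fsupp k" shows "bdd_fsupp (\<lambda>x. h x + k x)"
proof -
  obtain C A where C: "\<And>x. norm (h x) \<le> C" and A: "A \<in> sets M" "emeasure \<rho> A < \<infinity>" "\<And>x. x \<notin> A \<Longrightarrow> h x = 0"
    using assms(1) by (auto simp: bdd_fsupp_def)
  obtain D B where D: "\<And>x. norm (k x) \<le> D" and B: "B \<in> sets M" "emeasure \<rho> B < \<infinity>" "\<And>x. x \<notin> B \<Longrightarrow> k x = 0"
    using assms(2) by (auto simp: bdd_fsupp_def)
  have m: "h \<in> borel_measurable M" "k \<in> borel_measurable M" using assms by (auto simp: bdd_fsupp_def)
  show ?thesis
  proof (rule bdd_fsuppI[of _ "C + D" "A \<union> B"])
    show "(\<lambda>x. h x + k x) \<in> borel_measurable M" using m by measurable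
    show "norm (h x + k x) \<le> C + D" for x using norm_triangle_ineq[of "h x" "k x"] C[of x] D[of x] by linarith
    show "emeasure \<rho> (A \<union> B) < \<infinity>" using emeasure_subadditive[of A \<rho> B] A B
      by (metis (no_types, lifting) ennreal_add_less_top infinity_ennreal_def le_less_trans sets_intensity)
  qed (use A B in auto)
qed

text \<open>Domination through a monotone \<open>G\<close> with \<open>G 0 = 0\<close> keeps
  boundedness and support and lets the codomain change, as in the passage from real to imaginary
  exponents.\<close>

lemma bdd_fsupp_dominated:
  fixes h :: "'a \<Rightarrow> 'b::{banach, second_countable_topology}" and k :: "'a \<Rightarrow> 'c::{banach, second_countable_topology}"
  assumes h: "bdd_fsupp h" and k: "k \<in> borel_measurable M" "\<And>x. norm (k x) \<le> G (norm (h x))"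
    and G: "mono_on {0..} G" "G 0 = 0"
  shows "bdd_fsupp k"
proof -
  obtain C A where C: "\<And>x. norm (h x) \<le> C" and A: "A \<in> sets M" "emeasure \<rho> A < \<infinity>" "\<And>x. x \<notin> A \<Longrightarrow> h x = 0"
    using h by (auto simp: bdd_fsupp_def)
  show ?thesis
  proof (rule bdd_fsuppI[OF k(1) _ A(1,2), of "G C"])
    have "0 \<le> C" using C order_trans norm_ge_zero by blast
    then show "norm (k x) \<le> G C" for x using k(2)[of x] monotone_onD[OF G(1), of "norm (h x)" C] C[of x] by auto
    show "k x = 0" if "x \<notin> A" for x using k(2)[of x] A(3)[OF that] G(2) by simp
  qed
qed

lemma bdd_fsupp_scaleR:
  fixes h :: "'a \<Rightarrow> 'b::{banach, second_countable_topology}"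
  assumes "bdd_fsupp h" shows "bdd_fsupp (\<lambda>x. c *\<^sub>R h x)"
  by (rule bdd_fsupp_dominated[OF assms, where G="\<lambda>t. \<bar>c\<bar> * t"])
    (use bdd_fsupp_measurable[OF assms] in \<open>auto intro!: mono_onI mult_left_mono\<close>)

lemma bdd_fsupp_cmult: "bdd_fsupp h \<Longrightarrow> bdd_fsupp (\<lambda>x. c * h x)" for c :: real and h :: "'a \<Rightarrow> real"
  using bdd_fsupp_scaleR[of h c] by simp

lemma bdd_fsupp_uminus: "bdd_fsupp h \<Longrightarrow> bdd_fsupp (\<lambda>x. - h x)" for h :: "'a \<Rightarrow> real"
  using bdd_fsupp_scaleR[of h "-1"] by simp

lemma bdd_fsupp_diff: "bdd_fsupp h \<Longrightarrow> bdd_fsupp k \<Longrightarrow> bdd_fsupp (\<lambda>x. h x - k x)" for h k :: "'a \<Rightarrow> real"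
  using bdd_fsupp_add[OF _ bdd_fsupp_uminus, of h k] by simp

lemma bdd_fsupp_exp_minus_1:
  fixes h :: "'a \<Rightarrow> 'b::{real_normed_field, banach, second_countable_topology}"
  assumes "bdd_fsupp h" shows "bdd_fsupp (\<lambda>x. exp (h x) - 1)"
proof -
  obtain C A where C: "\<And>x. norm (h x) \<le> C" and A: "A \<in> sets M" "emeasure \<rho> A < \<infinity>" "\<And>x. x \<notin> A \<Longrightarrow> h x = 0"
    using assms by (auto simp: bdd_fsupp_def)
  show ?thesis
  proof (rule bdd_fsuppI[of _ "exp C + 1" A])
    show "(\<lambda>x. exp (h x) - 1) \<in> borel_measurable M" using bdd_fsupp_measurable[OF assms] by measurable
    fix x
    have "norm (exp (h x) - 1) \<le> norm (exp (h x)) + 1" using norm_triangle_ineq4[of "exp (h x)" 1] by simp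
    also have "norm (exp (h x)) \<le> exp C" using norm_exp[of "h x"] C[of x] by (meson exp_le_cancel_iff order_trans)
    finally show "norm (exp (h x) - 1) \<le> exp C + 1" by simp
  qed (use A in auto)
qed

lemma bdd_fsupp_integrable:
  fixes h :: "'a \<Rightarrow> 'b::{banach, second_countable_topology}"
  assumes "bdd_fsupp h" shows "integrable \<rho> h"
proof -
  obtain C A where C: "\<And>x. norm (h x) \<le> C" and A: "A \<in> sets M" "emeasure \<rho> A < \<infinity>" "\<And>x. x \<notin> A \<Longrightarrow> h x = 0"
    using assms by (auto simp: bdd_fsupp_def)
  show ?thesis
    by (rule integrableI_bounded_set[of A _ _ C]) (use A C bdd_fsupp_measurable[OF assms] in auto)
qed

lemma bdd_fsupp_AE_integrable:
  fixes h :: "'a \<Rightarrow> 'b::{banach, second_countable_topology}"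
  assumes "bdd_fsupp h" shows "AE \<omega> in P. integrable (cmeas \<omega>) h"
proof -
  obtain C A where C: "\<And>x. norm (h x) \<le> C" and A: "A \<in> sets M" "emeasure \<rho> A < \<infinity>" "\<And>x. x \<notin> A \<Longrightarrow> h x = 0"
    using assms by (auto simp: bdd_fsupp_def)
  show ?thesis
    using AE_cnt_finite[OF A(1,2)] by eventually_elim (rule integrable_cmeas_bounded(1)[OF _ C A(3)])
qed

lemma bdd_fsupp_exp:
  fixes h :: "'a \<Rightarrow> complex"
  assumes "bdd_fsupp h"
  shows "(\<integral>\<omega>. exp (integral\<^sup>L (cmeas \<omega>) h) \<partial>P) = exp (\<integral>x. exp (h x) - 1 \<partial>\<rho>)"
  using assms exp_cmeas unfolding bdd_fsupp_def by metis

lemma bdd_fsupp_exp_real: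
  fixes h :: "'a \<Rightarrow> real"
  assumes "bdd_fsupp h"
  shows "(\<integral>\<omega>. exp (integral\<^sup>L (cmeas \<omega>) h) \<partial>P) = exp (\<integral>x. exp (h x) - 1 \<partial>\<rho>)"
    and "integrable P (\<lambda>\<omega>. exp (integral\<^sup>L (cmeas \<omega>) h))"
  using assms exp_cmeas_real exp_cmeas_integrable[where 'b=real] unfolding bdd_fsupp_def by metis+

end

text \<open>The right side minus the left is \<open>(sqrt y - 2)^2\<close>. For
  \<open>y = \<phi> x\<close> it makes the density integrable on every set of finite
  intensity.\<close>

lemma le_two_sq_sqrt: "0 < y \<Longrightarrow> y \<le> 2 * (sqrt y - 1)\<^sup>2 + 2" for y :: real
proof -
  assume "0 < y"
  have "0 \<le> (sqrt y - 2)\<^sup>2" by simp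
  then show ?thesis using \<open>0 < y\<close> by (simp add: power2_diff)
qed

section \<open>Two equivalent intensities and the truncated logarithm\<close>

locale poisson_pair = mu: poisson_model M \<rho> P + nu: poisson_model M "density \<rho> (\<lambda>x. ennreal (\<phi> x))" Q
  for M \<rho> :: "'a measure" and \<phi> :: "'a \<Rightarrow> real" and P Q :: "('a \<Rightarrow> nat) measure" +
  assumes phi_meas [measurable]: "\<phi> \<in> borel_measurable M" and phi_pos: "\<And>x. 0 < \<phi> x"
    and L2: "(\<integral>\<^sup>+ x. ennreal ((sqrt (\<phi> x) - 1)\<^sup>2) \<partial>\<rho>) < \<infinity>"
begin

lemma integrable_L2: "integrable \<rho> (\<lambda>x. (sqrt (\<phi> x) - 1)\<^sup>2)"
  using L2 by (intro integrableI_bounded) auto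

lemma emeasure_density_finite:
  assumes A: "A \<in> sets M" "emeasure \<rho> A < \<infinity>"
  shows "emeasure (density \<rho> (\<lambda>x. ennreal (\<phi> x))) A < \<infinity>"
proof -
  have "emeasure (density \<rho> (\<lambda>x. ennreal (\<phi> x))) A = (\<integral>\<^sup>+ x. ennreal (\<phi> x) * indicator A x \<partial>\<rho>)"
    using A by (subst emeasure_density) auto
  also have "\<dots> \<le> (\<integral>\<^sup>+ x. ennreal (2 * (sqrt (\<phi> x) - 1)\<^sup>2) + 2 * indicator A x \<partial>\<rho>)"
  proof (rule nn_integral_mono)
    fix x
    have "ennreal (\<phi> x) \<le> ennreal (2 * (sqrt (\<phi> x) - 1)\<^sup>2 + 2)" by (intro ennreal_leI le_two_sq_sqrt phi_pos)
    then show "ennreal (\<phi> x) * indicator A x \<le> ennreal (2 * (sqrt (\<phi> x) - 1)\<^sup>2) + 2 * indicator A x"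
      by (auto split: split_indicator)
  qed
  also have "\<dots> = (\<integral>\<^sup>+ x. ennreal (2 * (sqrt (\<phi> x) - 1)\<^sup>2) \<partial>\<rho>) + 2 * emeasure \<rho> A"
    using A by (subst nn_integral_add) (auto simp: nn_integral_cmult_indicator)
  also have "(\<integral>\<^sup>+ x. ennreal (2 * (sqrt (\<phi> x) - 1)\<^sup>2) \<partial>\<rho>) = 2 * (\<integral>\<^sup>+ x. ennreal ((sqrt (\<phi> x) - 1)\<^sup>2) \<partial>\<rho>)"
    by (simp add: ennreal_mult nn_integral_cmult)
  finally show ?thesis using L2 A by (auto simp: ennreal_mult_less_top intro: le_less_trans)
qed

lemma bdd_fsupp_nu:
  fixes h :: "'a \<Rightarrow> 'b::{banach, second_countable_topology}"
  shows "mu.bdd_fsupp h \<Longrightarrow> nu.bdd_fsupp h"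
  unfolding mu.bdd_fsupp_def nu.bdd_fsupp_def using emeasure_density_finite by blast

definition level :: "real \<Rightarrow> 'a set" where
  "level \<epsilon> = {x. \<epsilon> < \<bar>ln (\<phi> x)\<bar>}"

lemma level_sets [measurable]: "level \<epsilon> \<in> sets M"
proof -
  have "{x \<in> space M. \<epsilon> < \<bar>ln (\<phi> x)\<bar>} \<in> sets M" by measurable
  then show ?thesis by (simp add: level_def mu.space_M)
qed

lemma sqrt_phi: "sqrt (\<phi> x) = exp (ln (\<phi> x) / 2)"
  using phi_pos[of x] by (simp add: ln_sqrt[symmetric])

lemma level_finite:
  assumes "0 < \<epsilon>" shows "emeasure \<rho> (level \<epsilon>) < \<infinity>"
proof -
  \<comment> \<open>Lower bound of \<open>(sqrt \<phi> - 1)^2\<close> on the level set, approached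
    when \<open>ln \<phi>\<close> is just below \<open>- \<epsilon>\<close>; Markov's inequality
    then gives finiteness.\<close>
  define c where "c = (1 - exp (- (\<epsilon> / 2)))\<^sup>2"
  have c: "0 < c" using assms by (simp add: c_def)
  have "ennreal c * emeasure \<rho> (level \<epsilon>) = (\<integral>\<^sup>+ x. ennreal c * indicator (level \<epsilon>) x \<partial>\<rho>)"
    by (subst nn_integral_cmult_indicator) auto
  also have "\<dots> \<le> (\<integral>\<^sup>+ x. ennreal ((sqrt (\<phi> x) - 1)\<^sup>2) \<partial>\<rho>)"
  proof (rule nn_integral_mono)
    fix x
    have "c \<le> (sqrt (\<phi> x) - 1)\<^sup>2" if "x \<in> level \<epsilon>"
    proof -
      have "1 - exp (- (\<epsilon> / 2)) \<le> 1 - exp (- \<bar>ln (\<phi> x) / 2\<bar>)" using that by (auto simp: level_def)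
      also have "\<dots> \<le> \<bar>exp (ln (\<phi> x) / 2) - 1\<bar>" by (rule abs_exp_minus_one_ge)
      finally have "1 - exp (- (\<epsilon> / 2)) \<le> \<bar>sqrt (\<phi> x) - 1\<bar>" by (simp add: sqrt_phi)
      then have "(1 - exp (- (\<epsilon> / 2)))\<^sup>2 \<le> \<bar>sqrt (\<phi> x) - 1\<bar>\<^sup>2" using assms by (intro power_mono) auto
      then show ?thesis by (simp add: c_def)
    qed
    then show "ennreal c * indicator (level \<epsilon>) x \<le> ennreal ((sqrt (\<phi> x) - 1)\<^sup>2)"
      by (auto split: split_indicator intro: ennreal_leI)
  qed
  also have "\<dots> < \<infinity>" by (rule L2)
  finally show ?thesis using c by (auto simp: ennreal_mult_less_top)
qed

definition trunc :: "real \<Rightarrow> 'a \<Rightarrow> real" where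
  "trunc \<epsilon> x = (if \<epsilon> < \<bar>ln (\<phi> x)\<bar> \<and> \<bar>ln (\<phi> x)\<bar> \<le> 1 / \<epsilon> then ln (\<phi> x) else 0)"

lemma trunc_measurable [measurable]: "trunc \<epsilon> \<in> borel_measurable M"
  unfolding trunc_def by measurable

lemma bdd_fsupp_trunc: "0 < \<epsilon> \<Longrightarrow> mu.bdd_fsupp (trunc \<epsilon>)"
  by (rule mu.bdd_fsuppI[of _ "1/\<epsilon>" "level \<epsilon>"]) (use level_finite[of \<epsilon>] level_sets[of \<epsilon>] in \<open>auto simp: trunc_def level_def\<close>)

text \<open>At each point the truncation is eventually exact, so pointwise limits of expressions in
  it are limits of eventually constant sequences.\<close>

lemma trunc_eventually:
  assumes e: "\<And>n. 0 < \<epsilon> n" "\<epsilon> \<longlonglongrightarrow> 0"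
  shows "\<forall>\<^sub>F n in sequentially. trunc (\<epsilon> n) x = ln (\<phi> x)"
proof (cases "ln (\<phi> x) = 0")
  case True
  then show ?thesis by (simp add: trunc_def)
next
  case False
  \<comment> \<open>Below the first entry \<epsilon> passes the lower cut-off, below the second it
    satisfies \<open>\<bar>ln (\<phi> x)\<bar> \<le> 1 / \<epsilon>\<close>.\<close>
  define m where "m = min \<bar>ln (\<phi> x)\<bar> (1 / \<bar>ln (\<phi> x)\<bar>)"
  have "0 < m" using False by (simp add: m_def)
  from order_tendstoD(2)[OF e(2) this] show ?thesis
  proof eventually_elim
    case (elim n)
    have "\<epsilon> n < 1 / \<bar>ln (\<phi> x)\<bar>" "\<epsilon> n < \<bar>ln (\<phi> x)\<bar>" using elim by (auto simp: m_def)
    then have "\<bar>ln (\<phi> x)\<bar> < 1 / \<epsilon> n" using e(1)[of n] False by (simp add: field_simps)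
    then show ?case using \<open>\<epsilon> n < \<bar>ln (\<phi> x)\<bar>\<close> by (simp add: trunc_def)
  qed
qed

text \<open>\<open>exp (log_Z \<epsilon> \<omega>)\<close> is the density of the Poisson law whose
  intensity is \<open>exp (trunc \<epsilon> x)\<close> times \<open>\<rho>\<close>;
  \<open>integral_Z_laplace\<close> shows this at the level of Laplace functionals.\<close>

definition log_Z :: "real \<Rightarrow> ('a \<Rightarrow> nat) \<Rightarrow> real" where
  "log_Z \<epsilon> \<omega> = integral\<^sup>L (cmeas \<omega>) (trunc \<epsilon>) - (\<integral>x. exp (trunc \<epsilon> x) - 1 \<partial>\<rho>)"

text \<open>Squared \<open>L2\<close> distance between the square root of the truncated density and
  \<open>sqrt \<phi>\<close>: the error parameter of the \<open>L1\<close> estimates.\<close>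

definition trunc_defect :: "real \<Rightarrow> real" where
  "trunc_defect \<epsilon> = (\<integral>x. (exp (trunc \<epsilon> x / 2) - sqrt (\<phi> x))\<^sup>2 \<partial>\<rho>)"

lemma log_Z_measurable [measurable]: "log_Z \<epsilon> \<in> borel_measurable P"
  unfolding log_Z_def by measurable

text \<open>The left side is 0 or equal to the right side, according to whether the truncation keeps
  the point.\<close>

lemma trunc_defect_integrand_le: "(exp (trunc \<epsilon> x / 2) - sqrt (\<phi> x))\<^sup>2 \<le> (sqrt (\<phi> x) - 1)\<^sup>2"
  by (auto simp: trunc_def sqrt_phi[symmetric] power2_commute)

lemma integrable_trunc_defect: "integrable \<rho> (\<lambda>x. (exp (trunc \<epsilon> x / 2) - sqrt (\<phi> x))\<^sup>2)"
  by (rule Bochner_Integration.integrable_bound[OF integrable_L2]) (use trunc_defect_integrand_le in auto)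

lemma trunc_defect_tendsto:
  assumes e: "\<And>n. 0 < \<epsilon> n" "\<epsilon> \<longlonglongrightarrow> 0"
  shows "(\<lambda>n. trunc_defect (\<epsilon> n)) \<longlonglongrightarrow> 0"
proof -
  have "(\<lambda>n. trunc_defect (\<epsilon> n)) \<longlonglongrightarrow> (\<integral>x. 0 \<partial>\<rho>)"
    unfolding trunc_defect_def
  proof (rule integral_dominated_convergence[OF _ _ integrable_L2])
    show "AE x in \<rho>. (\<lambda>n. (exp (trunc (\<epsilon> n) x / 2) - sqrt (\<phi> x))\<^sup>2) \<longlonglongrightarrow> 0"
    proof (rule AE_I2, rule tendsto_eventually)
      fix x show "\<forall>\<^sub>F n in sequentially. (exp (trunc (\<epsilon> n) x / 2) - sqrt (\<phi> x))\<^sup>2 = 0"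
        using trunc_eventually[OF e, of x] by eventually_elim (simp add: sqrt_phi)
    qed
  qed (use trunc_defect_integrand_le in auto)
  then show ?thesis by simp
qed

section \<open>Normalization and Hellinger affinity of the truncated densities\<close>

lemma exp_log_Z:
  assumes "0 < \<epsilon>"
  shows "integrable P (\<lambda>\<omega>. exp (log_Z \<epsilon> \<omega>))" "(\<integral>\<omega>. exp (log_Z \<epsilon> \<omega>) \<partial>P) = 1"
  using mu.bdd_fsupp_exp_real[OF bdd_fsupp_trunc[OF assms]] by (simp_all add: log_Z_def exp_diff)

text \<open>With \<open>s\<close>, \<open>t\<close> for the two truncations, the exponent of the
  affinity is the integral of \<open>exp ((s + t) / 2) - 1\<close> minus the average of the two
  normalizing integrals; completing the square leaves \<open>- D / 2\<close>. The last claim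
  separates the two parameters by comparison with \<open>sqrt \<phi>\<close>.\<close>

lemma integral_sqrt_Z:
  assumes e: "0 < \<epsilon>" "0 < \<eta>"
  defines "D \<equiv> (\<integral>x. (exp (trunc \<epsilon> x / 2) - exp (trunc \<eta> x / 2))\<^sup>2 \<partial>\<rho>)"
  shows "integrable P (\<lambda>\<omega>. exp (log_Z \<epsilon> \<omega> / 2) * exp (log_Z \<eta> \<omega> / 2))"
    "(\<integral>\<omega>. exp (log_Z \<epsilon> \<omega> / 2) * exp (log_Z \<eta> \<omega> / 2) \<partial>P) = exp (- D / 2)"
    "D \<le> 2 * trunc_defect \<epsilon> + 2 * trunc_defect \<eta>"
proof -
  let ?h = "\<lambda>x. trunc \<epsilon> x / 2 + trunc \<eta> x / 2"
  let ?a = "\<integral>x. exp (trunc \<epsilon> x) - 1 \<partial>\<rho>" and ?b = "\<integral>x. exp (trunc \<eta> x) - 1 \<partial>\<rho>"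
  note b = bdd_fsupp_trunc[OF e(1)] bdd_fsupp_trunc[OF e(2)]
  have bh: "mu.bdd_fsupp ?h" using mu.bdd_fsupp_add[OF mu.bdd_fsupp_cmult[OF b(1), of "1/2"] mu.bdd_fsupp_cmult[OF b(2), of "1/2"]] by simp
  define c where "c = (?a + ?b) / 2"
  have ae: "AE \<omega> in P. exp (log_Z \<epsilon> \<omega> / 2) * exp (log_Z \<eta> \<omega> / 2) = exp (integral\<^sup>L (cmeas \<omega>) ?h) * exp (- c)"
    using mu.bdd_fsupp_AE_integrable[OF b(1)] mu.bdd_fsupp_AE_integrable[OF b(2)]
  proof eventually_elim
    case (elim \<omega>)
    have "integral\<^sup>L (cmeas \<omega>) ?h = integral\<^sup>L (cmeas \<omega>) (trunc \<epsilon>) / 2 + integral\<^sup>L (cmeas \<omega>) (trunc \<eta>) / 2"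
      using elim by simp
    then show ?case by (simp add: log_Z_def c_def exp_add[symmetric] field_simps)
  qed
  note [measurable] = bh[THEN mu.bdd_fsupp_measurable]
  show "integrable P (\<lambda>\<omega>. exp (log_Z \<epsilon> \<omega> / 2) * exp (log_Z \<eta> \<omega> / 2))"
    by (subst integrable_cong_AE[OF _ _ ae]) (use mu.bdd_fsupp_exp_real(2)[OF bh] in auto)
  have "(\<integral>\<omega>. exp (log_Z \<epsilon> \<omega> / 2) * exp (log_Z \<eta> \<omega> / 2) \<partial>P) = (\<integral>\<omega>. exp (integral\<^sup>L (cmeas \<omega>) ?h) * exp (- c) \<partial>P)"
    by (rule integral_cong_AE[OF _ _ ae]) auto
  also have "\<dots> = exp ((\<integral>x. exp (?h x) - 1 \<partial>\<rho>) - (?a + ?b) / 2)"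
    by (simp only: c_def[symmetric] integral_mult_left_zero mu.bdd_fsupp_exp_real(1)[OF bh] exp_diff exp_minus) (simp only: divide_inverse)
  also have "(\<integral>x. exp (?h x) - 1 \<partial>\<rho>) - (?a + ?b) / 2 = - D / 2"
  proof -
    note i = mu.bdd_fsupp_integrable[OF mu.bdd_fsupp_exp_minus_1[OF bh]] mu.bdd_fsupp_integrable[OF mu.bdd_fsupp_exp_minus_1[OF b(1)]] mu.bdd_fsupp_integrable[OF mu.bdd_fsupp_exp_minus_1[OF b(2)]]
    have "D = (\<integral>x. (exp (trunc \<epsilon> x) - 1) + (exp (trunc \<eta> x) - 1) - 2 * (exp (?h x) - 1) \<partial>\<rho>)"
      unfolding D_def
    proof (rule Bochner_Integration.integral_cong[OF refl])
      fix x
      have "(exp (trunc \<epsilon> x / 2) - exp (trunc \<eta> x / 2))\<^sup>2 = exp (trunc \<epsilon> x / 2)^2 + exp (trunc \<eta> x / 2)^2 - 2 * (exp (trunc \<epsilon> x / 2) * exp (trunc \<eta> x / 2))"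
        by (simp add: power2_diff)
      then show "(exp (trunc \<epsilon> x / 2) - exp (trunc \<eta> x / 2))\<^sup>2 = (exp (trunc \<epsilon> x) - 1) + (exp (trunc \<eta> x) - 1) - 2 * (exp (?h x) - 1)"
        by (simp add: exp_double[symmetric] exp_add)
    qed
    also have "\<dots> = ?a + ?b - 2 * (\<integral>x. exp (?h x) - 1 \<partial>\<rho>)"
      by (simp only: Bochner_Integration.integral_diff[OF Bochner_Integration.integrable_add[OF i(2,3)] integrable_mult_right[OF i(1)]]
        Bochner_Integration.integral_add[OF i(2,3)] integral_mult_right_zero)
    finally show ?thesis by (simp add: field_simps)
  qed
  finally show "(\<integral>\<omega>. exp (log_Z \<epsilon> \<omega> / 2) * exp (log_Z \<eta> \<omega> / 2) \<partial>P) = exp (- D / 2)" .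
  have "D \<le> (\<integral>x. 2 * (exp (trunc \<epsilon> x / 2) - sqrt (\<phi> x))\<^sup>2 + 2 * (exp (trunc \<eta> x / 2) - sqrt (\<phi> x))\<^sup>2 \<partial>\<rho>)"
    unfolding D_def
  proof (rule integral_mono')
    show "integrable \<rho> (\<lambda>x. 2 * (exp (trunc \<epsilon> x / 2) - sqrt (\<phi> x))\<^sup>2 + 2 * (exp (trunc \<eta> x / 2) - sqrt (\<phi> x))\<^sup>2)"
      using integrable_trunc_defect by auto
    \<comment> \<open>The right side minus the left is \<open>(p + q - 2 * s)^2\<close>.\<close>
    have sq: "(p - q)\<^sup>2 \<le> 2 * (p - s)\<^sup>2 + 2 * (q - s)\<^sup>2" for p q s :: real
      using zero_le_power2[of "p + q - 2 * s"] by (simp add: power2_eq_square algebra_simps)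
    show "(exp (trunc \<epsilon> x / 2) - exp (trunc \<eta> x / 2))\<^sup>2 \<le> 2 * (exp (trunc \<epsilon> x / 2) - sqrt (\<phi> x))\<^sup>2 + 2 * (exp (trunc \<eta> x / 2) - sqrt (\<phi> x))\<^sup>2" for x
      by (rule sq)
  qed auto
  also have "\<dots> = 2 * trunc_defect \<epsilon> + 2 * trunc_defect \<eta>" unfolding trunc_defect_def using integrable_trunc_defect by simp
  finally show "D \<le> 2 * trunc_defect \<epsilon> + 2 * trunc_defect \<eta>" .
qed

lemma trunc_defect_nonneg: "0 \<le> trunc_defect \<epsilon>"
  unfolding trunc_defect_def by simp

text \<open>A Cauchy-Schwarz bound for \<open>a^2 - b^2 = (a - b) * (a + b)\<close> in parametrized
  form: for each \<open>t\<close> only the integrals of \<open>a^2\<close>, \<open>b^2\<close> and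
  \<open>a * b\<close> occur, which are known. \<open>le_three_sqrt\<close> then chooses
  \<open>t\<close>.\<close>

lemma L1_dist_Z:
  assumes e: "0 < \<epsilon>" "0 < \<eta>"
  shows "(\<integral>\<omega>. \<bar>exp (log_Z \<epsilon> \<omega>) - exp (log_Z \<eta> \<omega>)\<bar> \<partial>P) \<le> 3 * sqrt (2 * trunc_defect \<epsilon>) + 3 * sqrt (2 * trunc_defect \<eta>)"
proof -
  let ?d = "2 * trunc_defect \<epsilon> + 2 * trunc_defect \<eta>"
  let ?p = "\<lambda>\<omega>. exp (log_Z \<epsilon> \<omega> / 2)" and ?q = "\<lambda>\<omega>. exp (log_Z \<eta> \<omega> / 2)"
  note i = exp_log_Z(1)[OF e(1)] exp_log_Z(1)[OF e(2)] integral_sqrt_Z(1)[OF e]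
  have "(\<integral>\<omega>. \<bar>exp (log_Z \<epsilon> \<omega>) - exp (log_Z \<eta> \<omega>)\<bar> \<partial>P) \<le> ?d / (2 * t) + 2 * t" if t: "0 < t" for t
  proof -
    have "(\<integral>\<omega>. \<bar>exp (log_Z \<epsilon> \<omega>) - exp (log_Z \<eta> \<omega>)\<bar> \<partial>P) \<le>
      (\<integral>\<omega>. (exp (log_Z \<epsilon> \<omega>) + exp (log_Z \<eta> \<omega>) - 2 * (?p \<omega> * ?q \<omega>)) / (2 * t) + t * (exp (log_Z \<epsilon> \<omega>) + exp (log_Z \<eta> \<omega>)) \<partial>P)"
    proof (rule integral_mono)
      show "integrable P (\<lambda>\<omega>. \<bar>exp (log_Z \<epsilon> \<omega>) - exp (log_Z \<eta> \<omega>)\<bar>)" using i by auto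
      show "integrable P (\<lambda>\<omega>. (exp (log_Z \<epsilon> \<omega>) + exp (log_Z \<eta> \<omega>) - 2 * (?p \<omega> * ?q \<omega>)) / (2 * t) + t * (exp (log_Z \<epsilon> \<omega>) + exp (log_Z \<eta> \<omega>)))"
        using i by auto
      fix \<omega>
      have *: "\<bar>a\<^sup>2 - b\<^sup>2\<bar> \<le> (a - b)\<^sup>2 / (2 * t) + t * (a\<^sup>2 + b\<^sup>2)" for a b :: real
      proof -
        have "0 \<le> (\<bar>a - b\<bar> / t - \<bar>a + b\<bar>)\<^sup>2 * t / 2" using t by simp
        also have "\<dots> = (a - b)\<^sup>2 / (2 * t) - \<bar>a - b\<bar> * \<bar>a + b\<bar> + t * (a + b)\<^sup>2 / 2"
          using t by (simp add: power2_diff power_divide field_simps power2_eq_square)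
        also have "\<bar>a - b\<bar> * \<bar>a + b\<bar> = \<bar>a\<^sup>2 - b\<^sup>2\<bar>" by (simp add: abs_mult[symmetric] power2_eq_square algebra_simps)
        also have "t * (a + b)\<^sup>2 / 2 \<le> t * (a\<^sup>2 + b\<^sup>2)"
        proof -
          have "(a + b)\<^sup>2 / 2 \<le> a\<^sup>2 + b\<^sup>2" using zero_le_power2[of "a - b"] by (simp add: power2_eq_square algebra_simps)
          from mult_left_mono[OF this, of t] t show ?thesis by simp
        qed
        finally show ?thesis by simp
      qed
      have sq: "(?p \<omega>)\<^sup>2 = exp (log_Z \<epsilon> \<omega>)" "(?q \<omega>)\<^sup>2 = exp (log_Z \<eta> \<omega>)" by (simp_all add: exp_double[symmetric])
      show "\<bar>exp (log_Z \<epsilon> \<omega>) - exp (log_Z \<eta> \<omega>)\<bar> \<le> (exp (log_Z \<epsilon> \<omega>) + exp (log_Z \<eta> \<omega>) - 2 * (?p \<omega> * ?q \<omega>)) / (2 * t) + t * (exp (log_Z \<epsilon> \<omega>) + exp (log_Z \<eta> \<omega>))"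
        using *[of "?p \<omega>" "?q \<omega>"] unfolding power2_diff sq by (simp add: mult.assoc)
    qed
    also have "\<dots> = (2 - 2 * (\<integral>\<omega>. ?p \<omega> * ?q \<omega> \<partial>P)) / (2 * t) + t * 2"
      using i exp_log_Z(2)[OF e(1)] exp_log_Z(2)[OF e(2)] by simp
    also have "\<dots> \<le> ?d / (2 * t) + 2 * t"
    proof -
      let ?D = "\<integral>x. (exp (trunc \<epsilon> x / 2) - exp (trunc \<eta> x / 2))\<^sup>2 \<partial>\<rho>"
      \<comment> \<open>\<open>1 - x \<le> exp (- x)\<close> bounds the affinity from below, hence
        the squared Hellinger distance, 2 minus twice the affinity, by \<open>?D\<close>.\<close>
      have "1 - ?D / 2 \<le> (\<integral>\<omega>. ?p \<omega> * ?q \<omega> \<partial>P)"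
        unfolding integral_sqrt_Z(2)[OF e] using exp_ge_add_one_self[of "- ?D / 2"] by simp
      moreover have "?D \<le> ?d" by (rule integral_sqrt_Z(3)[OF e])
      moreover have "1 - ?d / 2 \<le> c" if "1 - b / 2 \<le> c" "b \<le> ?d" for b c :: real using that by (simp add: field_simps)
      ultimately have "1 - ?d / 2 \<le> (\<integral>\<omega>. ?p \<omega> * ?q \<omega> \<partial>P)" by blast
      then have "2 - 2 * (\<integral>\<omega>. ?p \<omega> * ?q \<omega> \<partial>P) \<le> ?d" by (simp add: field_simps)
      then show ?thesis using t by (simp add: divide_right_mono)
    qed
    finally show ?thesis .
  qed
  then have "(\<integral>\<omega>. \<bar>exp (log_Z \<epsilon> \<omega>) - exp (log_Z \<eta> \<omega>)\<bar> \<partial>P) \<le> 3 * sqrt ?d"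
    using trunc_defect_nonneg by (intro le_three_sqrt) auto
  also have "\<dots> \<le> 3 * sqrt (2 * trunc_defect \<epsilon>) + 3 * sqrt (2 * trunc_defect \<eta>)"
    using sqrt_add_le_add_sqrt[of "2 * trunc_defect \<epsilon>" "2 * trunc_defect \<eta>"] trunc_defect_nonneg by simp
  finally show ?thesis .
qed

text \<open>Weighting by \<open>exp (log_Z \<epsilon> \<omega>)\<close> tilts the intensity by
  \<open>exp (trunc \<epsilon> x)\<close>: the right side is the Laplace functional of the Poisson
  law with the tilted intensity.\<close>

lemma integral_Z_laplace:
  assumes e: "0 < \<epsilon>" and h: "mu.bdd_fsupp h"
  shows "(\<integral>\<omega>. exp (log_Z \<epsilon> \<omega>) * exp (- integral\<^sup>L (cmeas \<omega>) h) \<partial>P) = exp (\<integral>x. exp (trunc \<epsilon> x) * (exp (- h x) - 1) \<partial>\<rho>)"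
proof -
  let ?h = "\<lambda>x. trunc \<epsilon> x - h x"
  let ?a = "\<integral>x. exp (trunc \<epsilon> x) - 1 \<partial>\<rho>"
  note b = bdd_fsupp_trunc[OF e]
  have bh: "mu.bdd_fsupp ?h" using mu.bdd_fsupp_diff[OF b h] .
  note [measurable] = bh[THEN mu.bdd_fsupp_measurable] h[THEN mu.bdd_fsupp_measurable]
  have ae: "AE \<omega> in P. exp (log_Z \<epsilon> \<omega>) * exp (- integral\<^sup>L (cmeas \<omega>) h) = exp (integral\<^sup>L (cmeas \<omega>) ?h) * exp (- ?a)"
    using mu.bdd_fsupp_AE_integrable[OF b] mu.bdd_fsupp_AE_integrable[OF h]
    by eventually_elim (simp add: log_Z_def exp_add[symmetric])
  have "(\<integral>\<omega>. exp (log_Z \<epsilon> \<omega>) * exp (- integral\<^sup>L (cmeas \<omega>) h) \<partial>P) = (\<integral>\<omega>. exp (integral\<^sup>L (cmeas \<omega>) ?h) * exp (- ?a) \<partial>P)"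
    by (rule integral_cong_AE[OF _ _ ae]) auto
  also have "\<dots> = exp ((\<integral>x. exp (?h x) - 1 \<partial>\<rho>) - ?a)"
    using mu.bdd_fsupp_exp_real(1)[OF bh] by (simp add: exp_diff exp_minus divide_inverse)
  also have "(\<integral>x. exp (?h x) - 1 \<partial>\<rho>) - ?a = (\<integral>x. (exp (?h x) - 1) - (exp (trunc \<epsilon> x) - 1) \<partial>\<rho>)"
    by (rule Bochner_Integration.integral_diff[symmetric]) (intro mu.bdd_fsupp_integrable mu.bdd_fsupp_exp_minus_1 bh b)+
  also have "\<dots> = (\<integral>x. exp (trunc \<epsilon> x) * (exp (- h x) - 1) \<partial>\<rho>)"
    by (rule Bochner_Integration.integral_cong) (simp_all add: right_diff_distrib exp_add[symmetric])
  finally show ?thesis .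
qed

lemma exp_trunc_le: "exp (trunc \<epsilon> x) \<le> \<phi> x + 1"
  using phi_pos[of x] by (auto simp: trunc_def)

text \<open>The error bound is kept for every single \<epsilon>, so that convergence in probability
  can be read off without passing to subsequences.\<close>

lemma density_exists:
  obtains g where "g \<in> borel_measurable P" "\<And>\<omega>. 0 \<le> g \<omega>" "integrable P g" "density P (\<lambda>\<omega>. ennreal (g \<omega>)) = Q"
    "\<And>\<epsilon>. 0 < \<epsilon> \<Longrightarrow> (\<integral>\<omega>. \<bar>exp (log_Z \<epsilon> \<omega>) - g \<omega>\<bar> \<partial>P) \<le> 3 * sqrt (2 * trunc_defect \<epsilon>)"
proof -
  define e :: "nat \<Rightarrow> real" where "e n = 1 / real (Suc n)" for n
  have e: "\<And>n. 0 < e n" "e \<longlonglongrightarrow> 0" unfolding e_def using LIMSEQ_inverse_real_of_nat by (auto simp: inverse_eq_divide)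
  have r0: "(\<lambda>n. 3 * sqrt (2 * trunc_defect (e n))) \<longlonglongrightarrow> 0"
  proof -
    have "(\<lambda>n. 3 * sqrt (2 * trunc_defect (e n))) \<longlonglongrightarrow> 3 * sqrt (2 * 0)" by (intro tendsto_intros trunc_defect_tendsto e)
    then show ?thesis by simp
  qed
  obtain g0 where g0: "integrable P g0" "\<And>\<epsilon>. \<epsilon> \<in> {0<..} \<Longrightarrow> (\<integral>\<omega>. \<bar>exp (log_Z \<epsilon> \<omega>) - g0 \<omega>\<bar> \<partial>P) \<le> 3 * sqrt (2 * trunc_defect \<epsilon>)"
  proof (rule L1_Cauchy_family_limit[of "{0<..}" P "\<lambda>\<epsilon> \<omega>. exp (log_Z \<epsilon> \<omega>)" "\<lambda>\<epsilon>. 3 * sqrt (2 * trunc_defect \<epsilon>)" e])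
    show "integrable P (\<lambda>\<omega>. exp (log_Z \<epsilon> \<omega>))" if "\<epsilon> \<in> {0<..}" for \<epsilon> using exp_log_Z(1)[of \<epsilon>] that by simp
    show "(\<integral>\<omega>. \<bar>exp (log_Z \<epsilon> \<omega>) - exp (log_Z \<eta> \<omega>)\<bar> \<partial>P) \<le> 3 * sqrt (2 * trunc_defect \<epsilon>) + 3 * sqrt (2 * trunc_defect \<eta>)"
      if "\<epsilon> \<in> {0<..}" "\<eta> \<in> {0<..}" for \<epsilon> \<eta> using L1_dist_Z[of \<epsilon> \<eta>] that by simp
    show "e n \<in> {0<..}" for n using e(1) by simp
    show "(\<lambda>n. 3 * sqrt (2 * trunc_defect (e n))) \<longlonglongrightarrow> 0" by (rule r0)
  qed (use that in blast)
  \<comment> \<open>An \<open>L1\<close> limit of positive functions is nonnegative only almost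
    everywhere. Cutting it at 0 makes this hold everywhere and does not increase its distance to the
    functions \<open>exp (log_Z \<epsilon> \<omega>)\<close>.\<close>
  define g where "g \<omega> = max 0 (g0 \<omega>)" for \<omega>
  have ig: "integrable P g" unfolding g_def using g0(1) by auto
  have gm[measurable]: "g \<in> borel_measurable P" using ig by auto
  have gnn: "0 \<le> g \<omega>" for \<omega> by (simp add: g_def)
  have gb: "(\<integral>\<omega>. \<bar>exp (log_Z \<epsilon> \<omega>) - g \<omega>\<bar> \<partial>P) \<le> 3 * sqrt (2 * trunc_defect \<epsilon>)" if "0 < \<epsilon>" for \<epsilon>
  proof -
    have "(\<integral>\<omega>. \<bar>exp (log_Z \<epsilon> \<omega>) - g \<omega>\<bar> \<partial>P) \<le> (\<integral>\<omega>. \<bar>exp (log_Z \<epsilon> \<omega>) - g0 \<omega>\<bar> \<partial>P)"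
    proof (rule integral_mono)
      show "\<bar>exp (log_Z \<epsilon> \<omega>) - g \<omega>\<bar> \<le> \<bar>exp (log_Z \<epsilon> \<omega>) - g0 \<omega>\<bar>" for \<omega>
        using exp_gt_zero[of "log_Z \<epsilon> \<omega>"] unfolding g_def by linarith
    qed (use exp_log_Z(1)[OF that] ig g0(1) in auto)
    also have "\<dots> \<le> 3 * sqrt (2 * trunc_defect \<epsilon>)" using g0(2)[of \<epsilon>] that by simp
    finally show ?thesis .
  qed
  \<comment> \<open>\<open>L1\<close> convergence tested against weights bounded by 1:
    \<open>W = 1\<close> yields the total mass and \<open>exp (- integral h)\<close> the Laplace
    functional.\<close>
  have conv: "(\<lambda>n. \<integral>\<omega>. exp (log_Z (e n) \<omega>) * W \<omega> \<partial>P) \<longlonglongrightarrow> (\<integral>\<omega>. g \<omega> * W \<omega> \<partial>P)"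
    if W[measurable]: "W \<in> borel_measurable P" and W1: "AE \<omega> in P. \<bar>W \<omega>\<bar> \<le> 1" for W
  proof -
    have iW: "integrable P (\<lambda>\<omega>. f \<omega> * W \<omega>)" if f: "integrable P f" for f
    proof (rule Bochner_Integration.integrable_bound[OF f])
      show "(\<lambda>\<omega>. f \<omega> * W \<omega>) \<in> borel_measurable P" using f by measurable
      show "AE \<omega> in P. norm (f \<omega> * W \<omega>) \<le> norm (f \<omega>)"
        using W1 by eventually_elim (auto simp: abs_mult mult_left_le)
    qed
    have "norm ((\<integral>\<omega>. exp (log_Z (e n) \<omega>) * W \<omega> \<partial>P) - (\<integral>\<omega>. g \<omega> * W \<omega> \<partial>P)) \<le> 3 * sqrt (2 * trunc_defect (e n))" for n
    proof -
      have "(\<integral>\<omega>. exp (log_Z (e n) \<omega>) * W \<omega> \<partial>P) - (\<integral>\<omega>. g \<omega> * W \<omega> \<partial>P) = (\<integral>\<omega>. (exp (log_Z (e n) \<omega>) - g \<omega>) * W \<omega> \<partial>P)"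
        unfolding left_diff_distrib by (rule Bochner_Integration.integral_diff[symmetric]; rule iW) (use exp_log_Z(1)[OF e(1)] ig in auto)
      also have "norm \<dots> \<le> (\<integral>\<omega>. norm ((exp (log_Z (e n) \<omega>) - g \<omega>) * W \<omega>) \<partial>P)" by (rule integral_norm_bound)
      also have "\<dots> \<le> (\<integral>\<omega>. \<bar>exp (log_Z (e n) \<omega>) - g \<omega>\<bar> \<partial>P)"
      proof (rule integral_mono_AE)
        show "AE \<omega> in P. norm ((exp (log_Z (e n) \<omega>) - g \<omega>) * W \<omega>) \<le> \<bar>exp (log_Z (e n) \<omega>) - g \<omega>\<bar>"
          using W1 by eventually_elim (auto simp: abs_mult mult_left_le)
        show "integrable P (\<lambda>\<omega>. norm ((exp (log_Z (e n) \<omega>) - g \<omega>) * W \<omega>))"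
          using iW[of "\<lambda>\<omega>. exp (log_Z (e n) \<omega>) - g \<omega>"] exp_log_Z(1)[OF e(1)] ig by (intro integrable_norm) auto
      qed (use exp_log_Z(1)[OF e(1)] ig in auto)
      also have "\<dots> \<le> 3 * sqrt (2 * trunc_defect (e n))" by (rule gb[OF e(1)])
      finally show ?thesis .
    qed
    then have "(\<lambda>n. (\<integral>\<omega>. exp (log_Z (e n) \<omega>) * W \<omega> \<partial>P) - (\<integral>\<omega>. g \<omega> * W \<omega> \<partial>P)) \<longlonglongrightarrow> 0"
      by (intro Lim_null_comparison[OF _ r0] always_eventually allI)
    then show ?thesis by (simp add: Lim_null[symmetric])
  qed
  let ?G = "density P (\<lambda>\<omega>. ennreal (g \<omega>))"
  have Eg: "(\<integral>\<omega>. g \<omega> \<partial>P) = 1"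
  proof -
    have "(\<lambda>n. 1) \<longlonglongrightarrow> (\<integral>\<omega>. g \<omega> \<partial>P)" using conv[of "\<lambda>_. 1"] exp_log_Z(2)[OF e(1)] by simp
    then show ?thesis using LIMSEQ_unique tendsto_const by blast
  qed
  have "?G = Q"
  proof -
    obtain Y :: "nat \<Rightarrow> 'a set" where Y: "range Y \<subseteq> sets \<rho>" "(\<Union>n. Y n) = space \<rho>" "\<And>n. emeasure \<rho> (Y n) \<noteq> \<infinity>" "incseq Y"
      by (rule mu.intensity.sigma_finite_incseq) blast
    have YM: "Y n \<in> sets M" "emeasure \<rho> (Y n) < \<infinity>" for n using Y by (auto simp: top.not_eq_extremum)
    show ?thesis
    proof (rule laplace_functional_unique[of _ _ M Y])
      show "prob_space ?G"
      proof
        have "emeasure ?G (space ?G) = (\<integral>\<^sup>+ \<omega>. ennreal (g \<omega>) \<partial>P)"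
          by (subst emeasure_density) (use sets.top[of P] in \<open>auto intro!: nn_integral_cong\<close>)
        also have "\<dots> = ennreal (\<integral>\<omega>. g \<omega> \<partial>P)" by (rule nn_integral_eq_integral[OF ig]) (simp add: gnn)
        finally show "emeasure ?G (space ?G) = 1" by (simp add: Eg)
      qed
      show "prob_space Q" by unfold_locales
      show "sets ?G = sets (Xstar M)" by (simp add: mu.sets_P)
      show "sets Q = sets (Xstar M)" by (rule nu.sets_P)
      show "space M = UNIV" by (rule mu.space_M)
      show "range Y \<subseteq> sets M" "incseq Y" "(\<Union>n. Y n) = UNIV" using Y by auto
      show "AE \<omega> in ?G. cnt \<omega> (Y n) < \<infinity>" for n
        using mu.AE_cnt_finite[OF YM(1,2), of n] by (subst AE_density) auto
      show "AE \<omega> in Q. cnt \<omega> (Y n) < \<infinity>" for n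
        by (rule nu.AE_cnt_finite[OF YM(1) emeasure_density_finite[OF YM]])
      fix h :: "'a \<Rightarrow> real" and C n
      assume h: "h \<in> borel_measurable M" "\<And>x. 0 \<le> h x" "\<And>x. h x \<le> C" "\<And>x. x \<notin> Y n \<Longrightarrow> h x = 0"
      have bh: "mu.bdd_fsupp h" by (rule mu.bdd_fsuppI[OF h(1) _ YM h(4), where C=C]) (use h in auto)
      note [measurable] = h(1)
      have c0: "(\<integral>\<omega>. exp (- integral\<^sup>L (cmeas \<omega>) h) \<partial>?G) = (\<integral>\<omega>. g \<omega> * exp (- integral\<^sup>L (cmeas \<omega>) h) \<partial>P)"
        using gnn by (subst integral_density) auto
      have c1: "(\<lambda>n. \<integral>\<omega>. exp (log_Z (e n) \<omega>) * exp (- integral\<^sup>L (cmeas \<omega>) h) \<partial>P) \<longlonglongrightarrow> (\<integral>\<omega>. g \<omega> * exp (- integral\<^sup>L (cmeas \<omega>) h) \<partial>P)"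
        by (rule conv) (use h(2) in \<open>auto intro!: AE_I2 integral_nonneg\<close>)
      \<comment> \<open>On \<open>Y n\<close> the function \<open>\<phi>\<close> is integrable
        because the second intensity is finite there, and off \<open>Y n\<close> the integrand
        vanishes with \<open>h\<close>; so \<open>\<phi> + 1\<close> on \<open>Y n\<close>
        dominates.\<close>
      have c2: "(\<lambda>n. \<integral>\<omega>. exp (log_Z (e n) \<omega>) * exp (- integral\<^sup>L (cmeas \<omega>) h) \<partial>P) \<longlonglongrightarrow> exp (\<integral>x. \<phi> x * (exp (- h x) - 1) \<partial>\<rho>)"
        unfolding integral_Z_laplace[OF e(1) bh]
      proof (rule tendsto_exp, rule integral_dominated_convergence[where w="\<lambda>x. (\<phi> x + 1) * indicator (Y n) x"])
        have "integrable \<rho> (\<lambda>x. \<phi> x * indicator (Y n) x)"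
        proof (rule integrableI_bounded)
          have "(\<integral>\<^sup>+ x. ennreal (norm (\<phi> x * indicator (Y n) x)) \<partial>\<rho>) = emeasure (density \<rho> (\<lambda>x. ennreal (\<phi> x))) (Y n)"
            using YM phi_pos by (subst emeasure_density) (auto intro!: nn_integral_cong simp: abs_mult less_imp_le split: split_indicator)
          then show "(\<integral>\<^sup>+ x. ennreal (norm (\<phi> x * indicator (Y n) x)) \<partial>\<rho>) < \<infinity>"
            using emeasure_density_finite[OF YM] by simp
        qed (use YM in measurable)
        moreover have "integrable \<rho> (\<lambda>x. 1 * indicator (Y n) x :: real)" using YM by auto
        ultimately show "integrable \<rho> (\<lambda>x. (\<phi> x + 1) * indicator (Y n) x)" by (simp add: distrib_right)
        show "AE x in \<rho>. (\<lambda>n. exp (trunc (e n) x) * (exp (- h x) - 1)) \<longlonglongrightarrow> \<phi> x * (exp (- h x) - 1)"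
        proof (rule AE_I2, rule tendsto_eventually)
          fix x show "\<forall>\<^sub>F n in sequentially. exp (trunc (e n) x) * (exp (- h x) - 1) = \<phi> x * (exp (- h x) - 1)"
            using trunc_eventually[OF e, of x] by eventually_elim (simp add: phi_pos)
        qed
        show "AE x in \<rho>. norm (exp (trunc (e k) x) * (exp (- h x) - 1)) \<le> (\<phi> x + 1) * indicator (Y n) x" for k
        proof (rule AE_I2)
          fix x
          have "\<bar>exp (- h x) - 1\<bar> \<le> indicator (Y n) x"
            using h(2)[of x] h(4)[of x] by (auto split: split_indicator simp: abs_if)
          then have "exp (trunc (e k) x) * \<bar>exp (- h x) - 1\<bar> \<le> (\<phi> x + 1) * indicator (Y n) x"
            using exp_trunc_le[of "e k" x] phi_pos[of x] by (intro mult_mono) (auto intro: order_trans)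
          then show "norm (exp (trunc (e k) x) * (exp (- h x) - 1)) \<le> (\<phi> x + 1) * indicator (Y n) x"
            by (simp add: abs_mult)
        qed
      qed measurable
      have c3: "(\<integral>\<omega>. exp (- integral\<^sup>L (cmeas \<omega>) h) \<partial>Q) = exp (\<integral>x. \<phi> x * (exp (- h x) - 1) \<partial>\<rho>)"
      proof -
        have "(\<integral>\<omega>. exp (- integral\<^sup>L (cmeas \<omega>) h) \<partial>Q) = (\<integral>\<omega>. exp (integral\<^sup>L (cmeas \<omega>) (\<lambda>x. - h x)) \<partial>Q)"
          by simp
        also have "\<dots> = exp (\<integral>x. exp (- h x) - 1 \<partial>density \<rho> (\<lambda>x. ennreal (\<phi> x)))"
          by (rule nu.bdd_fsupp_exp_real(1)[OF nu.bdd_fsupp_uminus[OF bdd_fsupp_nu[OF bh]]])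
        also have "(\<integral>x. exp (- h x) - 1 \<partial>density \<rho> (\<lambda>x. ennreal (\<phi> x))) = (\<integral>x. \<phi> x * (exp (- h x) - 1) \<partial>\<rho>)"
          using phi_pos by (subst integral_density) (auto simp: less_imp_le)
        finally show ?thesis .
      qed
      show "(\<integral>\<omega>. exp (- integral\<^sup>L (cmeas \<omega>) h) \<partial>?G) = (\<integral>\<omega>. exp (- integral\<^sup>L (cmeas \<omega>) h) \<partial>Q)"
        unfolding c0 c3 by (rule LIMSEQ_unique[OF c1 c2])
    qed
  qed
  with gm gnn ig gb that show ?thesis by blast
qed

end

section \<open>The logarithm of the density\<close>

lemma sq_exp_half_lower:
  fixes u :: real
  shows "\<bar>u\<bar> > 1 \<Longrightarrow> 1 / 3 \<le> \<bar>exp (u / 2) - 1\<bar>" and "min (u\<^sup>2) 1 \<le> 16 * (exp (u / 2) - 1)\<^sup>2"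
proof -
  \<comment> \<open>\<open>exp (1/2) \<ge> 3/2\<close> gives the gap \<open>1/3\<close> for
    \<open>\<bar>u\<bar> > 1\<close>, whose square \<open>1/9\<close> exceeds \<open>1/16\<close>.
    The constant 16 comes from the slope bound \<open>\<bar>u\<bar> / 4\<close> for
    \<open>\<bar>u\<bar> \<le> 1\<close>.\<close>
  have half: "exp (- (1/2::real)) \<le> 2 / 3"
  proof -
    have "3 / 2 \<le> exp (1/2::real)" using exp_ge_add_one_self[of "1/2::real"] by linarith
    then have "inverse (exp (1/2::real)) \<le> inverse (3/2)" by (intro le_imp_inverse_le) auto
    then show ?thesis by (simp add: exp_minus)
  qed
  show big: "1 / 3 \<le> \<bar>exp (u / 2) - 1\<bar>" if "\<bar>u\<bar> > 1"
  proof -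
    have "exp (- \<bar>u / 2\<bar>) \<le> exp (- (1/2))" using that by simp
    then show ?thesis using half abs_exp_minus_one_ge[of "u / 2"] by linarith
  qed
  show "min (u\<^sup>2) 1 \<le> 16 * (exp (u / 2) - 1)\<^sup>2"
  proof (cases "\<bar>u\<bar> > 1")
    case True
    have "(1/3)\<^sup>2 \<le> \<bar>exp (u / 2) - 1\<bar>\<^sup>2" using big[OF True] by (intro power_mono) auto
    then show ?thesis by (auto simp: power2_eq_square)
  next
    case False
    have "\<bar>u\<bar> / 4 \<le> \<bar>exp (u / 2) - 1\<bar>"
    proof (cases "0 \<le> u")
      case True
      then show ?thesis using exp_ge_add_one_self[of "u / 2"] True by linarith
    next
      case neg: False
      \<comment> \<open>The quarter is a product of two halves: the lower bound of
        \<open>exp (u / 2)\<close> for \<open>u \<ge> - 1\<close>, and the slope at 0 of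
        \<open>exp (- u / 2)\<close> up to sign.\<close>
      have "1 / 2 \<le> exp (u / 2)" using exp_ge_add_one_self[of "u / 2"] False by linarith
      moreover have "- u / 2 \<le> exp (- u / 2) - 1" using exp_ge_add_one_self[of "- u / 2"] by linarith
      ultimately have "(1 / 2) * (- u / 2) \<le> exp (u / 2) * (exp (- u / 2) - 1)" using neg by (intro mult_mono) auto
      also have "\<dots> = 1 - exp (u / 2)" by (simp add: right_diff_distrib exp_add[symmetric])
      finally show ?thesis using neg by simp
    qed
    then have "(\<bar>u\<bar> / 4)\<^sup>2 \<le> \<bar>exp (u / 2) - 1\<bar>\<^sup>2" by (intro power_mono) auto
    then show ?thesis by (simp add: power_divide)
  qed
qed

text \<open>With \<open>y = exp (u / 2) - 1\<close> one has \<open>exp u - 1 = y^2 + 2 * y\<close>,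
  and \<open>\<bar>y\<bar> \<ge> 1/3\<close> gives \<open>\<bar>y\<bar> \<le> 3 * y^2\<close>; hence
  7 as \<open>1 + 2 * 3\<close>.\<close>

lemma exp_minus_1_big:
  fixes u :: real assumes "\<bar>u\<bar> > 1"
  shows "\<bar>exp u - 1\<bar> \<le> 7 * (exp (u / 2) - 1)\<^sup>2"
proof -
  define y where "y = exp (u / 2) - 1"
  have "\<bar>y\<bar> * (1/3) \<le> \<bar>y\<bar> * \<bar>y\<bar>" using sq_exp_half_lower(1)[OF assms] by (intro mult_left_mono) (auto simp: y_def)
  then have "\<bar>y\<bar> \<le> 3 * y\<^sup>2" by (simp add: power2_eq_square)
  moreover have "exp u - 1 = y\<^sup>2 + 2 * y"
    by (simp add: y_def power2_eq_square algebra_simps exp_add[symmetric])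
  ultimately have "\<bar>exp u - 1\<bar> \<le> 7 * y\<^sup>2" using zero_le_power2[of y] by linarith
  then show ?thesis by (simp add: y_def)
qed

text \<open>Again \<open>exp u - 1 = y^2 + 2 * y\<close>; subtracting \<open>u\<close> compensates
  the linear term, as \<open>y - u / 2 \<le> 2 * y^2\<close>, and 5 is
  \<open>1 + 2 * 2\<close>.\<close>

lemma exp_minus_1_minus_small:
  fixes u :: real assumes "\<bar>u\<bar> \<le> 1"
  shows "exp u - 1 - u \<le> 5 * (exp (u / 2) - 1)\<^sup>2"
proof -
  let ?w = "u / 2" let ?y = "exp ?w - 1"
  have "?y - ?w \<le> ?y\<^sup>2 * exp (- ?w)"
  proof -
    have "1 - ?w \<le> exp (- ?w)" using exp_ge_add_one_self[of "- ?w"] by linarith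
    then have "?y - ?w \<le> exp ?w + exp (- ?w) - 2" by simp
    also have "\<dots> = ?y\<^sup>2 * exp (- ?w)" by (simp add: power2_eq_square algebra_simps exp_add[symmetric])
    finally show ?thesis .
  qed
  also have "\<dots> \<le> ?y\<^sup>2 * 2"
  proof (rule mult_left_mono)
    have "1 / 2 \<le> exp ?w" using exp_ge_add_one_self[of ?w] assms by linarith
    then have "inverse (exp ?w) \<le> inverse (1/2)" by (intro le_imp_inverse_le) auto
    then show "exp (- ?w) \<le> 2" by (simp add: exp_minus)
  qed simp
  finally have "?y - ?w \<le> 2 * ?y\<^sup>2" by simp
  moreover have "exp u - 1 = ?y\<^sup>2 + 2 * ?y"
    by (simp add: power2_eq_square algebra_simps exp_add[symmetric])
  ultimately show ?thesis by simp
qed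

text \<open>For \<open>\<bar>u\<bar> \<le> 1\<close> the Taylor remainder
  \<open>(a * u)^2 / 2\<close> and \<open>u^2 \<le> 16 * (exp (u / 2) - 1)^2\<close> give
  \<open>8 * a^2\<close>; otherwise the trivial bound 2 and
  \<open>1 \<le> 16 * (exp (u / 2) - 1)^2\<close> give 32.\<close>

lemma norm_iexp_compensated_le:
  fixes u a :: real
  shows "cmod (iexp (a * u) - 1 - \<i> * complex_of_real (a * u * indicator {-1..1} u)) \<le> (8 * a\<^sup>2 + 32) * (exp (u / 2) - 1)\<^sup>2"
proof (cases "\<bar>u\<bar> \<le> 1")
  case True
  have "cmod (iexp (a * u) - (\<Sum>k\<le>1. (\<i> * complex_of_real (a * u)) ^ k / fact k)) \<le> \<bar>a * u\<bar> ^ Suc 1 / fact (Suc 1)"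
    by (rule iexp_approx1)
  also have "(\<Sum>k\<le>1. (\<i> * complex_of_real (a * u)) ^ k / fact k) = 1 + \<i> * complex_of_real (a * u)" by simp
  also have "\<bar>a * u\<bar> ^ Suc 1 / fact (Suc 1) = a\<^sup>2 / 2 * u\<^sup>2" by (simp add: power2_eq_square abs_mult_self_eq)
  also have "\<dots> \<le> a\<^sup>2 / 2 * (16 * (exp (u / 2) - 1)\<^sup>2)"
  proof (rule mult_left_mono)
    have "u\<^sup>2 \<le> 1" using True by (simp add: abs_square_le_1)
    then show "u\<^sup>2 \<le> 16 * (exp (u / 2) - 1)\<^sup>2" using sq_exp_half_lower(2)[of u] by simp
  qed simp
  also have "\<dots> \<le> (8 * a\<^sup>2 + 32) * (exp (u / 2) - 1)\<^sup>2" by (simp add: algebra_simps)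
  finally show ?thesis using True by (simp add: diff_diff_eq abs_le_iff)
next
  case False
  then have "1 \<le> \<bar>u\<bar>\<^sup>2" by (intro one_le_power) simp
  then have le: "1 \<le> 16 * (exp (u / 2) - 1)\<^sup>2" using sq_exp_half_lower(2)[of u] by simp
  have two: "cmod (iexp (a * u) - 1) \<le> 2" using norm_triangle_ineq4[of "iexp (a * u)" 1] by simp
  have mono: "32 * (exp (u / 2) - 1)\<^sup>2 \<le> (8 * a\<^sup>2 + 32) * (exp (u / 2) - 1)\<^sup>2" by (intro mult_right_mono) auto
  have "x \<le> c" if "1 \<le> 16 * q" "x \<le> 2" "32 * q \<le> c" for x q c :: real using that by linarith
  note this[OF le two mono]
  moreover have "indicator {-1..1} u = (0::real)" using False by (auto simp: indicator_def)
  ultimately show ?thesis by simp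
qed

section \<open>Exchange of the two intensities and positivity of the density\<close>

context poisson_pair begin

text \<open>The \<open>L2\<close> condition is symmetric:
  \<open>\<phi> * (sqrt (1 / \<phi>) - 1)^2 = (1 - sqrt \<phi>)^2\<close>, so the one for
  \<open>1 / \<phi>\<close> under the second intensity is the original one.\<close>

lemma swap: "poisson_pair M (density \<rho> (\<lambda>x. ennreal (\<phi> x))) (\<lambda>x. 1 / \<phi> x) Q P"
proof -
  have d: "density (density \<rho> (\<lambda>x. ennreal (\<phi> x))) (\<lambda>x. ennreal (1 / \<phi> x)) = \<rho>"
  proof -
    have one: "ennreal (\<phi> x) * ennreal (1 / \<phi> x) = 1" for x
      using phi_pos[of x] by (simp add: ennreal_mult[symmetric] less_imp_le)
    show ?thesis by (subst density_density_eq) (auto simp: one density_1)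
  qed
  show ?thesis
  proof (intro poisson_pair.intro poisson_pair_axioms.intro)
    show "poisson_model M (density \<rho> (\<lambda>x. ennreal (\<phi> x))) Q" by unfold_locales
    show "poisson_model M (density (density \<rho> (\<lambda>x. ennreal (\<phi> x))) (\<lambda>x. ennreal (1 / \<phi> x))) P"
      unfolding d by unfold_locales
    show "(\<lambda>x. 1 / \<phi> x) \<in> borel_measurable M" by measurable
    show "0 < 1 / \<phi> x" for x using phi_pos by simp
    have "(\<integral>\<^sup>+ x. ennreal ((sqrt (1 / \<phi> x) - 1)\<^sup>2) \<partial>density \<rho> (\<lambda>x. ennreal (\<phi> x))) = (\<integral>\<^sup>+ x. ennreal (\<phi> x) * ennreal ((sqrt (1 / \<phi> x) - 1)\<^sup>2) \<partial>\<rho>)"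
      by (rule nn_integral_density) auto
    also have "\<dots> = (\<integral>\<^sup>+ x. ennreal ((sqrt (\<phi> x) - 1)\<^sup>2) \<partial>\<rho>)"
    proof (rule nn_integral_cong)
      fix x
      have p: "0 < \<phi> x" by (rule phi_pos)
      then have "\<phi> x * (sqrt (1 / \<phi> x) - 1)\<^sup>2 = (sqrt (\<phi> x) * (sqrt (1 / \<phi> x) - 1))\<^sup>2" by (simp add: power_mult_distrib)
      also have "sqrt (\<phi> x) * (sqrt (1 / \<phi> x) - 1) = 1 - sqrt (\<phi> x)" using p by (simp add: right_diff_distrib real_sqrt_divide)
      finally show "ennreal (\<phi> x) * ennreal ((sqrt (1 / \<phi> x) - 1)\<^sup>2) = ennreal ((sqrt (\<phi> x) - 1)\<^sup>2)"
        using p by (simp add: ennreal_mult[symmetric] power2_commute)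
    qed
    finally show "(\<integral>\<^sup>+ x. ennreal ((sqrt (1 / \<phi> x) - 1)\<^sup>2) \<partial>density \<rho> (\<lambda>x. ennreal (\<phi> x))) < \<infinity>" using L2 by simp
  qed
qed

text \<open>A real-valued logarithm, meaningful where the derivative is positive and finite; the
  proof of \<open>exp_log_RN\<close> shows that this is almost everywhere.\<close>

definition log_RN :: "('a \<Rightarrow> nat) \<Rightarrow> real" where
  "log_RN \<omega> = ln (enn2real (RN_deriv P Q \<omega>))"

lemma log_RN_measurable [measurable]: "log_RN \<in> borel_measurable P"
  unfolding log_RN_def by measurable

lemma absolutely_continuous_PQ: "absolutely_continuous P Q"
proof -
  obtain g where "g \<in> borel_measurable P" "density P (\<lambda>\<omega>. ennreal (g \<omega>)) = Q" by (rule density_exists)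
  then show ?thesis using absolutely_continuousI_density[of "\<lambda>\<omega>. ennreal (g \<omega>)" P] by simp
qed

lemma exp_log_RN:
  shows "integrable P (\<lambda>\<omega>. exp (log_RN \<omega>))" "density P (\<lambda>\<omega>. ennreal (exp (log_RN \<omega>))) = Q"
    "\<And>\<epsilon>. 0 < \<epsilon> \<Longrightarrow> (\<integral>\<omega>. \<bar>exp (log_Z \<epsilon> \<omega>) - exp (log_RN \<omega>)\<bar> \<partial>P) \<le> 3 * sqrt (2 * trunc_defect \<epsilon>)"
proof -
  obtain g where g[measurable]: "g \<in> borel_measurable P" and g0: "\<And>\<omega>. 0 \<le> g \<omega>" and ig: "integrable P g"
    and dg: "density P (\<lambda>\<omega>. ennreal (g \<omega>)) = Q"
    and gb: "\<And>\<epsilon>. 0 < \<epsilon> \<Longrightarrow> (\<integral>\<omega>. \<bar>exp (log_Z \<epsilon> \<omega>) - g \<omega>\<bar> \<partial>P) \<le> 3 * sqrt (2 * trunc_defect \<epsilon>)"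
    by (rule density_exists) blast
  have acQP: "absolutely_continuous Q P" by (rule poisson_pair.absolutely_continuous_PQ[OF swap])
  \<comment> \<open>The zero set of \<open>g\<close> is null for \<open>Q\<close>, whose density is
    \<open>g\<close>, and therefore for \<open>P\<close>, by absolute continuity in the exchanged
    direction.\<close>
  let ?S = "{\<omega> \<in> space P. g \<omega> = 0}"
  have S: "?S \<in> sets P" by measurable
  have "emeasure Q ?S = (\<integral>\<^sup>+ \<omega>. ennreal (g \<omega>) * indicator ?S \<omega> \<partial>P)"
    unfolding dg[symmetric] using S by (subst emeasure_density) auto
  also have "\<dots> = (\<integral>\<^sup>+ \<omega>. 0 \<partial>P)" by (rule nn_integral_cong) (auto split: split_indicator)
  finally have "?S \<in> null_sets Q" using S by (simp add: null_sets_def mu.sets_P nu.sets_P)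
  then have "?S \<in> null_sets P" using acQP by (auto simp: absolutely_continuous_def)
  then have pos: "AE \<omega> in P. 0 < g \<omega>"
    by (rule AE_not_in[THEN AE_mp]) (use g0 in \<open>auto intro!: AE_I2 simp: less_le\<close>)
  have "AE \<omega> in P. ennreal (g \<omega>) = RN_deriv P Q \<omega>" by (rule mu.RN_deriv_unique[OF _ dg]) measurable
  with pos have ae: "AE \<omega> in P. exp (log_RN \<omega>) = g \<omega>"
  proof eventually_elim
    case (elim \<omega>)
    have "log_RN \<omega> = ln (g \<omega>)" unfolding log_RN_def elim(2)[symmetric] using g0 by simp
    then show ?case using elim by simp
  qed
  show "integrable P (\<lambda>\<omega>. exp (log_RN \<omega>))" by (subst integrable_cong_AE[OF _ _ ae]) (use ig in auto)
  show "density P (\<lambda>\<omega>. ennreal (exp (log_RN \<omega>))) = Q"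
  proof -
    have "density P (\<lambda>\<omega>. ennreal (exp (log_RN \<omega>))) = density P (\<lambda>\<omega>. ennreal (g \<omega>))"
      by (rule density_cong) (use ae in auto)
    then show ?thesis by (simp only: dg)
  qed
  show "(\<integral>\<omega>. \<bar>exp (log_Z \<epsilon> \<omega>) - exp (log_RN \<omega>)\<bar> \<partial>P) \<le> 3 * sqrt (2 * trunc_defect \<epsilon>)" if "0 < \<epsilon>" for \<epsilon>
  proof -
    have "(\<integral>\<omega>. \<bar>exp (log_Z \<epsilon> \<omega>) - exp (log_RN \<omega>)\<bar> \<partial>P) = (\<integral>\<omega>. \<bar>exp (log_Z \<epsilon> \<omega>) - g \<omega>\<bar> \<partial>P)"
      by (rule integral_cong_AE) (use ae in auto)
    then show ?thesis using gb[OF that] by simp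
  qed
qed

lemma integral_exp_log_RN: "(\<integral>\<omega>. exp (log_RN \<omega>) \<partial>P) = 1"
proof -
  have "emeasure Q (space P) = (\<integral>\<^sup>+ \<omega>. ennreal (exp (log_RN \<omega>)) * indicator (space P) \<omega> \<partial>P)"
    using emeasure_density[of "\<lambda>\<omega>. ennreal (exp (log_RN \<omega>))" P, OF _ sets.top] by (simp add: exp_log_RN(2))
  also have "\<dots> = (\<integral>\<^sup>+ \<omega>. ennreal (exp (log_RN \<omega>)) \<partial>P)" by (rule nn_integral_cong) simp
  also have "\<dots> = ennreal (\<integral>\<omega>. exp (log_RN \<omega>) \<partial>P)" by (rule nn_integral_eq_integral[OF exp_log_RN(1)]) simp
  finally have "ennreal (\<integral>\<omega>. exp (log_RN \<omega>) \<partial>P) = ennreal 1" using nu.emeasure_space_1 by simp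
  then show ?thesis by (subst (asm) ennreal_inj) auto
qed

section \<open>Convergence of the logarithms\<close>

lemma L1_tendsto:
  assumes e: "\<And>n. 0 < \<epsilon> n" "\<epsilon> \<longlonglongrightarrow> 0"
  shows "(\<lambda>n. \<integral>\<omega>. \<bar>exp (log_Z (\<epsilon> n) \<omega>) - exp (log_RN \<omega>)\<bar> \<partial>P) \<longlonglongrightarrow> 0"
proof (rule tendsto_sandwich)
  show "\<forall>\<^sub>F n in sequentially. 0 \<le> (\<integral>\<omega>. \<bar>exp (log_Z (\<epsilon> n) \<omega>) - exp (log_RN \<omega>)\<bar> \<partial>P)" by simp
  show "\<forall>\<^sub>F n in sequentially. (\<integral>\<omega>. \<bar>exp (log_Z (\<epsilon> n) \<omega>) - exp (log_RN \<omega>)\<bar> \<partial>P) \<le> 3 * sqrt (2 * trunc_defect (\<epsilon> n))"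
    using exp_log_RN(3)[OF e(1)] by simp
  have "(\<lambda>n. 3 * sqrt (2 * trunc_defect (\<epsilon> n))) \<longlonglongrightarrow> 3 * sqrt (2 * 0)" by (intro tendsto_intros trunc_defect_tendsto e)
  then show "(\<lambda>n. 3 * sqrt (2 * trunc_defect (\<epsilon> n))) \<longlonglongrightarrow> 0" by simp
qed simp

text \<open>\<open>L1\<close> convergence gives almost sure convergence along a subsequence, and the
  logarithm is continuous at the positive limit. Dominated convergence and Fatou are later applied
  along it.\<close>

lemma AE_approximation:
  obtains \<epsilon> :: "nat \<Rightarrow> real" where "\<And>n. 0 < \<epsilon> n" "\<epsilon> \<longlonglongrightarrow> 0" "AE \<omega> in P. (\<lambda>n. log_Z (\<epsilon> n) \<omega>) \<longlonglongrightarrow> log_RN \<omega>"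
proof -
  define e :: "nat \<Rightarrow> real" where "e n = 1 / real (Suc n)" for n
  have e: "\<And>n. 0 < e n" "e \<longlonglongrightarrow> 0" unfolding e_def using LIMSEQ_inverse_real_of_nat by (auto simp: inverse_eq_divide)
  obtain r where r: "strict_mono r" "AE \<omega> in P. (\<lambda>n. exp (log_Z (e (r n)) \<omega>) - exp (log_RN \<omega>)) \<longlonglongrightarrow> 0"
    using tendsto_L1_AE_subseq[of P "\<lambda>n \<omega>. exp (log_Z (e n) \<omega>) - exp (log_RN \<omega>)"] L1_tendsto[OF e]
      exp_log_RN(1) exp_log_Z(1)[OF e(1)] by auto
  have "AE \<omega> in P. (\<lambda>n. log_Z (e (r n)) \<omega>) \<longlonglongrightarrow> log_RN \<omega>"
    using r(2)
  proof eventually_elim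
    case (elim \<omega>)
    then have "(\<lambda>n. exp (log_Z (e (r n)) \<omega>)) \<longlonglongrightarrow> exp (log_RN \<omega>)" by (simp add: Lim_null[symmetric])
    then have "(\<lambda>n. ln (exp (log_Z (e (r n)) \<omega>))) \<longlonglongrightarrow> ln (exp (log_RN \<omega>))" by (intro tendsto_ln) auto
    then show ?case by simp
  qed
  moreover have "(e \<circ> r) \<longlonglongrightarrow> 0" by (rule LIMSEQ_subseq_LIMSEQ[OF e(2) r(1)])
  ultimately show ?thesis using that[of "e \<circ> r"] e(1) by simp
qed

text \<open>The logarithm is not uniformly continuous near 0, so small values of the density are
  split off first: the event \<open>log_RN \<omega> \<le> - k\<close> has small probability, and off
  it Markov's inequality applies to the \<open>L1\<close> distance.\<close>

lemma log_Z_tendsto_in_prob: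
  assumes e: "\<And>n. 0 < \<epsilon> n" "\<epsilon> \<longlonglongrightarrow> 0" and d: "0 < \<delta>"
  shows "(\<lambda>n. measure P {\<omega> \<in> space P. \<delta> < \<bar>log_RN \<omega> - log_Z (\<epsilon> n) \<omega>\<bar>}) \<longlonglongrightarrow> 0"
proof (rule order_tendstoI)
  fix a :: real assume "a < 0"
  then show "\<forall>\<^sub>F n in sequentially. a < measure P {\<omega> \<in> space P. \<delta> < \<bar>log_RN \<omega> - log_Z (\<epsilon> n) \<omega>\<bar>}"
    by (intro always_eventually allI) (rule less_le_trans[OF _ measure_nonneg])
next
  fix a :: real assume a: "0 < a"
  let ?B = "\<lambda>k::nat. {\<omega> \<in> space P. log_RN \<omega> \<le> - real k}"
  have "?B k \<in> sets P" for k by measurable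
  then have "(\<lambda>k. measure P (?B k)) \<longlonglongrightarrow> measure P (\<Inter>k. ?B k)"
    by (intro mu.finite_Lim_measure_decseq) (auto simp: decseq_def)
  also have "(\<Inter>k. ?B k) = {}"
  proof -
    have "\<exists>k::nat. - log_RN \<omega> < real k" for \<omega> by (rule reals_Archimedean2)
    then have "\<exists>k::nat. \<not> log_RN \<omega> \<le> - real k" for \<omega> by (metis minus_less_iff not_le)
    then show ?thesis by auto
  qed
  finally have "(\<lambda>k. measure P (?B k)) \<longlonglongrightarrow> 0" by simp
  from order_tendstoD(2)[OF this, of "a / 2"] a obtain k where k: "measure P (?B k) < a / 2"
    by (auto simp: eventually_sequentially)
  \<comment> \<open>Off \<open>?B k\<close> the density exceeds \<open>exp (- k)\<close>, and a gap
    \<delta> of the logarithms moves the ratio by at least \<open>1 - exp (- \<delta>)\<close> away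
    from 1; \<open>c\<close> is the resulting gap of the densities.\<close>
  define c where "c = exp (- real k) * (1 - exp (- \<delta>))"
  have c: "0 < c" using d by (simp add: c_def)
  let ?E = "\<lambda>n. \<integral>\<omega>. \<bar>exp (log_Z (\<epsilon> n) \<omega>) - exp (log_RN \<omega>)\<bar> \<partial>P"
  have bound: "measure P {\<omega> \<in> space P. \<delta> < \<bar>log_RN \<omega> - log_Z (\<epsilon> n) \<omega>\<bar>} \<le> measure P (?B k) + ?E n / c" for n
  proof -
    let ?T = "{\<omega> \<in> space P. \<delta> < \<bar>log_RN \<omega> - log_Z (\<epsilon> n) \<omega>\<bar>}"
    have i: "integrable P (\<lambda>\<omega>. \<bar>exp (log_Z (\<epsilon> n) \<omega>) - exp (log_RN \<omega>)\<bar> / c)"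
      using exp_log_RN(1) exp_log_Z(1)[OF e(1)] by auto
    have Bm: "?B k \<in> sets P" and Tm: "?T \<in> sets P" by measurable
    have ind: "integrable P (indicator S :: _ \<Rightarrow> real)" if "S \<in> sets P" for S
      using that by (intro integrable_real_indicator) (auto simp: mu.emeasure_eq_measure)
    have "measure P ?T = (\<integral>\<omega>. indicator ?T \<omega> \<partial>P)" by (auto intro!: arg_cong[where f="measure P"])
    also have "\<dots> \<le> (\<integral>\<omega>. indicator (?B k) \<omega> + \<bar>exp (log_Z (\<epsilon> n) \<omega>) - exp (log_RN \<omega>)\<bar> / c \<partial>P)"
    proof (rule integral_mono)
      fix \<omega> assume om: "\<omega> \<in> space P"
      have "c \<le> \<bar>exp (log_Z (\<epsilon> n) \<omega>) - exp (log_RN \<omega>)\<bar>" if "\<omega> \<in> ?T" "\<omega> \<notin> ?B k"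
      proof -
        let ?v = "log_Z (\<epsilon> n) \<omega> - log_RN \<omega>"
        have "exp (- \<bar>?v\<bar>) \<le> exp (- \<delta>)" using that by auto
        then have "1 - exp (- \<delta>) \<le> \<bar>exp ?v - 1\<bar>" using abs_exp_minus_one_ge[of ?v] by linarith
        moreover have "exp (- real k) \<le> exp (log_RN \<omega>)" using that om by auto
        ultimately have "c \<le> exp (log_RN \<omega>) * \<bar>exp ?v - 1\<bar>" unfolding c_def using d by (intro mult_mono) auto
        also have "\<dots> = \<bar>exp (log_RN \<omega>) * (exp ?v - 1)\<bar>" by (simp add: abs_mult)
        also have "exp (log_RN \<omega>) * (exp ?v - 1) = exp (log_Z (\<epsilon> n) \<omega>) - exp (log_RN \<omega>)"
          by (simp add: right_diff_distrib exp_add[symmetric])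
        finally show ?thesis .
      qed
      then show "indicator ?T \<omega> \<le> indicator (?B k) \<omega> + \<bar>exp (log_Z (\<epsilon> n) \<omega>) - exp (log_RN \<omega>)\<bar> / c"
        using c by (cases "\<omega> \<in> ?T"; cases "\<omega> \<in> ?B k") (simp_all add: le_divide_eq)
    qed (intro ind[OF Tm] Bochner_Integration.integrable_add[OF ind[OF Bm] i])+
    also have "\<dots> = measure P (?B k) + ?E n / c"
      unfolding Bochner_Integration.integral_add[OF ind[OF Bm] i] using Bm by (auto intro!: arg_cong[where f="measure P"])
    finally show ?thesis .
  qed
  have "(\<lambda>n. ?E n / c) \<longlonglongrightarrow> 0 / c" by (intro tendsto_divide tendsto_const L1_tendsto e) (use c in auto)
  then have "\<forall>\<^sub>F n in sequentially. ?E n / c < a / 2" using a by (intro order_tendstoD(2)) auto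
  then show "\<forall>\<^sub>F n in sequentially. measure P {\<omega> \<in> space P. \<delta> < \<bar>log_RN \<omega> - log_Z (\<epsilon> n) \<omega>\<bar>} < a"
  proof eventually_elim
    case (elim n)
    then show ?case using bound[of n] k by linarith
  qed
qed

lemma cnt_integral_tendsto_in_prob:
  assumes d: "0 < \<delta>"
  shows "((\<lambda>\<epsilon>. measure P {\<omega> \<in> space P.
           \<bar>log_RN \<omega> - (cnt_integral \<omega> (\<lambda>x. indicator {y. \<bar>ln (\<phi> y)\<bar> > \<epsilon>} x * ln (\<phi> x))
                   - (LINT x|\<rho>. indicator {y. \<bar>ln (\<phi> y)\<bar> > \<epsilon>} x * (\<phi> x - 1)))\<bar> > \<delta>}) \<longlongrightarrow> 0) (at_right 0)"
proof (rule tendsto_at_right_sequentially[of 0 1])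
  \<comment> \<open>With \<open>\<epsilon> < 1\<close> the discarded points satisfy
    \<open>\<bar>ln \<phi>\<bar> > 1 / \<epsilon> > 1\<close>, where both
    \<open>\<bar>\<phi> - 1\<bar>\<close> and the constant 1 are dominated by multiples of
    \<open>(sqrt \<phi> - 1)^2\<close>. So their intensity and their share \<open>c\<close> of the
    compensator tend to 0.\<close>
  fix \<epsilon> :: "nat \<Rightarrow> real" assume e0: "\<And>n. 0 < \<epsilon> n" and e1: "\<And>n. \<epsilon> n < 1" and lim: "\<epsilon> \<longlonglongrightarrow> 0"
  let ?q = "\<lambda>x. (sqrt (\<phi> x) - 1)\<^sup>2"
  define big where "big n = {x. \<epsilon> n < \<bar>ln (\<phi> x)\<bar> \<and> 1 / \<epsilon> n < \<bar>ln (\<phi> x)\<bar>}" for n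
  have big_sets[measurable]: "big n \<in> sets M" for n
  proof -
    have "{x \<in> space M. \<epsilon> n < \<bar>ln (\<phi> x)\<bar> \<and> 1 / \<epsilon> n < \<bar>ln (\<phi> x)\<bar>} \<in> sets M" by measurable
    then show ?thesis by (simp add: big_def mu.space_M)
  qed
  have big1: "1 < \<bar>ln (\<phi> x)\<bar>" if "x \<in> big n" for x n
  proof -
    have "1 < 1 / \<epsilon> n" using e0[of n] e1[of n] by simp
    then show ?thesis using that by (auto simp: big_def)
  qed
  have ev: "\<forall>\<^sub>F n in sequentially. x \<notin> big n" for x
    using trunc_eventually[OF e0 lim, of x]
  proof eventually_elim
    case (elim n)
    show ?case
    proof
      assume x: "x \<in> big n"
      then have "trunc (\<epsilon> n) x = 0" by (simp add: trunc_def big_def)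
      then show False using elim big1[OF x] by simp
    qed
  qed
  have ev0: "\<forall>\<^sub>F n in sequentially. indicator (big n) x = (0::real)" for x
    using ev[of x] by eventually_elim simp
  have bigfin: "emeasure \<rho> (big n) < \<infinity>" for n
  proof -
    have "big n \<subseteq> level (\<epsilon> n)" by (auto simp: big_def level_def)
    from emeasure_mono[OF this, of \<rho>] show ?thesis using level_finite[OF e0[of n]] by (auto intro: le_less_trans)
  qed
  have q: "\<bar>\<phi> x - 1\<bar> \<le> 7 * ?q x" "1 \<le> 16 * ?q x" if "1 < \<bar>ln (\<phi> x)\<bar>" for x
  proof -
    show "\<bar>\<phi> x - 1\<bar> \<le> 7 * ?q x" using exp_minus_1_big[OF that] phi_pos[of x] by (simp add: sqrt_phi)
    have "1 \<le> (ln (\<phi> x))\<^sup>2" using that by (metis less_imp_le one_le_power power2_abs)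
    then show "1 \<le> 16 * ?q x" using sq_exp_half_lower(2)[of "ln (\<phi> x)"] by (simp add: sqrt_phi)
  qed
  have iq: "integrable \<rho> (\<lambda>x. c * ?q x)" for c using integrable_L2 by simp
  have "(\<lambda>n. \<integral>x. indicator (big n) x \<partial>\<rho>) \<longlonglongrightarrow> (\<integral>x. 0 \<partial>\<rho> :: real)"
  proof (rule integral_dominated_convergence[OF _ _ iq[of 16]])
    show "AE x in \<rho>. (\<lambda>n. indicator (big n) x :: real) \<longlonglongrightarrow> 0"
      by (rule AE_I2, rule tendsto_eventually, rule ev0)
    show "AE x in \<rho>. norm (indicator (big n) x :: real) \<le> 16 * ?q x" for n
      using big1 q(2) by (auto split: split_indicator)
  qed auto
  then have mb: "(\<lambda>n. measure \<rho> (big n)) \<longlonglongrightarrow> 0" by simp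
  define c where "c n = (\<integral>x. indicator (big n) x * (\<phi> x - 1) \<partial>\<rho>)" for n
  have "c \<longlonglongrightarrow> (\<integral>x. 0 \<partial>\<rho> :: real)"
    unfolding c_def
  proof (rule integral_dominated_convergence[OF _ _ iq[of 7]])
    show "AE x in \<rho>. (\<lambda>n. indicator (big n) x * (\<phi> x - 1)) \<longlonglongrightarrow> 0"
    proof (rule AE_I2, rule tendsto_eventually)
      fix x show "\<forall>\<^sub>F n in sequentially. indicator (big n) x * (\<phi> x - 1) = 0"
        using ev0[of x] by eventually_elim simp
    qed
    show "AE x in \<rho>. norm (indicator (big n) x * (\<phi> x - 1)) \<le> 7 * ?q x" for n
      using big1 q(1) by (auto split: split_indicator)
  qed auto
  then have clim: "c \<longlonglongrightarrow> 0" by simp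
  have ci: "(LINT x|\<rho>. indicator {y. \<bar>ln (\<phi> y)\<bar> > \<epsilon> n} x * (\<phi> x - 1)) = (\<integral>x. exp (trunc (\<epsilon> n) x) - 1 \<partial>\<rho>) + c n" for n
  proof -
    have i1: "integrable \<rho> (\<lambda>x. indicator (big n) x * (\<phi> x - 1))"
      by (rule Bochner_Integration.integrable_bound[OF iq[of 7]]) (use big1 q(1) in \<open>auto split: split_indicator intro: order_trans\<close>)
    have "(LINT x|\<rho>. indicator {y. \<bar>ln (\<phi> y)\<bar> > \<epsilon> n} x * (\<phi> x - 1)) = (\<integral>x. (exp (trunc (\<epsilon> n) x) - 1) + indicator (big n) x * (\<phi> x - 1) \<partial>\<rho>)"
      by (rule Bochner_Integration.integral_cong) (auto simp: trunc_def big_def phi_pos split: split_indicator)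
    also have "\<dots> = (\<integral>x. exp (trunc (\<epsilon> n) x) - 1 \<partial>\<rho>) + c n"
      unfolding c_def by (rule Bochner_Integration.integral_add[OF mu.bdd_fsupp_integrable[OF mu.bdd_fsupp_exp_minus_1[OF bdd_fsupp_trunc[OF e0]]] i1])
    finally show ?thesis .
  qed
  \<comment> \<open>With no point in \<open>big n\<close> the integrands agree almost everywhere for
    \<open>cmeas \<omega>\<close>, so the integrals agree whether or not they converge.\<close>
  have cnt: "cnt_integral \<omega> (\<lambda>x. indicator {y. \<bar>ln (\<phi> y)\<bar> > \<epsilon> n} x * ln (\<phi> x)) = integral\<^sup>L (cmeas \<omega>) (trunc (\<epsilon> n))"
    if "cnt \<omega> (big n) = 0" for \<omega> n
    unfolding cnt_integral_eq_cmeas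
  proof (rule integral_cong_AE)
    have "big n \<in> null_sets (cmeas \<omega>)" using that by (simp add: null_sets_def emeasure_cmeas)
    then show "AE x in cmeas \<omega>. indicator {y. \<bar>ln (\<phi> y)\<bar> > \<epsilon> n} x * ln (\<phi> x) = trunc (\<epsilon> n) x"
      by (rule AE_not_in[THEN AE_mp]) (auto intro!: AE_I2 simp: trunc_def big_def split: split_indicator)
  qed auto
  have pb: "(\<lambda>n. measure P {\<omega> \<in> space P. cnt \<omega> (big n) \<noteq> 0}) \<longlonglongrightarrow> 0"
  proof -
    have "measure P {\<omega> \<in> space P. cnt \<omega> (big n) \<noteq> 0} = 1 - exp (- measure \<rho> (big n))" for n
    proof -
      have "emeasure P {\<omega> \<in> space P. cnt \<omega> (big n) = 0} = ennreal (exp (- measure \<rho> (big n)))"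
        using mu.emeasure_cnt_eq[OF big_sets bigfin, of n 0] by (simp add: poisson_prob_def)
      then have "measure P {\<omega> \<in> space P. cnt \<omega> (big n) = 0} = exp (- measure \<rho> (big n))" by (simp add: measure_def)
      moreover have "{\<omega> \<in> space P. cnt \<omega> (big n) \<noteq> 0} = space P - {\<omega> \<in> space P. cnt \<omega> (big n) = 0}" by auto
      moreover have "{\<omega> \<in> space P. cnt \<omega> (big n) = 0} \<in> sets P" by measurable
      ultimately show ?thesis using mu.prob_compl by simp
    qed
    moreover have "(\<lambda>n. 1 - exp (- measure \<rho> (big n))) \<longlonglongrightarrow> 1 - exp (- 0)" by (intro tendsto_intros mb)
    ultimately show ?thesis by simp
  qed
  let ?T = "\<lambda>n. {\<omega> \<in> space P.
           \<bar>log_RN \<omega> - (cnt_integral \<omega> (\<lambda>x. indicator {y. \<bar>ln (\<phi> y)\<bar> > \<epsilon> n} x * ln (\<phi> x))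
                   - (LINT x|\<rho>. indicator {y. \<bar>ln (\<phi> y)\<bar> > \<epsilon> n} x * (\<phi> x - 1)))\<bar> > \<delta>}"
  let ?A = "\<lambda>n. {\<omega> \<in> space P. \<delta> / 2 < \<bar>log_RN \<omega> - log_Z (\<epsilon> n) \<omega>\<bar>}" and ?B = "\<lambda>n. {\<omega> \<in> space P. cnt \<omega> (big n) \<noteq> 0}"
  show "(\<lambda>n. measure P (?T n)) \<longlonglongrightarrow> 0"
  proof (rule tendsto_sandwich)
    show "\<forall>\<^sub>F n in sequentially. 0 \<le> measure P (?T n)" by simp
    have "\<forall>\<^sub>F n in sequentially. \<bar>c n\<bar> < \<delta> / 2" using tendsto_rabs[OF clim] d by (intro order_tendstoD(2)) auto
    then show "\<forall>\<^sub>F n in sequentially. measure P (?T n) \<le> measure P (?A n) + measure P (?B n)"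
    proof eventually_elim
      case (elim n)
      have "?T n \<subseteq> ?A n \<union> ?B n"
      proof
        fix \<omega> assume T: "\<omega> \<in> ?T n"
        show "\<omega> \<in> ?A n \<union> ?B n"
        proof (cases "cnt \<omega> (big n) = 0")
          case True
          have "\<bar>log_RN \<omega> - (log_Z (\<epsilon> n) \<omega> - c n)\<bar> > \<delta>"
            using T by (simp add: cnt[OF True] ci log_Z_def diff_diff_eq)
          then have "\<delta> / 2 < \<bar>log_RN \<omega> - log_Z (\<epsilon> n) \<omega>\<bar>" using elim by linarith
          then show ?thesis using T by simp
        next
          case False
          then show ?thesis using T by simp
        qed
      qed
      moreover have AB: "?A n \<in> sets P" "?B n \<in> sets P" by measurable
      ultimately have "measure P (?T n) \<le> measure P (?A n \<union> ?B n)" by (intro mu.finite_measure_mono) auto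
      also have "\<dots> \<le> measure P (?A n) + measure P (?B n)" by (rule measure_Un_le[OF AB])
      finally show ?case .
    qed
    have "(\<lambda>n. measure P (?A n) + measure P (?B n)) \<longlonglongrightarrow> 0 + 0"
      by (intro tendsto_add pb log_Z_tendsto_in_prob e0 lim) (use d in simp)
    then show "(\<lambda>n. measure P (?A n) + measure P (?B n)) \<longlonglongrightarrow> 0" by simp
  qed simp
qed simp

section \<open>The Levy-Khintchine form\<close>

lemma compensated_integrable: "integrable \<rho> (\<lambda>x. ln (\<phi> x) * indicator {-1..1} (ln (\<phi> x)) - (\<phi> x - 1))"
proof (rule Bochner_Integration.integrable_bound)
  show "integrable \<rho> (\<lambda>x. 7 * (sqrt (\<phi> x) - 1)\<^sup>2)" using integrable_L2 by simp
  show "AE x in \<rho>. norm (ln (\<phi> x) * indicator {-1..1} (ln (\<phi> x)) - (\<phi> x - 1)) \<le> norm (7 * (sqrt (\<phi> x) - 1)\<^sup>2)"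
  proof (rule AE_I2)
    fix x
    let ?u = "ln (\<phi> x)"
    show "norm (?u * indicator {-1..1} ?u - (\<phi> x - 1)) \<le> norm (7 * (sqrt (\<phi> x) - 1)\<^sup>2)"
    proof (cases "\<bar>?u\<bar> \<le> 1")
      case True
      have "exp ?u - 1 - ?u \<le> 5 * (exp (?u / 2) - 1)\<^sup>2" by (rule exp_minus_1_minus_small[OF True])
      moreover have "0 \<le> exp ?u - 1 - ?u" using exp_ge_add_one_self[of ?u] by linarith
      moreover have "0 \<le> (exp (?u / 2) - 1)\<^sup>2" by simp
      ultimately have "\<bar>?u - (exp ?u - 1)\<bar> \<le> 7 * (exp (?u / 2) - 1)\<^sup>2" by linarith
      then show ?thesis using True phi_pos[of x] by (simp add: sqrt_phi abs_le_iff)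
    next
      case False
      then have "\<bar>exp ?u - 1\<bar> \<le> 7 * (exp (?u / 2) - 1)\<^sup>2" by (intro exp_minus_1_big) simp
      moreover have "indicator {-1..1} ?u = (0::real)" using False by (auto simp: indicator_def)
      ultimately show ?thesis using phi_pos[of x] by (simp add: sqrt_phi)
    qed
  qed
qed measurable

text \<open>The exponential formula at an imaginary exponent. The compensator is moved under the
  same integral because in the limit the two integrals need not exist separately.\<close>

lemma integral_iexp_log_Z:
  assumes "0 < \<epsilon>"
  shows "(\<integral>\<omega>. iexp (a * log_Z \<epsilon> \<omega>) \<partial>P) = exp (\<integral>x. iexp (a * trunc \<epsilon> x) - 1 - \<i> * complex_of_real (a * (exp (trunc \<epsilon> x) - 1)) \<partial>\<rho>)"
proof -
  let ?h = "\<lambda>x. \<i> * complex_of_real (a * trunc \<epsilon> x)"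
  let ?K = "\<integral>x. exp (trunc \<epsilon> x) - 1 \<partial>\<rho>"
  note b = bdd_fsupp_trunc[OF assms]
  have bh: "mu.bdd_fsupp ?h"
    by (rule mu.bdd_fsupp_dominated[OF b, where G="\<lambda>t. \<bar>a\<bar> * t"]) (auto simp: norm_mult abs_mult intro!: mono_onI mult_left_mono)
  note i1 = mu.bdd_fsupp_integrable[OF mu.bdd_fsupp_exp_minus_1[OF bh]] and i2 = mu.bdd_fsupp_integrable[OF mu.bdd_fsupp_exp_minus_1[OF b]]
  have "iexp (a * log_Z \<epsilon> \<omega>) = exp (integral\<^sup>L (cmeas \<omega>) ?h) * exp (- \<i> * complex_of_real (a * ?K))" for \<omega>
  proof -
    have "integral\<^sup>L (cmeas \<omega>) ?h = \<i> * complex_of_real (a * integral\<^sup>L (cmeas \<omega>) (trunc \<epsilon>))"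
      by (simp del: of_real_mult add: integral_complex_of_real)
    then show ?thesis by (simp add: log_Z_def exp_add[symmetric] algebra_simps)
  qed
  then have "(\<integral>\<omega>. iexp (a * log_Z \<epsilon> \<omega>) \<partial>P) = (\<integral>\<omega>. exp (integral\<^sup>L (cmeas \<omega>) ?h) \<partial>P) * exp (- \<i> * complex_of_real (a * ?K))"
    by (simp only: integral_mult_left_zero)
  also have "\<dots> = exp ((\<integral>x. exp (?h x) - 1 \<partial>\<rho>) - \<i> * complex_of_real (a * ?K))"
    unfolding mu.bdd_fsupp_exp[OF bh] by (simp add: exp_add[symmetric])
  also have "\<i> * complex_of_real (a * ?K) = (\<integral>x. \<i> * complex_of_real (a * (exp (trunc \<epsilon> x) - 1)) \<partial>\<rho>)"
    by (simp del: of_real_mult of_real_diff add: integral_complex_of_real)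
  also have "(\<integral>x. exp (?h x) - 1 \<partial>\<rho>) - (\<integral>x. \<i> * complex_of_real (a * (exp (trunc \<epsilon> x) - 1)) \<partial>\<rho>)
      = (\<integral>x. iexp (a * trunc \<epsilon> x) - 1 - \<i> * complex_of_real (a * (exp (trunc \<epsilon> x) - 1)) \<partial>\<rho>)"
    by (rule Bochner_Integration.integral_diff[symmetric, OF i1]) (intro integrable_mult_right integrable_of_real i2)
  finally show ?thesis .
qed

lemma inf_div_log_RN:
  "inf_div_with_levy (distr P borel log_RN) (density (distr \<rho> borel (\<lambda>x. ln (\<phi> x))) (indicator (UNIV - {0})))"
proof -
  let ?s = "density (distr \<rho> borel (\<lambda>x. ln (\<phi> x))) (indicator (UNIV - {0}))"
  let ?u = "\<lambda>x. ln (\<phi> x)"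
  have um[measurable]: "?u \<in> borel_measurable \<rho>" by measurable
  have nn: "(\<integral>\<^sup>+ x. f x \<partial>?s) = (\<integral>\<^sup>+ x. indicator (UNIV - {0}) (?u x) * f (?u x) \<partial>\<rho>)" if [measurable]: "f \<in> borel_measurable borel" for f
  proof -
    have "(\<integral>\<^sup>+ x. f x \<partial>?s) = (\<integral>\<^sup>+ x. indicator (UNIV - {0}) x * f x \<partial>distr \<rho> borel ?u)"
      by (rule nn_integral_density) auto
    also have "\<dots> = (\<integral>\<^sup>+ x. indicator (UNIV - {0}) (?u x) * f (?u x) \<partial>\<rho>)"
      by (rule nn_integral_distr) auto
    finally show ?thesis .
  qed
  have levy: "levy_measure ?s"
    unfolding levy_measure_def
  proof (intro conjI)
    show "sets ?s = sets borel" by simp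
    show "emeasure ?s {0} = 0" 
    proof -
      have "emeasure ?s {0} = (\<integral>\<^sup>+ x. indicator (UNIV - {0}) x * indicator {0} x \<partial>distr \<rho> borel ?u)"
        by (rule emeasure_density) auto
      also have "\<dots> = (\<integral>\<^sup>+ x. 0 \<partial>distr \<rho> borel ?u)" by (rule nn_integral_cong) (auto split: split_indicator)
      finally show ?thesis by simp
    qed
    have "(\<integral>\<^sup>+ x. ennreal (min (x\<^sup>2) 1) \<partial>?s) = (\<integral>\<^sup>+ x. indicator (UNIV - {0}) (?u x) * ennreal (min ((?u x)\<^sup>2) 1) \<partial>\<rho>)"
      by (rule nn) measurable
    also have "\<dots> \<le> (\<integral>\<^sup>+ x. ennreal (16 * (sqrt (\<phi> x) - 1)\<^sup>2) \<partial>\<rho>)"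
      using sq_exp_half_lower(2) by (intro nn_integral_mono) (auto simp: sqrt_phi split: split_indicator intro!: ennreal_leI)
    also have "\<dots> = 16 * (\<integral>\<^sup>+ x. ennreal ((sqrt (\<phi> x) - 1)\<^sup>2) \<partial>\<rho>)"
      by (simp add: ennreal_mult nn_integral_cmult)
    also have "\<dots> < \<infinity>" using L2 by (simp add: ennreal_mult_less_top)
    finally show "(\<integral>\<^sup>+ x. ennreal (min (x\<^sup>2) 1) \<partial>?s) < \<infinity>" .
  qed
  \<comment> \<open>The drift: the density is compensated by \<open>\<phi> - 1\<close>, the
    Levy-Khintchine form by \<open>ln \<phi>\<close> where
    \<open>\<bar>ln \<phi>\<bar> \<le> 1\<close>, and \<open>d\<close> integrates the difference.
    The Gaussian part is 0.\<close>
  define d where "d = (\<integral>x. ?u x * indicator {-1..1} (?u x) - (\<phi> x - 1) \<partial>\<rho>)"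
  have "char (distr P borel log_RN) a = exp (- complex_of_real (a\<^sup>2 * 0\<^sup>2 / 2) + \<i> * complex_of_real (a * d)
          + (CLINT x|?s. iexp (a * x) - 1 - \<i> * complex_of_real (a * x * indicator {-1..1} x)))" for a :: real
  proof -
    let ?f = "\<lambda>x. iexp (a * x) - 1 - \<i> * complex_of_real (a * x * indicator {-1..1} x)"
    let ?k = "\<lambda>x. iexp (a * ?u x) - 1 - \<i> * complex_of_real (a * (\<phi> x - 1))"
    let ?kt = "\<lambda>\<epsilon> x. iexp (a * trunc \<epsilon> x) - 1 - \<i> * complex_of_real (a * (exp (trunc \<epsilon> x) - 1))"
    have fm[measurable]: "?f \<in> borel_measurable borel" by measurable
    have if_: "integrable \<rho> (\<lambda>x. ?f (?u x))"
    proof (rule Bochner_Integration.integrable_bound)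
      show "integrable \<rho> (\<lambda>x. (8 * a\<^sup>2 + 32) * (sqrt (\<phi> x) - 1)\<^sup>2)" using integrable_L2 by simp
      show "(\<lambda>x. ?f (?u x)) \<in> borel_measurable \<rho>" by measurable
      show "AE x in \<rho>. norm (?f (?u x)) \<le> norm ((8 * a\<^sup>2 + 32) * (sqrt (\<phi> x) - 1)\<^sup>2)"
      proof (rule AE_I2)
        fix x
        have "norm (?f (?u x)) \<le> (8 * a\<^sup>2 + 32) * (sqrt (\<phi> x) - 1)\<^sup>2"
          unfolding sqrt_phi by (rule norm_iexp_compensated_le)
        also have "\<dots> \<le> norm ((8 * a\<^sup>2 + 32) * (sqrt (\<phi> x) - 1)\<^sup>2)" by simp
        finally show "norm (?f (?u x)) \<le> norm ((8 * a\<^sup>2 + 32) * (sqrt (\<phi> x) - 1)\<^sup>2)" .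
      qed
    qed
    have ig: "integrable \<rho> (\<lambda>x. \<i> * complex_of_real (a * (?u x * indicator {-1..1} (?u x) - (\<phi> x - 1))))"
      using compensated_integrable by (intro integrable_mult_right integrable_of_real) auto
    have keq: "?k x = ?f (?u x) + \<i> * complex_of_real (a * (?u x * indicator {-1..1} (?u x) - (\<phi> x - 1)))" for x
      by (simp add: algebra_simps)
    have ik: "integrable \<rho> ?k" unfolding keq by (rule Bochner_Integration.integrable_add[OF if_ ig])
    obtain \<epsilon> :: "nat \<Rightarrow> real" where e: "\<And>n. 0 < \<epsilon> n" "\<epsilon> \<longlonglongrightarrow> 0" "AE \<omega> in P. (\<lambda>n. log_Z (\<epsilon> n) \<omega>) \<longlonglongrightarrow> log_RN \<omega>"
      by (rule AE_approximation) blast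
    have c1: "(\<lambda>n. \<integral>\<omega>. iexp (a * log_Z (\<epsilon> n) \<omega>) \<partial>P) \<longlonglongrightarrow> (\<integral>\<omega>. iexp (a * log_RN \<omega>) \<partial>P)"
    proof (rule integral_dominated_convergence[where w="\<lambda>_. 1"])
      show "AE \<omega> in P. (\<lambda>n. iexp (a * log_Z (\<epsilon> n) \<omega>)) \<longlonglongrightarrow> iexp (a * log_RN \<omega>)"
        using e(3) by eventually_elim (intro tendsto_intros)
    qed auto
    \<comment> \<open>At each point the truncated integrand is either 0 or \<open>?k x\<close>, so
      the norm of \<open>?k\<close> is a dominating function.\<close>
    have c2: "(\<lambda>n. \<integral>\<omega>. iexp (a * log_Z (\<epsilon> n) \<omega>) \<partial>P) \<longlonglongrightarrow> exp (\<integral>x. ?k x \<partial>\<rho>)"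
      unfolding integral_iexp_log_Z[OF e(1)]
    proof (rule tendsto_exp, rule integral_dominated_convergence[where w="\<lambda>x. norm (?k x)"])
      show "integrable \<rho> (\<lambda>x. norm (?k x))" using ik by (rule integrable_norm)
      show "AE x in \<rho>. (\<lambda>n. ?kt (\<epsilon> n) x) \<longlonglongrightarrow> ?k x"
      proof (rule AE_I2, rule tendsto_eventually)
        fix x show "\<forall>\<^sub>F n in sequentially. ?kt (\<epsilon> n) x = ?k x"
          using trunc_eventually[OF e(1,2), of x] by eventually_elim (simp add: phi_pos)
      qed
      show "AE x in \<rho>. norm (?kt (\<epsilon> n) x) \<le> norm (?k x)" for n
        using phi_pos by (intro AE_I2) (auto simp: trunc_def)
    qed measurable
    have "char (distr P borel log_RN) a = (\<integral>\<omega>. iexp (a * log_RN \<omega>) \<partial>P)"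
      unfolding char_def by (subst integral_distr) auto
    also have "\<dots> = exp (\<integral>x. ?k x \<partial>\<rho>)" by (rule LIMSEQ_unique[OF c1 c2])
    also have "(\<integral>x. ?k x \<partial>\<rho>) = (\<integral>x. ?f (?u x) \<partial>\<rho>) + (\<integral>x. \<i> * complex_of_real (a * (?u x * indicator {-1..1} (?u x) - (\<phi> x - 1))) \<partial>\<rho>)"
      unfolding keq by (rule Bochner_Integration.integral_add[OF if_ ig])
    also have "(\<integral>x. \<i> * complex_of_real (a * (?u x * indicator {-1..1} (?u x) - (\<phi> x - 1))) \<partial>\<rho>) = \<i> * complex_of_real (a * d)"
      unfolding d_def by (simp del: of_real_mult of_real_diff add: integral_complex_of_real)
    \<comment> \<open>The mass deleted at 0, possibly infinite, is invisible because the integrand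
      vanishes there.\<close>
    also have "(\<integral>x. ?f (?u x) \<partial>\<rho>) = (CLINT x|?s. ?f x)"
    proof -
      have "(CLINT x|?s. ?f x) = (CLINT x|density (distr \<rho> borel ?u) (\<lambda>x. ennreal (indicator (UNIV - {0}) x)). ?f x)"
        by (simp add: ennreal_indicator)
      also have "\<dots> = (CLINT x|distr \<rho> borel ?u. indicator (UNIV - {0}) x *\<^sub>R ?f x)"
        by (rule integral_density) (use fm in \<open>auto simp del: of_real_mult\<close>)
      also have "\<dots> = (CLINT x|distr \<rho> borel ?u. ?f x)"
        by (rule Bochner_Integration.integral_cong) (auto split: split_indicator)
      also have "\<dots> = (CLINT x|\<rho>. ?f (?u x))"
        by (rule integral_distr) auto
      finally show ?thesis by simp
    qed
    finally show ?thesis by (simp add: add.commute)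
  qed
  with levy show ?thesis unfolding inf_div_with_levy_def by (intro conjI exI[of _ d] exI[of _ 0] allI) auto
qed

section \<open>The expectation\<close>

lemma integral_exp_minus_log_Z_Q:
  assumes e: "0 < \<epsilon>"
  shows "integrable Q (\<lambda>\<omega>. exp (- log_Z \<epsilon> \<omega>))" "(\<integral>\<omega>. exp (- log_Z \<epsilon> \<omega>) \<partial>Q) = 1"
proof -
  let ?K = "\<integral>x. exp (trunc \<epsilon> x) - 1 \<partial>\<rho>"
  note b = nu.bdd_fsupp_uminus[OF bdd_fsupp_nu[OF bdd_fsupp_trunc[OF e]]]
  have eq: "exp (- log_Z \<epsilon> \<omega>) = exp (integral\<^sup>L (cmeas \<omega>) (\<lambda>x. - trunc \<epsilon> x)) * exp ?K" for \<omega>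
    by (simp add: log_Z_def exp_add[symmetric])
  show "integrable Q (\<lambda>\<omega>. exp (- log_Z \<epsilon> \<omega>))" unfolding eq using nu.bdd_fsupp_exp_real(2)[OF b] by simp
  have "(\<integral>\<omega>. exp (- log_Z \<epsilon> \<omega>) \<partial>Q) = exp (\<integral>x. exp (- trunc \<epsilon> x) - 1 \<partial>density \<rho> (\<lambda>x. ennreal (\<phi> x))) * exp ?K"
    unfolding eq integral_mult_left_zero nu.bdd_fsupp_exp_real(1)[OF b] ..
  also have "(\<integral>x. exp (- trunc \<epsilon> x) - 1 \<partial>density \<rho> (\<lambda>x. ennreal (\<phi> x))) = (\<integral>x. \<phi> x * (exp (- trunc \<epsilon> x) - 1) \<partial>\<rho>)"
    using phi_pos by (subst integral_density) (auto simp: less_imp_le)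
  \<comment> \<open>Where the truncation equals \<open>ln \<phi>\<close>, this is
    \<open>\<phi> * (1 / \<phi> - 1) = - (\<phi> - 1)\<close>; elsewhere both integrands are 0. Thus
    the exponent cancels against \<open>?K\<close>.\<close>
  also have "\<dots> = (\<integral>x. - (exp (trunc \<epsilon> x) - 1) \<partial>\<rho>)"
    by (rule Bochner_Integration.integral_cong) (auto simp: trunc_def phi_pos exp_minus right_diff_distrib less_imp_neq[OF phi_pos, symmetric])
  also have "\<dots> = - ?K" by (rule Bochner_Integration.integral_minus)
  finally show "(\<integral>\<omega>. exp (- log_Z \<epsilon> \<omega>) \<partial>Q) = 1" by (simp add: exp_add[symmetric])
qed

lemma exp_minus_self_nonneg: "0 \<le> exp t - 1 - t" for t :: real
  using exp_ge_add_one_self[of t] by linarith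

text \<open>Since \<open>exp (log_Z \<epsilon> \<omega>)\<close> has mean 1, the left side is minus
  the mean of \<open>log_Z \<epsilon>\<close>, which Campbell's formula evaluates; bounded
  truncation on finite intensity keeps every term finite.\<close>

lemma nn_integral_psi_log_Z:
  assumes e: "0 < \<epsilon>"
  shows "(\<integral>\<^sup>+ \<omega>. ennreal (exp (log_Z \<epsilon> \<omega>) - 1 - log_Z \<epsilon> \<omega>) \<partial>P) = (\<integral>\<^sup>+ x. ennreal (exp (trunc \<epsilon> x) - 1 - trunc \<epsilon> x) \<partial>\<rho>)"
proof -
  let ?K = "\<integral>x. exp (trunc \<epsilon> x) - 1 \<partial>\<rho>"
  note b = bdd_fsupp_trunc[OF e]
  note it = mu.bdd_fsupp_integrable[OF b] and ik = mu.bdd_fsupp_integrable[OF mu.bdd_fsupp_exp_minus_1[OF b]]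
  have il: "integrable P (log_Z \<epsilon>)" unfolding log_Z_def using mu.campbell(1)[OF it] by simp
  have El: "(\<integral>\<omega>. log_Z \<epsilon> \<omega> \<partial>P) = (\<integral>x. trunc \<epsilon> x \<partial>\<rho>) - ?K"
    unfolding log_Z_def using mu.campbell[OF it] by (simp add: mu.prob_space del: mu.space_P)
  have "(\<integral>\<^sup>+ \<omega>. ennreal (exp (log_Z \<epsilon> \<omega>) - 1 - log_Z \<epsilon> \<omega>) \<partial>P) = ennreal (\<integral>\<omega>. exp (log_Z \<epsilon> \<omega>) - 1 - log_Z \<epsilon> \<omega> \<partial>P)"
    by (rule nn_integral_eq_integral) (use exp_log_Z(1)[OF e] il exp_minus_self_nonneg in auto)
  also have "(\<integral>\<omega>. exp (log_Z \<epsilon> \<omega>) - 1 - log_Z \<epsilon> \<omega> \<partial>P) = ?K - (\<integral>x. trunc \<epsilon> x \<partial>\<rho>)"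
    using exp_log_Z[OF e] il El by (simp add: mu.prob_space del: mu.space_P)
  also have "\<dots> = (\<integral>x. (exp (trunc \<epsilon> x) - 1) - trunc \<epsilon> x \<partial>\<rho>)"
    by (rule Bochner_Integration.integral_diff[symmetric, OF ik it])
  also have "ennreal \<dots> = (\<integral>\<^sup>+ x. ennreal (exp (trunc \<epsilon> x) - 1 - trunc \<epsilon> x) \<partial>\<rho>)"
    by (rule nn_integral_eq_integral[symmetric]) (use ik it exp_minus_self_nonneg in auto)
  finally show ?thesis .
qed

text \<open>Both sides may be infinite, so the identity is proved as two inequalities in
  \<open>ennreal\<close>. Fatou gives each of them, once over configurations and once over points,
  as no truncated value exceeds \<open>?R\<close> or \<open>?L\<close>.\<close>

lemma nn_integral_psi_log_RN:
  "(\<integral>\<^sup>+ \<omega>. ennreal (exp (log_RN \<omega>) - 1 - log_RN \<omega>) \<partial>P) = (\<integral>\<^sup>+ x. ennreal (\<phi> x - 1 - ln (\<phi> x)) \<partial>\<rho>)"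
    (is "?L = ?R")
proof (rule antisym)
  obtain \<epsilon> :: "nat \<Rightarrow> real" where e: "\<And>n. 0 < \<epsilon> n" "\<epsilon> \<longlonglongrightarrow> 0" "AE \<omega> in P. (\<lambda>n. log_Z (\<epsilon> n) \<omega>) \<longlonglongrightarrow> log_RN \<omega>"
    by (rule AE_approximation) blast
  have le_R: "(\<integral>\<^sup>+ x. ennreal (exp (trunc (\<epsilon> n) x) - 1 - trunc (\<epsilon> n) x) \<partial>\<rho>) \<le> ?R" for n
  proof (rule nn_integral_mono)
    fix x show "ennreal (exp (trunc (\<epsilon> n) x) - 1 - trunc (\<epsilon> n) x) \<le> ennreal (\<phi> x - 1 - ln (\<phi> x))"
      using exp_minus_self_nonneg[of "ln (\<phi> x)"] phi_pos[of x] by (auto simp: trunc_def)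
  qed
  have "?L = (\<integral>\<^sup>+ \<omega>. liminf (\<lambda>n. ennreal (exp (log_Z (\<epsilon> n) \<omega>) - 1 - log_Z (\<epsilon> n) \<omega>)) \<partial>P)"
  proof (rule nn_integral_cong_AE)
    show "AE \<omega> in P. ennreal (exp (log_RN \<omega>) - 1 - log_RN \<omega>) = liminf (\<lambda>n. ennreal (exp (log_Z (\<epsilon> n) \<omega>) - 1 - log_Z (\<epsilon> n) \<omega>))"
      using e(3)
    proof eventually_elim
      case (elim \<omega>)
      have "(\<lambda>n. ennreal (exp (log_Z (\<epsilon> n) \<omega>) - 1 - log_Z (\<epsilon> n) \<omega>)) \<longlonglongrightarrow> ennreal (exp (log_RN \<omega>) - 1 - log_RN \<omega>)"
        by (intro tendsto_intros elim)
      then show ?case by (rule lim_imp_Liminf[OF trivial_limit_sequentially, symmetric])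
    qed
  qed
  also have "\<dots> \<le> liminf (\<lambda>n. \<integral>\<^sup>+ \<omega>. ennreal (exp (log_Z (\<epsilon> n) \<omega>) - 1 - log_Z (\<epsilon> n) \<omega>) \<partial>P)"
    by (rule nn_integral_liminf) measurable
  also have "\<dots> \<le> liminf (\<lambda>n::nat. ?R)"
    unfolding nn_integral_psi_log_Z[OF e(1)] by (intro Liminf_mono always_eventually allI le_R)
  also have "\<dots> = ?R" by (simp add: Liminf_const)
  finally show "?L \<le> ?R" .

  have lower: "(\<integral>\<^sup>+ x. ennreal (exp (trunc (\<epsilon> n) x) - 1 - trunc (\<epsilon> n) x) \<partial>\<rho>) \<le> ?L" for n
  proof -
    let ?Z = "log_Z (\<epsilon> n)"
    have one: "(\<integral>\<^sup>+ \<omega>. ennreal (exp (?Z \<omega>)) \<partial>P) = 1" "(\<integral>\<^sup>+ \<omega>. ennreal (exp (log_RN \<omega>)) \<partial>P) = 1"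
      using nn_integral_eq_integral[OF exp_log_Z(1)[OF e(1)[of n]]] exp_log_Z(2)[OF e(1)[of n]]
        nn_integral_eq_integral[OF exp_log_RN(1)] integral_exp_log_RN by auto
    have oneQ: "(\<integral>\<^sup>+ \<omega>. ennreal (exp (log_RN \<omega>) * exp (- ?Z \<omega>)) \<partial>P) = 1"
    proof -
      have m: "(\<lambda>\<omega>. exp (- ?Z \<omega>)) \<in> borel_measurable P" by measurable
      have "(\<integral>\<^sup>+ \<omega>. ennreal (exp (log_RN \<omega>) * exp (- ?Z \<omega>)) \<partial>P) = (\<integral>\<^sup>+ \<omega>. ennreal (exp (log_RN \<omega>)) * ennreal (exp (- ?Z \<omega>)) \<partial>P)"
        by (simp add: ennreal_mult)
      also have "\<dots> = (\<integral>\<^sup>+ \<omega>. ennreal (exp (- ?Z \<omega>)) \<partial>density P (\<lambda>\<omega>. ennreal (exp (log_RN \<omega>))))"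
        by (rule nn_integral_density[symmetric]) auto
      also have "\<dots> = 1"
        unfolding exp_log_RN(2) using nn_integral_eq_integral[OF integral_exp_minus_log_Z_Q(1)[OF e(1)[of n]]] integral_exp_minus_log_Z_Q(2)[OF e(1)[of n]] by simp
      finally show ?thesis .
    qed
    \<comment> \<open>tangent line inequality for \<open>z - 1 - ln z\<close> at \<open>exp (log_Z \<epsilon> \<omega>)\<close>\<close>
    have pw: "ennreal (exp (?Z \<omega>) - 1 - ?Z \<omega>) + (ennreal (exp (log_RN \<omega>)) + 1) \<le>
        ennreal (exp (log_RN \<omega>) - 1 - log_RN \<omega>) + (ennreal (exp (log_RN \<omega>) * exp (- ?Z \<omega>)) + ennreal (exp (?Z \<omega>)))" for \<omega>
    proof -
      have "1 + (log_RN \<omega> + - ?Z \<omega>) \<le> exp (log_RN \<omega>) * exp (- ?Z \<omega>)"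
        unfolding exp_add[symmetric] by (rule exp_ge_add_one_self)
      then have "(exp (?Z \<omega>) - 1 - ?Z \<omega>) + (exp (log_RN \<omega>) + 1) \<le> (exp (log_RN \<omega>) - 1 - log_RN \<omega>) + (exp (log_RN \<omega>) * exp (- ?Z \<omega>) + exp (?Z \<omega>))"
        by linarith
      then have "ennreal ((exp (?Z \<omega>) - 1 - ?Z \<omega>) + (exp (log_RN \<omega>) + 1)) \<le> ennreal ((exp (log_RN \<omega>) - 1 - log_RN \<omega>) + (exp (log_RN \<omega>) * exp (- ?Z \<omega>) + exp (?Z \<omega>)))"
        by (rule ennreal_leI)
      moreover have "ennreal ((exp (?Z \<omega>) - 1 - ?Z \<omega>) + (exp (log_RN \<omega>) + 1)) = ennreal (exp (?Z \<omega>) - 1 - ?Z \<omega>) + (ennreal (exp (log_RN \<omega>)) + 1)"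
        by (subst ennreal_plus[OF exp_minus_self_nonneg]) auto
      moreover have "ennreal ((exp (log_RN \<omega>) - 1 - log_RN \<omega>) + (exp (log_RN \<omega>) * exp (- ?Z \<omega>) + exp (?Z \<omega>)))
         = ennreal (exp (log_RN \<omega>) - 1 - log_RN \<omega>) + (ennreal (exp (log_RN \<omega>) * exp (- ?Z \<omega>)) + ennreal (exp (?Z \<omega>)))"
        by (subst ennreal_plus[OF exp_minus_self_nonneg]) auto
      ultimately show ?thesis by simp
    qed
    have "(\<integral>\<^sup>+ \<omega>. ennreal (exp (?Z \<omega>) - 1 - ?Z \<omega>) \<partial>P) + 2 = (\<integral>\<^sup>+ \<omega>. ennreal (exp (?Z \<omega>) - 1 - ?Z \<omega>) + (ennreal (exp (log_RN \<omega>)) + 1) \<partial>P)"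
      using one mu.emeasure_space_1 by (simp add: nn_integral_add)
    \<comment> \<open>All terms are kept on the additive side, so that nothing infinite is
      subtracted; each of the two added pairs has integral 2 and cancels.\<close>
    also have "\<dots> \<le> (\<integral>\<^sup>+ \<omega>. ennreal (exp (log_RN \<omega>) - 1 - log_RN \<omega>) + (ennreal (exp (log_RN \<omega>) * exp (- ?Z \<omega>)) + ennreal (exp (?Z \<omega>))) \<partial>P)"
      by (rule nn_integral_mono) (rule pw)
    also have "\<dots> = ?L + 2"
      using one oneQ by (simp add: nn_integral_add)
    finally have "(\<integral>\<^sup>+ \<omega>. ennreal (exp (?Z \<omega>) - 1 - ?Z \<omega>) \<partial>P) \<le> ?L" by (simp add: add.commute[of _ 2])
    then show ?thesis unfolding nn_integral_psi_log_Z[OF e(1)] .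
  qed
  have "?R = (\<integral>\<^sup>+ x. liminf (\<lambda>n. ennreal (exp (trunc (\<epsilon> n) x) - 1 - trunc (\<epsilon> n) x)) \<partial>\<rho>)"
  proof (rule nn_integral_cong)
    fix x
    have "(\<lambda>n. ennreal (exp (trunc (\<epsilon> n) x) - 1 - trunc (\<epsilon> n) x)) \<longlonglongrightarrow> ennreal (\<phi> x - 1 - ln (\<phi> x))"
      using trunc_eventually[OF e(1,2), of x] by (intro tendsto_eventually) (auto elim!: eventually_mono simp: phi_pos)
    then show "ennreal (\<phi> x - 1 - ln (\<phi> x)) = liminf (\<lambda>n. ennreal (exp (trunc (\<epsilon> n) x) - 1 - trunc (\<epsilon> n) x))"
      by (rule lim_imp_Liminf[OF trivial_limit_sequentially, symmetric])
  qed
  also have "\<dots> \<le> liminf (\<lambda>n. \<integral>\<^sup>+ x. ennreal (exp (trunc (\<epsilon> n) x) - 1 - trunc (\<epsilon> n) x) \<partial>\<rho>)"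
    by (rule nn_integral_liminf) measurable
  also have "\<dots> \<le> liminf (\<lambda>n::nat. ?L)" by (intro Liminf_mono always_eventually allI lower)
  also have "\<dots> = ?L" by (simp add: Liminf_const)
  finally show "?R \<le> ?L" .
qed

text \<open>The positive part of \<open>log_RN\<close> lies below
  \<open>exp (log_RN \<omega>)\<close>, so \<open>?p\<close> is finite and the extended difference
  is never of the form infinity minus infinity; a pointwise identity gives
  \<open>?n = ?I + ?p\<close>.\<close>

lemma ext_expectation_log_RN:
  "ext_expectation P log_RN = - enn2ereal (\<integral>\<^sup>+ x. ennreal (\<phi> x - 1 - ln (\<phi> x)) \<partial>\<rho>)"
proof -
  let ?I = "\<integral>\<^sup>+ x. ennreal (\<phi> x - 1 - ln (\<phi> x)) \<partial>\<rho>"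
  let ?p = "\<integral>\<^sup>+ \<omega>. ennreal (log_RN \<omega>) \<partial>P" and ?n = "\<integral>\<^sup>+ \<omega>. ennreal (- log_RN \<omega>) \<partial>P"
  have one: "(\<integral>\<^sup>+ \<omega>. ennreal (exp (log_RN \<omega>)) \<partial>P) = 1"
    using nn_integral_eq_integral[OF exp_log_RN(1)] integral_exp_log_RN by auto
  have "?p \<le> (\<integral>\<^sup>+ \<omega>. ennreal (exp (log_RN \<omega>)) \<partial>P)"
  proof (rule nn_integral_mono)
    show "ennreal (log_RN \<omega>) \<le> ennreal (exp (log_RN \<omega>))" for \<omega>
      using exp_ge_add_one_self[of "log_RN \<omega>"] by (intro ennreal_leI) linarith
  qed
  then have pfin: "?p < \<infinity>" using one by (auto intro: le_less_trans)
  \<comment> \<open>Written without subtraction so that it integrates in \<open>ennreal\<close>,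
    where negative reals are sent to 0: the terms with \<open>log_RN\<close> and
    \<open>- log_RN\<close> are its positive and negative parts.\<close>
  have pw: "ennreal (exp (log_RN \<omega>) - 1 - log_RN \<omega>) + ennreal (log_RN \<omega>) + 1 = ennreal (exp (log_RN \<omega>)) + ennreal (- log_RN \<omega>)" for \<omega>
  proof -
    let ?l = "log_RN \<omega>"
    have "ennreal (exp ?l - 1 - ?l) + ennreal (max 0 ?l) + ennreal 1 = ennreal ((exp ?l - 1 - ?l) + max 0 ?l + 1)"
      by (simp only: ennreal_plus[OF add_nonneg_nonneg[OF exp_minus_self_nonneg max.cobounded1] zero_le_one]
          ennreal_plus[OF exp_minus_self_nonneg max.cobounded1])
    also have "(exp ?l - 1 - ?l) + max 0 ?l + 1 = exp ?l + max 0 (- ?l)" by (simp add: max_def)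
    also have "ennreal \<dots> = ennreal (exp ?l) + ennreal (max 0 (- ?l))" by (rule ennreal_plus) auto
    finally have *: "ennreal (exp ?l - 1 - ?l) + ennreal (max 0 ?l) + ennreal 1 = ennreal (exp ?l) + ennreal (max 0 (- ?l))" .
    have "ennreal (max 0 t) = ennreal t" for t by (simp add: max_def ennreal_neg)
    with * show ?thesis by (simp only: ennreal_1)
  qed
  have "?I + ?p + 1 = 1 + ?n"
  proof -
    have "?I + ?p + 1 = (\<integral>\<^sup>+ \<omega>. ennreal (exp (log_RN \<omega>) - 1 - log_RN \<omega>) + ennreal (log_RN \<omega>) + 1 \<partial>P)"
      unfolding nn_integral_psi_log_RN[symmetric] using mu.emeasure_space_1 by (simp add: nn_integral_add)
    also have "\<dots> = 1 + ?n" unfolding pw using one by (simp add: nn_integral_add)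
    finally show ?thesis .
  qed
  then have "1 + ?n = 1 + (?I + ?p)" by (simp add: add.commute)
  then have n: "?n = ?I + ?p" by (simp add: ennreal_add_left_cancel)
  show ?thesis
    unfolding ext_expectation_def n using pfin
    by (cases "?p"; cases "?I") (auto simp: enn2ereal_ennreal ennreal_plus[symmetric] simp del: ennreal_plus)
qed

text \<open>For \<open>\<bar>ln \<phi>\<bar> \<le> 1\<close> the integrand is at most
  \<open>7 * (sqrt \<phi> - 1)^2\<close>; elsewhere it differs from \<open>- ln \<phi>\<close> by
  \<open>\<phi> - 1\<close>, which obeys the same bound. So each integral is bounded by the other
  plus a finite amount.\<close>

lemma nn_integral_psi_finite_iff:
  "(\<integral>\<^sup>+ x. ennreal (\<phi> x - 1 - ln (\<phi> x)) \<partial>\<rho>) < \<infinity> \<longleftrightarrow>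
    (\<integral>\<^sup>+ x. indicator {y. \<bar>ln (\<phi> y)\<bar> > 1} x * ennreal \<bar>ln (\<phi> x)\<bar> \<partial>\<rho>) < \<infinity>" (is "?I < _ \<longleftrightarrow> ?J < _")
proof -
  let ?q = "\<lambda>x. 7 * (sqrt (\<phi> x) - 1)\<^sup>2"
  have qfin: "(\<integral>\<^sup>+ x. ennreal (?q x) \<partial>\<rho>) < \<infinity>"
    using L2 by (simp add: ennreal_mult nn_integral_cmult ennreal_mult_less_top)
  have lm[measurable]: "{y. \<bar>ln (\<phi> y)\<bar> > 1} \<in> sets M" using level_sets[of 1] by (simp add: level_def)
  have small: "\<phi> x - 1 - ln (\<phi> x) \<le> ?q x" if "\<not> 1 < \<bar>ln (\<phi> x)\<bar>" for x
  proof -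
    have "exp (ln (\<phi> x)) - 1 - ln (\<phi> x) \<le> 5 * (exp (ln (\<phi> x) / 2) - 1)\<^sup>2" using that by (intro exp_minus_1_minus_small) simp
    also have "\<dots> \<le> ?q x" by (simp add: sqrt_phi)
    finally show ?thesis using phi_pos[of x] by simp
  qed
  have big: "\<bar>\<phi> x - 1\<bar> \<le> ?q x" if "1 < \<bar>ln (\<phi> x)\<bar>" for x
    using exp_minus_1_big[OF that] phi_pos[of x] by (simp add: sqrt_phi)
  have psi0: "0 \<le> \<phi> x - 1 - ln (\<phi> x)" for x using exp_minus_self_nonneg[of "ln (\<phi> x)"] phi_pos[of x] by simp
  have "?I \<le> (\<integral>\<^sup>+ x. ennreal (?q x) + indicator {y. \<bar>ln (\<phi> y)\<bar> > 1} x * ennreal \<bar>ln (\<phi> x)\<bar> \<partial>\<rho>)"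
  proof (rule nn_integral_mono)
    fix x
    show "ennreal (\<phi> x - 1 - ln (\<phi> x)) \<le> ennreal (?q x) + indicator {y. \<bar>ln (\<phi> y)\<bar> > 1} x * ennreal \<bar>ln (\<phi> x)\<bar>"
    proof (cases "1 < \<bar>ln (\<phi> x)\<bar>")
      case True
      have "ennreal (\<phi> x - 1 - ln (\<phi> x)) \<le> ennreal (?q x + \<bar>ln (\<phi> x)\<bar>)" using big[OF True] by (intro ennreal_leI) linarith
      then show ?thesis using True by simp
    next
      case False
      then show ?thesis using small[OF False] by (simp add: ennreal_leI)
    qed
  qed
  also have "\<dots> = (\<integral>\<^sup>+ x. ennreal (?q x) \<partial>\<rho>) + ?J" by (rule nn_integral_add) auto
  finally have IJ: "?I \<le> (\<integral>\<^sup>+ x. ennreal (?q x) \<partial>\<rho>) + ?J" .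
  have "?J \<le> (\<integral>\<^sup>+ x. ennreal (?q x) + ennreal (\<phi> x - 1 - ln (\<phi> x)) \<partial>\<rho>)"
  proof (rule nn_integral_mono)
    fix x
    show "indicator {y. \<bar>ln (\<phi> y)\<bar> > 1} x * ennreal \<bar>ln (\<phi> x)\<bar> \<le> ennreal (?q x) + ennreal (\<phi> x - 1 - ln (\<phi> x))"
    proof (cases "1 < \<bar>ln (\<phi> x)\<bar>")
      case True
      have "ennreal \<bar>ln (\<phi> x)\<bar> \<le> ennreal (?q x + (\<phi> x - 1 - ln (\<phi> x)))" using big[OF True] psi0[of x] by (intro ennreal_leI) linarith
      then show ?thesis using True psi0[of x] by (simp add: ennreal_plus)
    next
      case False
      then show ?thesis by simp
    qed
  qed
  also have "\<dots> = (\<integral>\<^sup>+ x. ennreal (?q x) \<partial>\<rho>) + ?I" by (rule nn_integral_add) auto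
  finally have JI: "?J \<le> (\<integral>\<^sup>+ x. ennreal (?q x) \<partial>\<rho>) + ?I" .
  show ?thesis using IJ JI qfin by (auto intro: le_less_trans)
qed

end

theorem theorem3p2:
  fixes M :: "('a::polish_space) measure" and \<phi> :: "'a \<Rightarrow> real"
    and Pmu Pnu :: "('a \<Rightarrow> nat) measure"
  assumes sets_M: "sets M = sets borel"
    and sf: "sigma_finite_measure M"
    and na: "nonatomic M"
    and phi_meas: "\<phi> \<in> borel_measurable M"
    and phi_pos: "\<And>x. \<phi> x > 0"
    and L2: "(\<integral>\<^sup>+ x. ennreal ((sqrt (\<phi> x) - 1)\<^sup>2) \<partial>M) < \<infinity>"
    and Pmu: "poisson_measure M M Pmu"
    and Pnu: "poisson_measure M (density M (\<lambda>x. ennreal (\<phi> x))) Pnu"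
  defines "L \<equiv> (\<lambda>\<omega>. ln (enn2real (RN_deriv Pmu Pnu \<omega>)))"
  shows
    "absolutely_continuous Pmu Pnu
     \<and> (\<forall>\<delta>>0. ((\<lambda>\<epsilon>. measure Pmu {\<omega> \<in> space Pmu.
           \<bar>L \<omega> - (cnt_integral \<omega> (\<lambda>x. indicator {y. \<bar>ln (\<phi> y)\<bar> > \<epsilon>} x * ln (\<phi> x))
                   - (LINT x|M. indicator {y. \<bar>ln (\<phi> y)\<bar> > \<epsilon>} x * (\<phi> x - 1)))\<bar> > \<delta>})
           \<longlongrightarrow> 0) (at_right 0))
     \<and> L \<in> borel_measurable Pmu
     \<and> inf_div_with_levy (distr Pmu borel L)
         (density (distr M borel (\<lambda>x. ln (\<phi> x))) (indicator (UNIV - {0})))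
     \<and> ext_expectation Pmu L = - enn2ereal (\<integral>\<^sup>+ x. ennreal (\<phi> x - 1 - ln (\<phi> x)) \<partial>M)
     \<and> ext_expectation Pmu L \<le> 0
     \<and> (\<bar>ext_expectation Pmu L\<bar> \<noteq> \<infinity> \<longleftrightarrow>
          (\<integral>\<^sup>+ x. indicator {y. \<bar>ln (\<phi> y)\<bar> > 1} x * ennreal \<bar>ln (\<phi> x)\<bar> \<partial>M) < \<infinity>)"
proof -
  have sp: "space M = UNIV" using sets_eq_imp_space_eq[OF sets_M] by simp
  have pr: "prob_space Pmu" "prob_space Pnu" using Pmu Pnu by (auto simp: poisson_measure_def)
  \<comment> \<open>A density with finite values over a sigma-finite measure is again
    sigma-finite.\<close>
  have sf2: "sigma_finite_measure (density M (\<lambda>x. ennreal (\<phi> x)))"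
    by (subst sigma_finite_measure.sigma_finite_iff_density_finite[OF sf]) (use phi_meas in auto)
  interpret poisson_pair M M \<phi> Pmu Pnu
    by (intro poisson_pair.intro poisson_model.intro poisson_model_axioms.intro poisson_pair_axioms.intro
        pr sf sf2 sp Pmu Pnu phi_meas phi_pos L2)
  have L: "L = log_RN" by (rule ext) (simp add: L_def log_RN_def)
  have fin: "\<bar>ext_expectation Pmu log_RN\<bar> \<noteq> \<infinity> \<longleftrightarrow> (\<integral>\<^sup>+ x. ennreal (\<phi> x - 1 - ln (\<phi> x)) \<partial>M) < \<infinity>"
    unfolding ext_expectation_log_RN
    by (cases "\<integral>\<^sup>+ x. ennreal (\<phi> x - 1 - ln (\<phi> x)) \<partial>M") (auto simp: enn2ereal_ennreal)
  show ?thesis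
    unfolding L
  proof (intro conjI allI impI)
    show "absolutely_continuous Pmu Pnu" by (rule absolutely_continuous_PQ)
    show "((\<lambda>\<epsilon>. measure Pmu {\<omega> \<in> space Pmu.
           \<bar>log_RN \<omega> - (cnt_integral \<omega> (\<lambda>x. indicator {y. \<bar>ln (\<phi> y)\<bar> > \<epsilon>} x * ln (\<phi> x))
                   - (LINT x|M. indicator {y. \<bar>ln (\<phi> y)\<bar> > \<epsilon>} x * (\<phi> x - 1)))\<bar> > \<delta>}) \<longlongrightarrow> 0) (at_right 0)"
      if "0 < \<delta>" for \<delta> by (rule cnt_integral_tendsto_in_prob[OF that])
    show "log_RN \<in> borel_measurable Pmu" by (rule log_RN_measurable)
    show "inf_div_with_levy (distr Pmu borel log_RN) (density (distr M borel (\<lambda>x. ln (\<phi> x))) (indicator (UNIV - {0})))"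
      by (rule inf_div_log_RN)
    show "ext_expectation Pmu log_RN = - enn2ereal (\<integral>\<^sup>+ x. ennreal (\<phi> x - 1 - ln (\<phi> x)) \<partial>M)"
      by (rule ext_expectation_log_RN)
    then show "ext_expectation Pmu log_RN \<le> 0" by simp
    show "\<bar>ext_expectation Pmu log_RN\<bar> \<noteq> \<infinity> \<longleftrightarrow> (\<integral>\<^sup>+ x. indicator {y. \<bar>ln (\<phi> y)\<bar> > 1} x * ennreal \<bar>ln (\<phi> x)\<bar> \<partial>M) < \<infinity>"
      unfolding fin by (rule nn_integral_psi_finite_iff)
  qed
qed

end
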